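(* Let $\kappa_1,\kappa_2,\dots$ be formal indeterminates and $X(y)=\frac{1}{y}+\sum_{i\ge 1}\kappa_i y^{i-1}$. For an integer $g\ge 1$ let $W^{(g)}_{per}(x)=\sum_{n\ge1}\alpha^{(g)}_n x^{-n-1}$ be the generating function of permutations of genus $g$ in which every $i$-cycle is weighted by $\kappa_i$ (notation in the context). Then, as an identity of formal Laurent series in $y$, \[ W^{(g)}_{per}(X(y))=\sum_{l=1}^{g}\ \sum_{\substack{[a]\vdash g\\ [a]=(a_1,\dots,a_l)}}\frac{1}{\mathrm{sym}(a)}\left(-\frac{d}{dX(y)}\right)^{2g+l-1}\left(-\frac{1}{X'(y)}\prod_{i=1}^{l}\frac{X^{(2a_i)}(y)}{2^{2a_i}(2a_i+1)!}\right), \] where the inner sum runs over integer partitions $[a]$ of $g$ with exactly $l$ parts, and $\mathrm{sym}(a)=\prod_j k_j!$ with $k_j$ the number of parts of $[a]$ equal to $j$. Equivalently, for every $g\ge1$, $W^{(g)}_{per}(X(y))$ equals the coefficient of $\hbar^{2g-1}$ in \[ \sum_{m\ge 0}\left(-\frac{d}{dX(y)}\right)^{m}\left(-\frac{1}{X'(y)}\right)[u^m]\,\frac{\exp\!\Big(\frac{1}{\hbar}\int_{y-\hbar u/2}^{y+\hbar u/2}X(y')\,dy'-X(y)\,u\Big)}{\hbar u}. \]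
   Context: For $\sigma\in\mathcal S_n$ let $l(\sigma)$ be its number of disjoint cycles, and let $\zeta_n\in\mathcal S_n$ be the cyclic permutation $\zeta_n(i)=i+1 \bmod n$. The genus of $\sigma$ is defined by $2g(\sigma)=n+1-l(\sigma)-l(\sigma^{-1}\zeta_n)$. For an integer partition $[a]=(a_1,\dots,a_k)\vdash n$, let $D^{(g)}_{n,[a]}$ be the number of permutations of $\{1,\dots,n\}$ of genus $g$ and cycle type $[a]$, and set $\alpha^{(g)}_n=\sum_{[a]\vdash n}D^{(g)}_{n,[a]}\prod_i\kappa_{a_i}$. For $g\ge1$, $W^{(g)}_{per}(x)=\sum_{n\ge1}\alpha^{(g)}_n/x^{n+1}$, a formal power series in $1/x$. Since $1/X(y)=y\,(1+\sum_i\kappa_i y^i)^{-1}$ is a power series in $y$ with leading term $y$, $W^{(g)}_{per}(X(y))$ is a well-defined formal power series in $y$ with coefficients polynomial in the $\kappa_i$. The operator $\frac{d}{dX(y)}$ means $\frac{1}{X'(y)}\frac{d}{dy}$, and $X^{(k)}$ is the $k$-th derivative of $X$ in $y$; $1/X'(y)=-y^2(1-\sum_i(i-1)\kappa_i y^i)^{-1}$ is a power series. In the second formula, the exponent is interpreted through its Taylor expansion in $\hbar u$: $\frac{1}{\hbar}\int_{y-\hbar u/2}^{y+\hbar u/2}X(y')dy'-X(y)u=\sum_{k\ge1}\frac{\hbar^{2k}u^{2k+1}X^{(2k)}(y)}{2^{2k}(2k+1)!}$, and $[u^m]$ denotes extraction of the coefficient of $u^m$. *)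

theory Defs
  imports
    "HOL-Combinatorics.Orbits"
    "HOL-Library.Multiset"
    "HOL-Computational_Algebra.Formal_Laurent_Series"
    "HOL-Computational_Algebra.Fraction_Field"
begin

unbundle fps_syntax

section \<open>Permutations: cycles, genus, weighted counts\<close>

text \<open>
  Fixed points count as cycles of length one, also in the cycle type.
\<close>

definition cycles :: "nat \<Rightarrow> (nat \<Rightarrow> nat) \<Rightarrow> nat set set" where
  "cycles n \<sigma> = orbit \<sigma> ` {1..n}"

definition num_cycles :: "nat \<Rightarrow> (nat \<Rightarrow> nat) \<Rightarrow> nat" where
  "num_cycles n \<sigma> = card (cycles n \<sigma>)"

definition cycle_type :: "nat \<Rightarrow> (nat \<Rightarrow> nat) \<Rightarrow> nat multiset" where
  "cycle_type n \<sigma> = image_mset card (mset_set (cycles n \<sigma>))"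

definition zeta :: "nat \<Rightarrow> nat \<Rightarrow> nat" where
  "zeta n i = (if i \<in> {1..n} then i mod n + 1 else i)"

text \<open>
  The genus is taken as a rational number, so that no parity or sign information is lost
  by truncating subtraction or integer division.
\<close>

definition genus :: "nat \<Rightarrow> (nat \<Rightarrow> nat) \<Rightarrow> rat" where
  "genus n \<sigma> =
     (of_nat n + 1 - of_nat (num_cycles n \<sigma>) - of_nat (num_cycles n (inv \<sigma> \<circ> zeta n))) / 2"

definition int_partitions :: "nat \<Rightarrow> nat multiset set" where
  "int_partitions n = {a. 0 \<notin># a \<and> sum_mset a = n}"

lemma finite_int_partitions: "finite (int_partitions n)"
proof (rule finite_subset)
  have "size a \<le> sum_mset a" if "0 \<notin># a" for a :: "nat multiset"
    using that by (induction a) auto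
  moreover have "x \<le> sum_mset a" if "x \<in># a" for x and a :: "nat multiset"
    using that by (metis le_add1 mset_add sum_mset.add_mset)
  ultimately show "int_partitions n \<subseteq> (\<Union>k\<le>n. multisets_of_size {..n} k)"
    by (auto simp: int_partitions_def multisets_of_size_def)
  show "finite (\<Union>k\<le>n. multisets_of_size {..n} k)"
    by auto
qed

definition D_count :: "nat \<Rightarrow> nat \<Rightarrow> nat multiset \<Rightarrow> nat" where
  "D_count g n a =
     card {\<sigma>. \<sigma> permutes {1..n} \<and> genus n \<sigma> = of_nat g \<and> cycle_type n \<sigma> = a}"

text \<open>
  The indeterminates \<open>\<kappa>\<^sub>1, \<kappa>\<^sub>2, \<dots>\<close> are an arbitrary sequence in an arbitrary field of
  characteristic zero; the value \<open>\<kappa> 0\<close> is never used.  Genuine indeterminates are the case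
  of the field \<open>((nat \<Rightarrow>\<^sub>0 nat) \<Rightarrow>\<^sub>0 rat) fract\<close> of rational functions in countably many variables
  (with the polynomial mappings of the HOL library), which the following instance puts in the
  required class, and \<open>\<kappa> i = Fract (Poly_Mapping.single (Poly_Mapping.single i 1) 1) 1\<close>.
\<close>

instance fract :: ("{idom,ring_char_0}") field_char_0
proof
  show "inj (of_nat :: nat \<Rightarrow> 'a fract)"
    by (auto intro!: injI simp: of_nat_fract eq_fract)
qed

definition alpha :: "(nat \<Rightarrow> 'a::field_char_0) \<Rightarrow> nat \<Rightarrow> nat \<Rightarrow> 'a" where
  "alpha \<kappa> g n = (\<Sum>a\<in>int_partitions n. of_nat (D_count g n a) * (\<Prod>i\<in>#a. \<kappa> i))"

text \<open>The power series variable of \<open>W_per \<kappa> g\<close> stands for \<open>1/x\<close>.\<close>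

definition W_per :: "(nat \<Rightarrow> 'a::field_char_0) \<Rightarrow> nat \<Rightarrow> 'a fps" where
  "W_per \<kappa> g = Abs_fps (\<lambda>j. if j \<ge> 2 then alpha \<kappa> g (j - 1) else 0)"

section \<open>The Laurent series \<open>X(y)\<close> and substitution of it\<close>

definition X_ser :: "(nat \<Rightarrow> 'a::field_char_0) \<Rightarrow> 'a fls" where
  "X_ser \<kappa> = fls_X_inv + fps_to_fls (Abs_fps (\<lambda>j. \<kappa> (j + 1)))"

text \<open>
  Substituting \<open>x = X(y)\<close> in a power series in \<open>1/x\<close> means composing it with \<open>1/X(y)\<close>, which
  is a power series in \<open>y\<close> without constant term.
\<close>

definition subst_X :: "(nat \<Rightarrow> 'a::field_char_0) \<Rightarrow> 'a fps \<Rightarrow> 'a fls" where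
  "subst_X \<kappa> W = fps_to_fls (W oo fls_regpart (inverse (X_ser \<kappa>)))"

lemma fls_subdegree_X_ser: "fls_subdegree (X_ser \<kappa>) = -1"
  by (rule fls_subdegree_eqI) (auto simp: X_ser_def)

lemma fps_to_fls_regpart_inverse_X_ser:
  "fps_to_fls (fls_regpart (inverse (X_ser \<kappa>))) = inverse (X_ser \<kappa>)"
  by (rule fls_regpart_to_fls_trivial) (simp add: fls_subdegree_X_ser)

lemma fls_regpart_inverse_X_ser_nth_0: "fls_regpart (inverse (X_ser \<kappa>)) $ 0 = 0"
  using fls_eq0_below_subdegree[of 0 "inverse (X_ser \<kappa>)"]
  by (simp add: fls_subdegree_X_ser)

definition d_dX :: "(nat \<Rightarrow> 'a::field_char_0) \<Rightarrow> 'a fls \<Rightarrow> 'a fls" where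
  "d_dX \<kappa> F = 1 / fls_deriv (X_ser \<kappa>) * fls_deriv F"

text \<open>\<open>X_coeff \<kappa> k\<close> is \<open>X\<^sup>(\<^sup>2\<^sup>k\<^sup>)(y) / (2\<^sup>2\<^sup>k (2k+1)!)\<close>.\<close>

definition X_coeff :: "(nat \<Rightarrow> 'a::field_char_0) \<Rightarrow> nat \<Rightarrow> 'a fls" where
  "X_coeff \<kappa> k = (fls_deriv ^^ (2 * k)) (X_ser \<kappa>) / (2 ^ (2 * k) * fact (2 * k + 1))"

definition sym_factor :: "nat multiset \<Rightarrow> nat" where
  "sym_factor a = (\<Prod>j\<in>set_mset a. fact (count a j))"

section \<open>The generating function in \<open>\<hbar>\<close> and \<open>u\<close>\<close>

text \<open>
  Series in \<open>\<hbar>\<close> are Laurent series over Laurent series in \<open>y\<close>, of type \<open>'a fls fls\<close>, with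
  \<open>\<hbar>\<close> the outer variable; \<open>u\<close> is a further variable outside of \<open>\<hbar>\<close>.  The exponent is the
  Taylor expansion
  \<open>\<Sum>k\<ge>1. \<hbar>\<^sup>2\<^sup>k u\<^sup>2\<^sup>k\<^sup>+\<^sup>1 X\<^sup>(\<^sup>2\<^sup>k\<^sup>)(y) / (2\<^sup>2\<^sup>k (2k+1)!)\<close> of
  \<open>1/\<hbar> \<integral> X(y') dy' - X(y) u\<close>, the integral being over \<open>[y - \<hbar>u/2, y + \<hbar>u/2]\<close>.
\<close>

definition exponent_ser :: "(nat \<Rightarrow> 'a::field_char_0) \<Rightarrow> 'a fls fls fps" where
  "exponent_ser \<kappa> =
     Abs_fps (\<lambda>j. if odd j \<and> j \<ge> 3
                  then fls_const (X_coeff \<kappa> (j div 2)) * fls_X ^ (2 * (j div 2)) else 0)"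

definition exp_over_hu :: "(nat \<Rightarrow> 'a::field_char_0) \<Rightarrow> 'a fls fls fls" where
  "exp_over_hu \<kappa> =
     fps_to_fls (fps_exp 1 oo exponent_ser \<kappa>) / (fls_const fls_X * fls_X)"

text \<open>
  An operator on Laurent series in \<open>y\<close> acts on series in \<open>\<hbar>\<close> coefficientwise.
\<close>

definition hbar_lift :: "('b::zero \<Rightarrow> 'b) \<Rightarrow> 'b fls \<Rightarrow> 'b fls" where
  "hbar_lift f F = Abs_fls (\<lambda>k. f (F $$ k))"

lemma hbar_lift_nth:
  assumes "f 0 = 0"
  shows "hbar_lift f F $$ k = f (F $$ k)"
  unfolding hbar_lift_def
  by (rule nth_Abs_fls_lower_bound[of "fls_subdegree F"]) (simp add: assms)

text \<open>
  The sum of these terms over \<open>m\<close> is to be taken in the topology of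
  \<open>'a fls fls\<close>, which is the \<open>\<hbar>\<close>-adic one.
\<close>

definition hbar_term :: "(nat \<Rightarrow> 'a::field_char_0) \<Rightarrow> nat \<Rightarrow> 'a fls fls" where
  "hbar_term \<kappa> m =
     (hbar_lift (\<lambda>F. - d_dX \<kappa> F) ^^ m)
       (fls_const (- (1 / fls_deriv (X_ser \<kappa>))) * exp_over_hu \<kappa> $$ int m)"

end

theory Submission
  imports Defs "HOL-Combinatorics.Multiset_Permutations"
begin

text \<open>
  A Laurent series \<open>F\<close> without terms of degree below \<open>1\<close> is determined by the residues of
  \<open>X\<^sup>n X' F\<close>, and under this pairing the powers of \<open>- d/dX\<close> become falling factorials.  The formula
  is thereby equivalent to
  \<open>\<alpha>\<^sub>n\<^sup>(\<^sup>g\<^sup>) = n!/r! Res [u\<^sup>n\<^sup>+\<^sup>1] S(u)\<^sup>r\<close> with \<open>r = n + 1 - 2g\<close>, where \<open>S(u)\<close> is the integral of \<open>X\<close>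
  over \<open>[y - u/2, y + u/2]\<close>.  Substituting \<open>u = y v\<close> and expanding in the \<open>\<kappa>\<^sub>i\<close> reduces this to the
  enumeration of the permutations \<open>\<sigma>\<close> of cycle type \<open>a\<close> by the number of cycles of
  \<open>\<sigma>\<^sup>-\<^sup>1 \<zeta>\<close>: with \<open>N\<close> marking these cycles, one needs that
  the sum of \<open>N\<^sup>l\<close> over all cyclic \<open>\<zeta>\<close>, for a fixed \<open>\<sigma>\<close>, is \<open>(n - 1)!\<close> times the coefficient of
  \<open>v\<^sup>n\<^sup>+\<^sup>1\<close> in
  \<open>((1 + v/2) / (1 - v/2))\<^sup>N \<Prod>\<^sub>i ((1 + v/2)\<^sup>i - (1 - v/2)\<^sup>i)\<close>, the product being over the
  cycle lengths \<open>i\<close> of \<open>\<sigma>\<close>.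
  The cyclic permutations are detected by a signed sum over invariant subsets, which makes all
  other contributions computable or cancel.
\<close>

section \<open>Orbits of permutations\<close>

text \<open>The weight \<open>card S\<close> is additive over cycles, so its alternating sum over
  unions of cycles survives for a single cycle only; this is what detects cyclicity. For fixed
  \<open>S\<close> the sum over the \<open>\<zeta>\<close> preserving \<open>S\<close> is
  alternating on \<open>S\<close> and symmetric on its complement, from both sides. Up to sign it
  depends only on the double coset of \<open>\<omega>\<close>, that is, on how many points of
  \<open>S\<close> leave it: none and one give explicit products, two or more give zero. The genus
  refers to one fixed \<open>\<zeta>\<close>, whereas this count fixes \<open>\<sigma>\<close> and
  lets \<open>\<zeta>\<close> vary. Summing over all \<open>\<sigma>\<close> of one cycle type as
  well removes the difference, because all cyclic permutations are conjugate. A single genus is then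
  isolated by comparing coefficients of polynomials in \<open>N\<close>. Partitions of
  \<open>n\<close> turn into partitions of \<open>g\<close> by reading one power of a double series
  in \<open>y\<close> and \<open>v\<close> in both orders: by powers of \<open>y\<close> the indices
  are cycle lengths, by powers of \<open>v\<close> they are orders of derivatives of
  \<open>X\<close>.\<close>

lemma orbit_eq_permutation:
  assumes "permutation p" "y \<in> orbit p x"
  shows "orbit p y = orbit p x"
  using assms by (meson cyclic_on_orbit' orbit_cyclic_eq3)

lemma orbits_eq_or_disjoint:
  assumes "permutation p"
  shows "orbit p x = orbit p y \<or> orbit p x \<inter> orbit p y = {}"
  using orbit_eq_permutation[OF assms] by blast

text \<open>Only the arrows into \<open>x\<close> and \<open>y\<close> are redirected. The cycle of
  \<open>y\<close> has no arrow into \<open>x\<close>, so a walk from \<open>y\<close> traverses all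
  of it before its closing arrow is met.\<close>

lemma orbit_transpose_comp_subset:
  assumes p: "permutation p" and x: "x \<notin> orbit p y"
  shows "orbit p y \<subseteq> orbit (transpose x y \<circ> p) y"
proof
  let ?M = "transpose x y \<circ> p"
  have M: "permutation ?M" by (simp add: p permutation_compose permutation_swap_id)
  have yM: "y \<in> orbit ?M y" by (rule permutation_self_in_orbit[OF M])
  have step: "p w \<in> orbit ?M y" if "w \<in> orbit p y" "w \<in> orbit ?M y" for w
  proof (cases "p w = y")
    case False
    have "p w \<noteq> x" using that x by (auto intro: orbit.step)
    with False have "?M w = p w" by simp
    then show ?thesis using that by (metis orbit.step)
  qed (simp add: yM)
  fix w assume "w \<in> orbit p y"
  then show "w \<in> orbit ?M y"
  proof induct
    case base
    show ?case by (rule step[OF permutation_self_in_orbit[OF p] yM])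
  next
    case (step w)
    then show ?case by (rule \<open>\<And>w. w \<in> orbit p y \<Longrightarrow> w \<in> orbit ?M y \<Longrightarrow> p w \<in> orbit ?M y\<close>)
  qed
qed

text \<open>The closing arrows of two disjoint cycles are exchanged, which joins the cycles into
  one; every other cycle keeps its arrows.\<close>

lemma orbit_transpose_comp:
  assumes p: "permutation p" and x: "x \<notin> orbit p y"
  shows "orbit (transpose x y \<circ> p) z =
    (if z \<in> orbit p x \<union> orbit p y then orbit p x \<union> orbit p y else orbit p z)"
proof -
  let ?M = "transpose x y \<circ> p"
  have M: "permutation ?M" by (simp add: p permutation_compose permutation_swap_id)
  have y: "y \<notin> orbit p x" using x p by (metis orbit_swap permutation_self_in_orbit)
  have sub: "orbit p y \<subseteq> orbit ?M y" "orbit p x \<subseteq> orbit ?M x"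
    using orbit_transpose_comp_subset[OF p x] orbit_transpose_comp_subset[OF p y]
    by (simp_all add: transpose_commute)
  have "x \<in> orbit ?M y"
  proof -
    \<comment> \<open>The predecessor \<open>inv p y\<close> lies on the cycle of \<open>y\<close>,
      and its new image is \<open>x\<close>: this is the link between the two cycles.\<close>
    obtain w where w: "w \<in> orbit p y" "p w = y"
      by (rule that[of "inv p y"]) (use p in \<open>auto simp: orbit_inv_eq[symmetric] permutation_inverse_works
          bij_inv_eq_iff permutation_bijective surj_f_inv_f bij_is_surj intro: orbit.base\<close>)
    then have "?M w = x" by simp
    then show ?thesis using w sub by (metis orbit.step subsetD)
  qed
  then have eq: "orbit ?M x = orbit ?M y" by (rule orbit_eq_permutation[OF M])
  have closed: "?M w \<in> orbit p x \<union> orbit p y" if "w \<in> orbit p x \<union> orbit p y" for w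
    using that permutation_self_in_orbit[OF p] by (auto simp: transpose_def intro: orbit.step)
  have le: "orbit ?M w \<subseteq> orbit p x \<union> orbit p y" if w: "w \<in> orbit p x \<union> orbit p y" for w
  proof
    fix v assume "v \<in> orbit ?M w"
    then show "v \<in> orbit p x \<union> orbit p y" by induct (use closed w in blast)+
  qed
  show ?thesis
  proof (cases "z \<in> orbit p x \<union> orbit p y")
    case True
    then have "z \<in> orbit ?M x \<union> orbit ?M y" using sub by blast
    then have "orbit ?M z = orbit ?M y" using eq orbit_eq_permutation[OF M] by blast
    then have "orbit p x \<union> orbit p y \<subseteq> orbit ?M z" using sub eq by auto
    with le[OF True] True show ?thesis by auto
  next
    case False
    have "?M s = p s" if "s \<in> orbit p z" for s
    proof -
      have "p s \<in> orbit p z" using that by (rule orbit.step)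
      then have "p s \<noteq> x" "p s \<noteq> y" using False by (metis UnCI orbit_eq_permutation p permutation_self_in_orbit)+
      then show ?thesis by simp
    qed
    then have "orbit ?M z = orbit p z" by (intro orbit_cong permutation_self_in_orbit[OF p])
    with False show ?thesis by (auto simp only: if_False)
  qed
qed

text \<open>The set \<open>A\<close> need not be invariant. For a set with one exit the number
  obtained is that of the cycles meeting the set, and it is used in this sense below.\<close>

definition num_orbits :: "'a set \<Rightarrow> ('a \<Rightarrow> 'a) \<Rightarrow> nat" where
  "num_orbits A p = card (orbit p ` A)"

text \<open>Since \<open>a\<close> is a fixed point of \<open>p\<close>, joining its cycle to that
  of \<open>b\<close> inserts \<open>a\<close> into the latter.\<close>

lemma orbits_insert_transpose:
  assumes p: "p permutes A" and A: "finite A" and a: "a \<notin> A" and b: "b \<in> A"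
  shows "orbit (transpose a b \<circ> p) ` insert a A = insert (insert a (orbit p b)) (orbit p ` A - {orbit p b})"
    and "insert a (orbit p b) \<notin> orbit p ` A - {orbit p b}"
proof -
  have P: "permutation p" using A p by (rule permutes_imp_permutation)
  have oa: "orbit p a = {a}" using p a by (simp add: orbit_eq_singleton_iff permutes_not_in)
  have sub: "orbit p z \<subseteq> A" if "z \<in> A" for z using p that by (rule permutes_orbit_subset)
  have anot: "a \<notin> orbit p b" using sub[OF b] a by auto
  have o: "orbit (transpose a b \<circ> p) z =
    (if z = a \<or> z \<in> orbit p b then insert a (orbit p b) else orbit p z)" for z
    using orbit_transpose_comp[OF P anot, of z] by (simp add: oa)
  have eq: "orbit p z = orbit p b" if "z \<in> orbit p b" for z
    using that by (rule orbit_eq_permutation[OF P])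
  have self: "z \<in> orbit p z" for z by (rule permutation_self_in_orbit[OF P])
  show "orbit (transpose a b \<circ> p) ` insert a A = insert (insert a (orbit p b)) (orbit p ` A - {orbit p b})"
  proof (intro equalityI subsetI)
    fix S assume "S \<in> orbit (transpose a b \<circ> p) ` insert a A"
    then obtain z where z: "z \<in> insert a A" "S = orbit (transpose a b \<circ> p) z" by blast
    then show "S \<in> insert (insert a (orbit p b)) (orbit p ` A - {orbit p b})"
      using self[of z] by (cases "z = a \<or> z \<in> orbit p b") (auto simp: o)
  next
    fix S assume S: "S \<in> insert (insert a (orbit p b)) (orbit p ` A - {orbit p b})"
    show "S \<in> orbit (transpose a b \<circ> p) ` insert a A"
    proof (cases "S = insert a (orbit p b)")
      case True
      then show ?thesis using o[of a] by (metis imageI insertI1)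
    next
      case False
      with S obtain z where z: "z \<in> A" "S = orbit p z" "orbit p z \<noteq> orbit p b" by blast
      then have "S = orbit (transpose a b \<circ> p) z" using eq[of z] a o[of z] by metis
      with z show ?thesis by blast
    qed
  qed
  show "insert a (orbit p b) \<notin> orbit p ` A - {orbit p b}" using sub a by blast
qed

lemma orbits_insert_fixed:
  assumes p: "p permutes A" and a: "a \<notin> A"
  shows "orbit p ` insert a A = insert {a} (orbit p ` A)" "{a} \<notin> orbit p ` A"
proof -
  have oa: "orbit p a = {a}" using p a by (simp add: orbit_eq_singleton_iff permutes_not_in)
  show "orbit p ` insert a A = insert {a} (orbit p ` A)" by (simp add: oa)
  show "{a} \<notin> orbit p ` A" using permutes_orbit_subset[OF p] a by blast
qed

text \<open>The recursion behind the inductions over finite sets: the permutations of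
  \<open>insert a A\<close> are the products \<open>transpose a b \<circ> p\<close>, and only
  \<open>b = a\<close> opens a new cycle.\<close>

lemma num_orbits_insert:
  assumes p: "p permutes A" and A: "finite A" and a: "a \<notin> A" and b: "b \<in> insert a A"
  shows "num_orbits (insert a A) (transpose a b \<circ> p) = num_orbits A p + (if b = a then 1 else 0)"
proof (cases "b = a")
  case True
  then show ?thesis using orbits_insert_fixed[OF p a] A by (simp add: num_orbits_def)
next
  case False
  with b have b: "b \<in> A" by simp
  have "card (orbit p ` A) > 0" using b A by (auto simp: card_gt_0_iff)
  then show ?thesis using orbits_insert_transpose[OF p A a b] A b False
    by (simp add: num_orbits_def card_Diff_singleton)
qed

lemma sign_eq_num_orbits:
  assumes "finite A" "p permutes A"
  shows "sign p = (- 1) ^ (card A + num_orbits A p)"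
  using assms
proof (induction A arbitrary: p rule: finite_induct)
  case empty
  then show ?case by (simp add: num_orbits_def)
next
  case (insert a A)
  from insert.prems obtain b q where q: "p = transpose a b \<circ> q" "b \<in> insert a A" "q permutes A"
  proof -
    have "p \<in> {p. p permutes insert a A}" using insert.prems by simp
    then show ?thesis unfolding permutes_insert by (auto simp del: insert_iff intro: that)
  qed
  have "permutation q" using q insert.hyps by (auto intro: permutes_imp_permutation)
  then have "sign p = sign (transpose a b) * sign q"
    using q by (simp add: sign_compose permutation_swap_id)
  then have *: "sign p = (if b = a then 1 else - 1) * sign q" by (simp add: sign_swap_id)
  have **: "num_orbits (insert a A) p = num_orbits A q + (if b = a then 1 else 0)"
    unfolding q(1) by (rule num_orbits_insert[OF q(3) insert.hyps(1,2) q(2)])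
  show ?case unfolding * ** using insert.IH[OF q(3)] insert.hyps by simp
qed

section \<open>Conjugation and restriction\<close>

lemma orbit_conjugate:
  assumes "bij h"
  shows "orbit (h \<circ> p \<circ> inv h) (h x) = h ` orbit p x"
proof -
  have "((h \<circ> p \<circ> inv h) ^^ n) (h x) = h ((p ^^ n) x)" for n
    using assms by (induction n) (simp_all add: bij_is_inj)
  then show ?thesis by (auto simp: orbit_altdef)
qed

lemma orbits_conjugate:
  assumes "h permutes A"
  shows "orbit (h \<circ> p \<circ> inv h) ` A = (`) h ` orbit p ` A"
proof -
  have "orbit (h \<circ> p \<circ> inv h) ` h ` A = (`) h ` orbit p ` A"
    by (simp add: image_image orbit_conjugate[OF permutes_bij[OF assms]])
  then show ?thesis using permutes_image[OF assms] by simp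
qed

lemma num_orbits_conjugate:
  assumes "h permutes A"
  shows "num_orbits A (h \<circ> p \<circ> inv h) = num_orbits A p"
  unfolding num_orbits_def orbits_conjugate[OF assms]
  by (rule card_image) (metis assms inj_on_def inj_image_eq_iff permutes_inj)

text \<open>The two products are conjugate by \<open>h\<close>. In the manipulation of
  \<open>signed_sum\<close> this has the role of the cyclicity of the trace.\<close>

lemma num_orbits_comp_commute:
  assumes "h permutes A"
  shows "num_orbits A (p \<circ> h) = num_orbits A (h \<circ> p)"
proof -
  have "h \<circ> (p \<circ> h) \<circ> inv h = h \<circ> p \<circ> (h \<circ> inv h)" by (simp only: o_assoc)
  also have "\<dots> = h \<circ> p" using permutes_inv_o(1)[OF assms] by simp
  finally show ?thesis using num_orbits_conjugate[OF assms, of "p \<circ> h"] by simp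
qed

lemma num_orbits_perm_restrict:
  assumes "finite A" "p permutes A" "p ` S = S" "S \<subseteq> A" 
  shows "num_orbits S (perm_restrict p S) = num_orbits S p"
proof -
  have "orbit (perm_restrict p S) x = orbit p x" if "x \<in> S" for x
  proof (rule sym, rule orbit_cong0[of _ S])
    show "p \<in> S \<rightarrow> S" using assms(3) by auto
  qed (use that in \<open>auto simp: perm_restrict_def\<close>)
  then show ?thesis by (simp add: num_orbits_def cong: image_cong)
qed

section \<open>Signed sums over products of two symmetric groups\<close>

lemma permutes_disjoint_comp_commute:
  assumes "p permutes S" "q permutes T" "S \<inter> T = {}"
  shows "p \<circ> q = q \<circ> p"
proof
  fix x
  consider "x \<in> S" | "x \<in> T" | "x \<notin> S" "x \<notin> T" by blast
  then show "(p \<circ> q) x = (q \<circ> p) x"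
  proof cases
    case 1
    moreover have "p x \<in> S" using 1 permutes_in_image[OF assms(1)] by simp
    ultimately have "x \<notin> T" "p x \<notin> T" using assms(3) by blast+
    then show ?thesis using assms by (simp add: permutes_not_in)
  next
    case 2
    moreover have "q x \<in> T" using 2 permutes_in_image[OF assms(2)] by simp
    ultimately have "x \<notin> S" "q x \<notin> S" using assms(3) by blast+
    then show ?thesis using assms by (simp add: permutes_not_in)
  qed (use assms in \<open>simp add: permutes_not_in\<close>)
qed

text \<open>Each new point of \<open>T\<close> either forms a cycle of its own, with factor
  \<open>x\<close>, or is inserted at a point of \<open>U\<close> or at an earlier point of
  \<open>T\<close>; hence the factors. As \<open>card U \<le> 1\<close>, the identity is the only
  permutation of \<open>U\<close>, which starts the induction. The two possible sizes of
  \<open>U\<close> serve the values of \<open>signed_sum\<close> at \<open>id\<close> and at a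
  transposition.\<close>

lemma sum_power_num_orbits_extend:
  fixes x :: "'b::comm_ring_1"
  assumes "finite T" "finite S" "S \<inter> T = {}" "U \<subseteq> S" "card U \<le> 1" "\<rho> permutes S"
  shows "(\<Sum>\<tau> | \<tau> permutes (U \<union> T). x ^ num_orbits (S \<union> T) (\<tau> \<circ> \<rho>)) =
    x ^ num_orbits S \<rho> * (\<Prod>i<card T. x + of_nat (card U + i))"
  using assms(1,3)
proof (induction T rule: finite_induct)
  case empty
  have "finite U" using assms finite_subset by blast
  then have "U = {} \<or> (\<exists>u. U = {u})" using assms(5) by (auto simp: le_Suc_eq card_1_singleton_iff)
  then have "{\<tau>. \<tau> permutes U} = {id}" by auto
  then show ?case by simp
next
  case (insert t T)
  have fin: "finite U" "finite (U \<union> T)" "U \<inter> T = {}"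
    using assms insert finite_subset[of U S] by auto
  have t: "t \<notin> U \<union> T" "t \<notin> S \<union> T" using insert assms by auto
  have "(\<Sum>\<tau> | \<tau> permutes (U \<union> insert t T). x ^ num_orbits (S \<union> insert t T) (\<tau> \<circ> \<rho>)) =
    (\<Sum>b\<in>insert t (U \<union> T). \<Sum>q | q permutes (U \<union> T).
       x ^ num_orbits (insert t (S \<union> T)) (transpose t b \<circ> (q \<circ> \<rho>)))"
    using sum_over_permutations_insert[OF fin(2) t(1),
        of "\<lambda>\<tau>. x ^ num_orbits (insert t (S \<union> T)) (\<tau> \<circ> \<rho>)"] by (simp add: o_assoc)
  also have "\<dots> = (\<Sum>b\<in>insert t (U \<union> T). \<Sum>q | q permutes (U \<union> T).
       (if b = t then x else 1) * x ^ num_orbits (S \<union> T) (q \<circ> \<rho>))"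
  proof (intro sum.cong refl)
    fix b q assume b: "b \<in> insert t (U \<union> T)" and q: "q \<in> {q. q permutes (U \<union> T)}"
    have "q \<circ> \<rho> permutes S \<union> T"
      by (rule permutes_compose) (use q assms in \<open>auto intro: permutes_subset\<close>)
    then have "num_orbits (insert t (S \<union> T)) (transpose t b \<circ> (q \<circ> \<rho>)) =
        num_orbits (S \<union> T) (q \<circ> \<rho>) + (if b = t then 1 else 0)"
      by (rule num_orbits_insert) (use assms insert b t in auto)
    then show "x ^ num_orbits (insert t (S \<union> T)) (transpose t b \<circ> (q \<circ> \<rho>)) =
        (if b = t then x else 1) * x ^ num_orbits (S \<union> T) (q \<circ> \<rho>)" by simp
  qed
  also have "\<dots> = (\<Sum>b\<in>insert t (U \<union> T). if b = t then x else 1) *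
      (\<Sum>q | q permutes (U \<union> T). x ^ num_orbits (S \<union> T) (q \<circ> \<rho>))"
    by (simp add: sum_product)
  also have "(\<Sum>b\<in>insert t (U \<union> T). if b = t then x else 1) = x + (\<Sum>b\<in>U \<union> T. if b = t then x else 1)"
    using fin t by simp
  also have "(\<Sum>b\<in>U \<union> T. if b = t then x else 1) = (\<Sum>b\<in>U \<union> T. 1)"
    by (rule sum.cong) (use t in auto)
  also have "x + \<dots> = x + of_nat (card U + card T)"
    using fin insert.hyps(1) by (simp add: card_Un_disjoint)
  finally show ?case using insert by (simp add: mult_ac)
qed

text \<open>An insertion into an existing cycle costs a transposition, hence a factor
  \<open>- 1\<close> for each point already present, against \<open>x\<close> for a new
  cycle.\<close>

lemma sum_sign_power_num_orbits:
  fixes x :: "'b::comm_ring_1"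
  assumes "finite S"
  shows "(\<Sum>\<rho> | \<rho> permutes S. of_int (sign \<rho>) * x ^ num_orbits S \<rho>) = (\<Prod>i<card S. x - of_nat i)"
  using assms
proof (induction S rule: finite_induct)
  case empty
  then show ?case by (simp add: num_orbits_def)
next
  case (insert a S)
  have "(\<Sum>\<rho> | \<rho> permutes insert a S. of_int (sign \<rho>) * x ^ num_orbits (insert a S) \<rho>) =
    (\<Sum>b\<in>insert a S. \<Sum>q | q permutes S.
       of_int (sign (transpose a b \<circ> q)) * x ^ num_orbits (insert a S) (transpose a b \<circ> q))"
    by (rule sum_over_permutations_insert) (use insert in auto)
  also have "\<dots> = (\<Sum>b\<in>insert a S. \<Sum>q | q permutes S.
       (if b = a then x else - 1) * (of_int (sign q) * x ^ num_orbits S q))"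
  proof (intro sum.cong refl)
    fix b q assume b: "b \<in> insert a S" and q: "q \<in> {q. q permutes S}"
    have "permutation q" using q insert.hyps by (auto intro: permutes_imp_permutation)
    then have "sign (transpose a b \<circ> q) = (if b = a then 1 else - 1) * sign q"
      by (simp add: sign_compose permutation_swap_id sign_swap_id)
    then show "of_int (sign (transpose a b \<circ> q)) * x ^ num_orbits (insert a S) (transpose a b \<circ> q) =
       (if b = a then x else - 1) * (of_int (sign q) * x ^ num_orbits S q)"
      using num_orbits_insert[of q S a b] b q insert.hyps by simp
  qed
  also have "\<dots> = (\<Sum>b\<in>insert a S. if b = a then x else - 1) *
      (\<Sum>q | q permutes S. of_int (sign q) * x ^ num_orbits S q)"
    by (simp add: sum_product)
  also have "(\<Sum>b\<in>insert a S. if b = a then x else - 1) = x + (\<Sum>b\<in>S. if b = a then x else - 1)"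
    using insert by simp
  also have "(\<Sum>b\<in>S. if b = a then x else - 1) = (\<Sum>b\<in>S. - 1)"
    by (rule sum.cong) (use insert in auto)
  finally show ?case using insert by (simp add: mult_ac)
qed

text \<open>
  For \<open>x = dim V\<close> and \<open>k = card S\<close> this is \<open>k! (n - k)!\<close> times the trace on the \<open>n\<close>-th tensor power
  of \<open>V\<close> of \<open>\<omega>\<close> composed with the projection onto \<open>\<Lambda>\<^sup>k(V) \<otimes> Sym\<^sup>n\<^sup>-\<^sup>k(V)\<close>.
\<close>

definition signed_sum :: "'b \<Rightarrow> 'a set \<Rightarrow> 'a set \<Rightarrow> ('a \<Rightarrow> 'a) \<Rightarrow> 'b::field_char_0" where
  "signed_sum x A S \<omega> = (\<Sum>\<rho> | \<rho> permutes S. \<Sum>\<tau> | \<tau> permutes (A - S).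
     of_int (sign \<rho>) * x ^ num_orbits A (\<omega> \<circ> (\<rho> \<circ> \<tau>)))"

locale split_set =
  fixes A S :: "'a set" and x :: "'b::field_char_0"
  assumes finA: "finite A" and SA: "S \<subseteq> A"
begin

lemma finS: "finite S" using finA SA finite_subset by blast

abbreviation "\<Theta> \<equiv> signed_sum x A S"

lemma comp_left_S:
  assumes r: "r permutes S"
  shows "\<Theta> (\<omega> \<circ> r) = of_int (sign r) * \<Theta> \<omega>"
proof -
  define f where "f \<rho> = of_int (sign \<rho>) * (\<Sum>\<tau> | \<tau> permutes (A - S). x ^ num_orbits A (\<omega> \<circ> (\<rho> \<circ> \<tau>)))" for \<rho> :: "'a \<Rightarrow> 'a"
  have "\<Theta> \<omega> = (\<Sum>\<rho> | \<rho> permutes S. f \<rho>)"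
    by (simp add: signed_sum_def f_def sum_distrib_left)
  also have "\<dots> = (\<Sum>\<rho> | \<rho> permutes S. f (r \<circ> \<rho>))" by (rule setum_permutations_compose_left[OF r])
  also have "\<dots> = of_int (sign r) * \<Theta> (\<omega> \<circ> r)"
    unfolding signed_sum_def sum_distrib_left
  proof (intro sum.cong refl)
    fix \<rho> assume "\<rho> \<in> {\<rho>. \<rho> permutes S}"
    then have "sign (r \<circ> \<rho>) = sign r * sign \<rho>"
      using r finS by (simp add: sign_compose permutes_imp_permutation[OF finS])
    then show "f (r \<circ> \<rho>) = (\<Sum>\<tau> | \<tau> permutes (A - S). of_int (sign r) *
        (of_int (sign \<rho>) * x ^ num_orbits A (\<omega> \<circ> r \<circ> (\<rho> \<circ> \<tau>))))"
      by (simp add: f_def sum_distrib_left mult_ac o_assoc)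
  qed
  finally have "of_int (sign r) * \<Theta> \<omega> = of_int (sign r * sign r) * \<Theta> (\<omega> \<circ> r)"
    by (simp only: of_int_mult mult.assoc)
  then show ?thesis by (simp only: sign_idempotent of_int_1 mult_1)
qed

lemma comp_left_T:
  assumes t: "t permutes (A - S)"
  shows "\<Theta> (\<omega> \<circ> t) = \<Theta> \<omega>"
  unfolding signed_sum_def
proof (rule sum.cong[OF refl])
  fix \<rho> assume "\<rho> \<in> {\<rho>. \<rho> permutes S}"
  then have "t \<circ> \<rho> = \<rho> \<circ> t" using permutes_disjoint_comp_commute[OF t, of \<rho> S] by auto
  then have *: "\<omega> \<circ> t \<circ> (\<rho> \<circ> \<tau>) = \<omega> \<circ> (\<rho> \<circ> (t \<circ> \<tau>))" for \<tau> by (metis o_assoc)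
  show "(\<Sum>\<tau> | \<tau> permutes (A - S). of_int (sign \<rho>) * x ^ num_orbits A (\<omega> \<circ> t \<circ> (\<rho> \<circ> \<tau>))) =
    (\<Sum>\<tau> | \<tau> permutes (A - S). of_int (sign \<rho>) * x ^ num_orbits A (\<omega> \<circ> (\<rho> \<circ> \<tau>)))"
    unfolding * by (rule setum_permutations_compose_left[OF t, symmetric])
qed

text \<open>A factor on the left of \<open>\<omega>\<close> is carried around the product by
  \<open>num_orbits_comp_commute\<close>, commutes past \<open>\<tau>\<close> because the supports
  are disjoint, and is then absorbed by reindexing \<open>\<rho>\<close>.\<close>

lemma comp_right_S:
  assumes r: "r permutes S"
  shows "\<Theta> (r \<circ> \<omega>) = of_int (sign r) * \<Theta> \<omega>"
proof -
  have rA: "r permutes A" using r SA by (rule permutes_subset)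
  define f where "f \<rho> = of_int (sign \<rho>) * (\<Sum>\<tau> | \<tau> permutes (A - S). x ^ num_orbits A (\<omega> \<circ> (\<rho> \<circ> \<tau>)))" for \<rho> :: "'a \<Rightarrow> 'a"
  have "\<Theta> \<omega> = (\<Sum>\<rho> | \<rho> permutes S. f \<rho>)"
    by (simp add: signed_sum_def f_def sum_distrib_left)
  also have "\<dots> = (\<Sum>\<rho> | \<rho> permutes S. f (\<rho> \<circ> r))" by (rule sum_permutations_compose_right[OF r])
  also have "\<dots> = of_int (sign r) * \<Theta> (r \<circ> \<omega>)"
    unfolding signed_sum_def sum_distrib_left f_def
  proof (intro sum.cong refl)
    fix \<rho> \<tau> assume \<rho>: "\<rho> \<in> {\<rho>. \<rho> permutes S}" and \<tau>: "\<tau> \<in> {\<tau>. \<tau> permutes (A - S)}"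
    have "\<tau> \<circ> r = r \<circ> \<tau>" using permutes_disjoint_comp_commute[of \<tau> "A - S" r S] \<tau> r by auto
    then have "\<omega> \<circ> (\<rho> \<circ> r \<circ> \<tau>) = (\<omega> \<circ> (\<rho> \<circ> \<tau>)) \<circ> r" by (metis o_assoc)
    then have "num_orbits A (\<omega> \<circ> (\<rho> \<circ> r \<circ> \<tau>)) = num_orbits A (r \<circ> (\<omega> \<circ> (\<rho> \<circ> \<tau>)))"
      by (simp only: num_orbits_comp_commute[OF rA])
    moreover have "sign (\<rho> \<circ> r) = sign r * sign \<rho>"
      using r \<rho> by (simp add: sign_compose permutes_imp_permutation[OF finS])
    ultimately show "of_int (sign (\<rho> \<circ> r)) * x ^ num_orbits A (\<omega> \<circ> (\<rho> \<circ> r \<circ> \<tau>)) =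
      of_int (sign r) * (of_int (sign \<rho>) * x ^ num_orbits A (r \<circ> \<omega> \<circ> (\<rho> \<circ> \<tau>)))"
      by (simp add: o_assoc)
  qed
  finally have "of_int (sign r) * \<Theta> \<omega> = of_int (sign r * sign r) * \<Theta> (r \<circ> \<omega>)"
    by (simp only: of_int_mult mult.assoc)
  then show ?thesis by (simp only: sign_idempotent of_int_1 mult_1)
qed

lemma comp_right_T:
  assumes t: "t permutes (A - S)"
  shows "\<Theta> (t \<circ> \<omega>) = \<Theta> \<omega>"
  unfolding signed_sum_def
proof (rule sum.cong[OF refl])
  fix \<rho> :: "'a \<Rightarrow> 'a"
  have tA: "t permutes A" using t by (rule permutes_subset) auto
  have "num_orbits A (t \<circ> \<omega> \<circ> (\<rho> \<circ> \<tau>)) = num_orbits A (\<omega> \<circ> (\<rho> \<circ> (\<tau> \<circ> t)))" for \<tau>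
    using num_orbits_comp_commute[OF tA, of "\<omega> \<circ> (\<rho> \<circ> \<tau>)"] by (simp add: o_assoc)
  then show "(\<Sum>\<tau> | \<tau> permutes (A - S). of_int (sign \<rho>) * x ^ num_orbits A (t \<circ> \<omega> \<circ> (\<rho> \<circ> \<tau>))) =
    (\<Sum>\<tau> | \<tau> permutes (A - S). of_int (sign \<rho>) * x ^ num_orbits A (\<omega> \<circ> (\<rho> \<circ> \<tau>)))"
    using sum_permutations_compose_right[OF t,
        of "\<lambda>\<tau>. of_int (sign \<rho>) * x ^ num_orbits A (\<omega> \<circ> (\<rho> \<circ> \<tau>))"] by simp
qed

text \<open>
  Swapping the two exits \<open>i\<close>, \<open>j\<close> inside \<open>S\<close> is the same as swapping their images outside of
  \<open>S\<close>; the former changes the sign of the sum and the latter does not.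
\<close>

lemma two_exits:
  assumes \<omega>: "\<omega> permutes A" and i: "i \<in> S" "\<omega> i \<notin> S" and j: "j \<in> S" "\<omega> j \<notin> S" and ij: "i \<noteq> j"
  shows "\<Theta> \<omega> = 0"
proof -
  have inj: "inj \<omega>" using \<omega> by (rule permutes_inj)
  have "\<omega> \<circ> transpose i j = transpose (\<omega> i) (\<omega> j) \<circ> \<omega>"
    using inj by (auto simp: fun_eq_iff transpose_def inj_eq)
  moreover have "transpose i j permutes S" using i j by (simp add: permutes_swap_id)
  moreover have "transpose (\<omega> i) (\<omega> j) permutes (A - S)"
    using i j SA permutes_in_image[OF \<omega>] by (intro permutes_swap_id) auto
  ultimately have "- \<Theta> \<omega> = \<Theta> \<omega>"
    using comp_left_S[of "transpose i j" \<omega>] comp_right_T[of "transpose (\<omega> i) (\<omega> j)" \<omega>] ij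
    by (simp add: sign_swap_id)
  then show ?thesis by simp
qed

text \<open>The sum splits over the two disjoint sets: the signed part gives the falling factorial,
  the unsigned part the rising one.\<close>

lemma signed_sum_id:
  "\<Theta> id = (\<Prod>i<card S. x - of_nat i) * (\<Prod>i<card (A - S). x + of_nat i)"
proof -
  have "\<Theta> id = (\<Sum>\<rho> | \<rho> permutes S. of_int (sign \<rho>) *
      (\<Sum>\<tau> | \<tau> permutes ({} \<union> (A - S)). x ^ num_orbits (S \<union> (A - S)) (\<tau> \<circ> \<rho>)))"
    unfolding signed_sum_def sum_distrib_left
  proof (intro sum.cong refl)
    fix \<rho> \<tau> assume \<rho>: "\<rho> \<in> {\<rho>. \<rho> permutes S}" and \<tau>: "\<tau> \<in> {\<tau>. \<tau> permutes ({} \<union> (A - S))}"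
    have "\<tau> \<circ> \<rho> = \<rho> \<circ> \<tau>" by (rule permutes_disjoint_comp_commute[of \<tau> "A - S" \<rho> S]) (use \<rho> \<tau> in auto)
    moreover have "S \<union> (A - S) = A" using SA by blast
    ultimately show "of_int (sign \<rho>) * x ^ num_orbits A (id \<circ> (\<rho> \<circ> \<tau>)) =
      of_int (sign \<rho>) * x ^ num_orbits (S \<union> (A - S)) (\<tau> \<circ> \<rho>)" by simp
  qed auto
  also have "\<dots> = (\<Sum>\<rho> | \<rho> permutes S. of_int (sign \<rho>) *
      (x ^ num_orbits S \<rho> * (\<Prod>i<card (A - S). x + of_nat (card ({} :: 'a set) + i))))"
    by (intro sum.cong refl arg_cong2[where f="(*)"] sum_power_num_orbits_extend)
      (use finA finS in auto)
  also have "\<dots> = (\<Sum>\<rho> | \<rho> permutes S. of_int (sign \<rho>) * x ^ num_orbits S \<rho>) * (\<Prod>i<card (A - S). x + of_nat i)"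
    by (simp add: sum_distrib_right mult.assoc)
  finally show ?thesis using sum_sign_power_num_orbits[OF finS, of x] by simp
qed

text \<open>
  The sum over \<open>b\<close> of these values, together with the value at \<open>id\<close>, runs over all permutations
  of \<open>insert a (A - S)\<close>, and it does not depend on \<open>b\<close> by conjugation.
\<close>

lemma signed_sum_transpose:
  assumes a: "a \<in> S" and b: "b \<in> A - S"
  shows "\<Theta> (transpose a b) = (\<Prod>i<card S. x - of_nat i) * (\<Prod>i<card (A - S) - 1. x + 1 + of_nat i)"
proof -
  let ?T = "A - S"
  have T: "finite ?T" "a \<notin> ?T" using finA a by auto
  have same: "\<Theta> (transpose a c) = \<Theta> (transpose a b)" if c: "c \<in> ?T" for c
  proof (cases "c = b")
    case False
    have "transpose a c = transpose b c \<circ> transpose a b \<circ> transpose b c"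
      using False a b c by (auto simp: fun_eq_iff transpose_def)
    moreover have "transpose b c permutes ?T" using b c by (rule permutes_swap_id)
    ultimately show ?thesis using comp_left_T comp_right_T by metis
  qed simp
  have "(\<Sum>c\<in>insert a ?T. \<Theta> (transpose a c)) =
    (\<Sum>c\<in>insert a ?T. \<Sum>\<tau> | \<tau> permutes ?T. \<Sum>\<rho> | \<rho> permutes S. of_int (sign \<rho>) *
       x ^ num_orbits (S \<union> ?T) (transpose a c \<circ> \<tau> \<circ> \<rho>))"
    unfolding signed_sum_def
  proof (rule sum.cong[OF refl], subst sum.swap, intro sum.cong refl)
    fix c \<rho> \<tau> assume \<rho>: "\<rho> \<in> {\<rho>. \<rho> permutes S}" and \<tau>: "\<tau> \<in> {\<tau>. \<tau> permutes ?T}"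
    have "\<tau> \<circ> \<rho> = \<rho> \<circ> \<tau>" by (rule permutes_disjoint_comp_commute[of \<tau> "A - S" \<rho> S]) (use \<rho> \<tau> in auto)
    moreover have "S \<union> (A - S) = A" using SA by blast
    ultimately show "of_int (sign \<rho>) * x ^ num_orbits A (transpose a c \<circ> (\<rho> \<circ> \<tau>)) =
      of_int (sign \<rho>) * x ^ num_orbits (S \<union> ?T) (transpose a c \<circ> \<tau> \<circ> \<rho>)"
      by (metis o_assoc)
  qed
  also have "\<dots> = (\<Sum>\<tau> | \<tau> permutes insert a ?T. \<Sum>\<rho> | \<rho> permutes S. of_int (sign \<rho>) *
       x ^ num_orbits (S \<union> ?T) (\<tau> \<circ> \<rho>))"
    by (rule sum_over_permutations_insert[OF T, symmetric])
  also have "\<dots> = (\<Sum>\<rho> | \<rho> permutes S. of_int (sign \<rho>) *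
      (\<Sum>\<tau> | \<tau> permutes ({a} \<union> ?T). x ^ num_orbits (S \<union> ?T) (\<tau> \<circ> \<rho>)))"
    by (subst sum.swap) (simp add: sum_distrib_left)
  also have "\<dots> = (\<Sum>\<rho> | \<rho> permutes S. of_int (sign \<rho>) *
      (x ^ num_orbits S \<rho> * (\<Prod>i<card ?T. x + of_nat (card {a} + i))))"
    by (intro sum.cong refl arg_cong2[where f="(*)"] sum_power_num_orbits_extend)
      (use finA finS a in auto)
  also have "\<dots> = (\<Prod>i<card S. x - of_nat i) * (\<Prod>i<card ?T. x + 1 + of_nat i)"
    unfolding mult.assoc[symmetric] sum_distrib_right[symmetric] sum_sign_power_num_orbits[OF finS]
    by (simp add: add.assoc)
  finally have "\<Theta> id + of_nat (card ?T) * \<Theta> (transpose a b) =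
      (\<Prod>i<card S. x - of_nat i) * (\<Prod>i<card ?T. x + 1 + of_nat i)"
    using T same by (simp add: id_def)
  then have eq: "of_nat (card ?T) * \<Theta> (transpose a b) =
      (\<Prod>i<card S. x - of_nat i) * ((\<Prod>i<card ?T. x + 1 + of_nat i) - (\<Prod>i<card ?T. x + of_nat i))"
    by (simp add: signed_sum_id algebra_simps)
  obtain m where m: "card ?T = Suc m" using b T by (metis card_Suc_Diff1)
  \<comment> \<open>The factors \<open>x + 1, ..., x + m\<close> are common to both products. The
    remaining ones, \<open>x + m + 1\<close> and \<open>x\<close>, differ by \<open>card ?T\<close>,
    which is then cancelled in characteristic zero.\<close>
  have "(\<Prod>i<card ?T. x + 1 + of_nat i) - (\<Prod>i<card ?T. x + of_nat i) =
      of_nat (card ?T) * (\<Prod>i<m. x + 1 + of_nat i)"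
  proof -
    have "(\<Prod>i<Suc m. x + of_nat i) = x * (\<Prod>i<m. x + 1 + of_nat i)"
      by (simp add: prod.lessThan_Suc_shift add_ac del: prod.lessThan_Suc)
    then show ?thesis unfolding m by (simp add: algebra_simps)
  qed
  with eq have "of_nat (card ?T) * \<Theta> (transpose a b) =
      of_nat (card ?T) * ((\<Prod>i<card S. x - of_nat i) * (\<Prod>i<m. x + 1 + of_nat i))"
    by (simp add: mult_ac)
  moreover have "(of_nat (card ?T) :: 'b) \<noteq> 0" unfolding m by (rule of_nat_neq_0)
  ultimately show ?thesis using m by (simp only: mult_cancel_left) simp
qed

lemma perm_restrict_split:
  assumes "\<omega> permutes A" "\<omega> ` S = S"
  shows "perm_restrict \<omega> S permutes S" "perm_restrict \<omega> (A - S) permutes (A - S)"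
    "\<omega> = perm_restrict \<omega> S \<circ> perm_restrict \<omega> (A - S)"
proof -
  have inj: "inj \<omega>" using assms permutes_inj by blast
  have *: "\<omega> ` (A - S) = A - S" using assms inj by (simp add: image_set_diff permutes_image)
  have perm: "perm_restrict \<omega> B permutes B" if "\<omega> ` B = B" for B
  proof (rule bij_imp_permutes)
    have "bij_betw \<omega> B B" using that inj by (simp add: bij_betw_def inj_on_subset[OF inj subset_UNIV])
    then show "bij_betw (perm_restrict \<omega> B) B B"
      by (rule bij_betw_cong[THEN iffD1, rotated]) (simp add: perm_restrict_simps)
  qed (simp add: perm_restrict_simps)
  show 1: "perm_restrict \<omega> S permutes S" "perm_restrict \<omega> (A - S) permutes (A - S)"
    using assms * perm by blast+
  show "\<omega> = perm_restrict \<omega> S \<circ> perm_restrict \<omega> (A - S)"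
    using perm_restrict_union[OF 1] assms SA by (simp add: Un_absorb1)
qed

lemma sign_perm_restrict:
  assumes "\<omega> permutes A" "\<omega> ` S = S"
  shows "sign (perm_restrict \<omega> S) = (- 1) ^ (card S + num_orbits S \<omega>)"
  using sign_eq_num_orbits[OF finS perm_restrict_split(1)[OF assms]]
    num_orbits_perm_restrict[OF finA assms SA] by simp

text \<open>The restrictions of \<open>\<omega>\<close> to \<open>S\<close> and to its complement
  are absorbed, leaving a sign and the value at \<open>id\<close>. The sign is
  \<open>(- 1) ^ (card S + num_orbits S \<omega>)\<close>, and the prefactor removes its dependence
  on \<open>card S\<close>.\<close>

lemma signed_sum_invariant:
  assumes "\<omega> permutes A" "\<omega> ` S = S"
  shows "(- 1) ^ card S * \<Theta> \<omega> = (- 1) ^ num_orbits S \<omega> *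
    ((\<Prod>i<card S. x - of_nat i) * (\<Prod>i<card (A - S). x + of_nat i))"
proof -
  have "\<Theta> \<omega> = \<Theta> (perm_restrict \<omega> S \<circ> (perm_restrict \<omega> (A - S) \<circ> id))"
    using perm_restrict_split(3)[OF assms] by simp
  also have "\<dots> = of_int (sign (perm_restrict \<omega> S)) * \<Theta> id"
    unfolding comp_right_S[OF perm_restrict_split(1)[OF assms]]
      comp_right_T[OF perm_restrict_split(2)[OF assms]] ..
  finally show ?thesis
    by (simp add: sign_perm_restrict[OF assms] signed_sum_id power_add mult_ac)
qed

text \<open>An exit from \<open>i\<close> to \<open>y\<close> forces an entry from some
  \<open>j\<close> outside to some \<open>a\<close> in \<open>S\<close>. Exchanging the two targets
  gives a \<open>\<pi>\<close> that preserves \<open>S\<close>, so after absorbing the restrictions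
  of \<open>\<pi>\<close> only \<open>transpose a y\<close> remains.\<close>

lemma signed_sum_one_exit:
  assumes \<omega>: "\<omega> permutes A" and i: "i \<in> S" "\<omega> i \<notin> S" and u: "\<And>j. j \<in> S \<Longrightarrow> j \<noteq> i \<Longrightarrow> \<omega> j \<in> S"
  shows "(- 1) ^ card S * \<Theta> \<omega> = (- 1) ^ num_orbits S \<omega> *
    ((\<Prod>i<card S. x - of_nat i) * (\<Prod>i<card (A - S) - 1. x + 1 + of_nat i))"
proof -
  have inj: "inj \<omega>" using \<omega> by (rule permutes_inj)
  define y where "y = \<omega> i"
  have yT: "y \<in> A - S" using i SA permutes_in_image[OF \<omega>] by (auto simp: y_def)
  \<comment> \<open>Without an entry from outside, \<open>S\<close> would be covered by the images
    of \<open>S - {i}\<close>, which are too few.\<close>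
  obtain j where j: "j \<in> A - S" "\<omega> j \<in> S"
  proof (rule ccontr)
    assume "\<not> thesis"
    then have no: "\<omega> j \<notin> S" if "j \<in> A - S" for j using that \<open>\<And>j. j \<in> A - S \<Longrightarrow> \<omega> j \<in> S \<Longrightarrow> thesis\<close> by blast
    have "S \<subseteq> \<omega> ` (S - {i})"
    proof
      fix s assume s: "s \<in> S"
      then obtain r where r: "r \<in> A" "s = \<omega> r" using permutes_image[OF \<omega>] SA by blast
      with no s have "r \<in> S" by blast
      with r s i show "s \<in> \<omega> ` (S - {i})" by auto
    qed
    then have "card S \<le> card (S - {i})" using finS by (meson card_mono finite_Diff finite_imageI card_image_le order_trans)
    then show False using i finS by (metis card_Diff1_less leD)
  qed
  define a where "a = \<omega> j"
  have a: "a \<in> S" using j a_def by simp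
  define \<pi> where "\<pi> = transpose a y \<circ> \<omega>"
  have ay: "transpose a y permutes A" using a yT SA by (intro permutes_swap_id) auto
  have \<pi>: "\<pi> permutes A" unfolding \<pi>_def by (rule permutes_compose[OF \<omega> ay])
  have "\<pi> s \<in> S" if "s \<in> S" for s
  proof (cases "s = i")
    case False
    then have "\<omega> s \<in> S" "\<omega> s \<noteq> a" using u that j(1) inj by (auto simp: a_def inj_eq)
    moreover have "\<omega> s \<noteq> y" using False inj by (simp add: y_def inj_eq)
    ultimately show ?thesis by (simp add: \<pi>_def)
  qed (use a y_def \<pi>_def in simp)
  then have \<pi>S: "\<pi> ` S = S"
    by (intro card_subset_eq[OF finS]) (auto simp: card_image permutes_inj_on[OF \<pi>])
  have \<omega>\<pi>: "\<omega> = transpose a y \<circ> \<pi>" by (simp add: \<pi>_def o_assoc)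
  have "\<Theta> \<omega> = \<Theta> (transpose a y \<circ> perm_restrict \<pi> S \<circ> perm_restrict \<pi> (A - S))"
    using \<omega>\<pi> perm_restrict_split(3)[OF \<pi> \<pi>S] by (metis o_assoc)
  also have "\<dots> = of_int (sign (perm_restrict \<pi> S)) * \<Theta> (transpose a y)"
    using comp_left_S comp_left_T perm_restrict_split[OF \<pi> \<pi>S] by metis
  finally have \<Theta>: "\<Theta> \<omega> = of_int (sign (perm_restrict \<pi> S)) * \<Theta> (transpose a y)" .
  \<comment> \<open>The transposition joins a cycle inside \<open>S\<close> with one outside. The
    number of cycles meeting \<open>S\<close> is therefore unchanged, and intersecting with
    \<open>S\<close> recovers the cycles of \<open>\<pi>\<close>.\<close>
  have "num_orbits S \<omega> = num_orbits S \<pi>"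
  proof -
    have P: "permutation \<pi>" using finA \<pi> by (rule permutes_imp_permutation)
    have Oy: "orbit \<pi> y \<subseteq> A - S"
    proof
      fix z assume "z \<in> orbit \<pi> y"
      then show "z \<in> A - S"
      proof induct
        case base
        then show ?case using yT \<pi>S \<pi> by (metis Diff_iff imageE inj_eq permutes_in_image permutes_inj)
      next
        case (step z)
        then show ?case using \<pi>S \<pi> by (metis Diff_iff imageE inj_eq permutes_in_image permutes_inj)
      qed
    qed
    have Os: "orbit \<pi> s \<subseteq> S" if "s \<in> S" for s
    proof
      fix z assume "z \<in> orbit \<pi> s"
      then show "z \<in> S" by induct (use that \<pi>S in auto)
    qed
    have a': "a \<notin> orbit \<pi> y" using Oy a by blast
    have o: "orbit \<omega> s = (if orbit \<pi> s = orbit \<pi> a then orbit \<pi> a \<union> orbit \<pi> y else orbit \<pi> s)"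
      if "s \<in> S" for s
    proof -
      have "s \<notin> orbit \<pi> y" using Oy that by blast
      moreover have "s \<in> orbit \<pi> a \<longleftrightarrow> orbit \<pi> s = orbit \<pi> a"
        using orbit_eq_permutation[OF P] permutation_self_in_orbit[OF P] by metis
      ultimately show ?thesis using orbit_transpose_comp[OF P a', of s] \<omega>\<pi> by simp
    qed
    define h where "h B = (if B = orbit \<pi> a then orbit \<pi> a \<union> orbit \<pi> y else B)" for B
    have im: "orbit \<omega> ` S = h ` orbit \<pi> ` S"
      unfolding image_image by (rule image_cong[OF refl]) (simp add: o h_def)
    have "inj_on h (orbit \<pi> ` S)"
    proof (rule inj_on_inverseI[where g = "\<lambda>B. B \<inter> S"])
      fix B assume "B \<in> orbit \<pi> ` S"
      then show "h B \<inter> S = B" using Os Oy a by (auto simp: h_def)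
    qed
    then show ?thesis unfolding num_orbits_def im by (rule card_image)
  qed
  then show ?thesis
    by (simp add: \<Theta> sign_perm_restrict[OF \<pi> \<pi>S] signed_sum_transpose[OF a yT] power_add mult_ac)
qed

end

section \<open>Factorizations into a cyclic permutation\<close>

lemma sum_Pow_insert:
  assumes "finite B" "b \<notin> B"
  shows "sum h (Pow (insert b B)) = sum h (Pow B) + (\<Sum>C\<in>Pow B. h (insert b C))"
proof -
  have "inj_on (insert b) (Pow B)" using assms(2) by (auto intro!: inj_onI)
  then show ?thesis using assms
    by (subst Pow_insert, subst sum.union_disjoint) (auto simp: sum.reindex)
qed

lemma sum_Pow_minus_one_power:
  assumes "finite B"
  shows "(\<Sum>C\<in>Pow B. (- 1) ^ card C) = (if B = {} then 1 else 0 :: 'b::comm_ring_1)"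
  using assms
proof (induction B rule: finite_induct)
  case (insert b B)
  have "(\<Sum>C\<in>Pow B. (- 1) ^ card (insert b C)) = (\<Sum>C\<in>Pow B. - ((- 1) ^ card C) :: 'b)"
  proof (rule sum.cong[OF refl])
    fix C assume "C \<in> Pow B"
    then have "finite C" "b \<notin> C" using insert finite_subset by auto
    then show "(- 1) ^ card (insert b C) = (- ((- 1) ^ card C) :: 'b)" by simp
  qed
  then show ?case using insert by (simp add: sum_Pow_insert sum_negf)
qed simp

text \<open>Splitting off one element \<open>b\<close> cancels the sums over the remaining set and
  leaves \<open>f b\<close> times a plain alternating sum, which is nonzero only if nothing else
  remains.\<close>

lemma sum_Pow_sum_minus_one_power:
  fixes f :: "'a \<Rightarrow> 'b::comm_ring_1"
  assumes "finite B"
  shows "(\<Sum>C\<in>Pow B. sum f C * (- 1) ^ card C) = (if card B = 1 then - sum f B else 0)"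
  using assms
proof (induction B rule: finite_induct)
  case (insert b B)
  have "(\<Sum>C\<in>Pow B. sum f (insert b C) * (- 1) ^ card (insert b C)) =
      (\<Sum>C\<in>Pow B. - f b * (- 1) ^ card C - sum f C * (- 1) ^ card C)"
  proof (rule sum.cong[OF refl])
    fix C assume "C \<in> Pow B"
    then have "finite C" "b \<notin> C" using insert finite_subset by auto
    then show "sum f (insert b C) * (- 1) ^ card (insert b C) =
      - f b * (- 1) ^ card C - sum f C * (- 1) ^ card C" by (simp add: algebra_simps)
  qed
  also have "\<dots> = - f b * (\<Sum>C\<in>Pow B. (- 1) ^ card C) - (\<Sum>C\<in>Pow B. sum f C * (- 1) ^ card C)"
    by (simp only: sum_subtractf sum_distrib_left)
  finally show ?case using insert by (simp add: sum_Pow_insert sum_Pow_minus_one_power card_eq_0_iff)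
qed simp

lemma sum_card_orbits:
  assumes A: "finite A" and p: "p permutes A"
  shows "sum card (orbit p ` A) = card A"
proof -
  have P: "permutation p" using A p by (rule permutes_imp_permutation)
  have "\<Union> (orbit p ` A) = A"
    using permutes_orbit_subset[OF p] permutation_self_in_orbit[OF P] by blast
  moreover have "card (\<Union> (orbit p ` A)) = sum card (orbit p ` A)"
  proof (rule card_Union_disjoint)
    show "pairwise disjnt (orbit p ` A)"
      using orbits_eq_or_disjoint[OF P] unfolding pairwise_def disjnt_def by blast
    show "finite B" if "B \<in> orbit p ` A" for B
      using that permutes_orbit_subset[OF p] A finite_subset by blast
  qed
  ultimately show ?thesis by simp
qed

text \<open>The invariant sets are the unions of cycles; \<open>S\<close> and its set of cycles
  determine each other.\<close>

lemma sum_invariant_sets: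
  fixes F :: "nat \<Rightarrow> 'b::comm_ring_1"
  assumes A: "finite A" and p: "p permutes A"
  shows "(\<Sum>S | S \<subseteq> A \<and> p ` S = S. F (card S) * (- 1) ^ num_orbits S p) =
    (\<Sum>C\<in>Pow (orbit p ` A). F (sum card C) * (- 1) ^ card C)"
proof -
  have P: "permutation p" using A p by (rule permutes_imp_permutation)
  note self = permutation_self_in_orbit[OF P]
  have sub: "orbit p z \<subseteq> A" if "z \<in> A" for z using p that by (rule permutes_orbit_subset)
  have U: "\<Union> (orbit p ` S) = S" if "p ` S = S" for S
  proof -
    have "orbit p s \<subseteq> S" if "s \<in> S" for s
    proof
      fix z assume "z \<in> orbit p s"
      then show "z \<in> S" by induct (use that \<open>p ` S = S\<close> in auto)
    qed
    then show ?thesis using self by blast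
  qed
  have V: "orbit p ` \<Union> C = C" if "C \<subseteq> orbit p ` A" for C
  proof
    show "orbit p ` \<Union> C \<subseteq> C" using that orbit_eq_permutation[OF P] by fastforce
    show "C \<subseteq> orbit p ` \<Union> C"
    proof
      fix B assume B: "B \<in> C"
      with that obtain a where a: "B = orbit p a" by blast
      then have "a \<in> \<Union> C" using B self by blast
      with a show "B \<in> orbit p ` \<Union> C" by blast
    qed
  qed
  have W: "p ` \<Union> C = \<Union> C" if "C \<subseteq> orbit p ` A" for C
  proof (rule card_subset_eq)
    have "\<Union> C \<subseteq> A" using that sub by blast
    then show "finite (\<Union> C)" using A finite_subset by blast
    show "card (p ` \<Union> C) = card (\<Union> C)" by (simp add: card_image permutes_inj_on[OF p])
    show "p ` \<Union> C \<subseteq> \<Union> C" using that by (auto dest!: subsetD intro: orbit.step)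
  qed
  have card: "card (\<Union> C) = sum card C" if "C \<subseteq> orbit p ` A" for C
  proof (rule card_Union_disjoint)
    show "pairwise disjnt C"
      using that orbits_eq_or_disjoint[OF P] unfolding pairwise_def disjnt_def by blast
    show "finite B" if "B \<in> C" for B
    proof -
      have "B \<subseteq> A" using that \<open>C \<subseteq> orbit p ` A\<close> sub by fast
      then show ?thesis using A by (rule finite_subset)
    qed
  qed
  show ?thesis
  proof (rule sum.reindex_bij_witness[of _ Union "\<lambda>S. orbit p ` S"], goal_cases)
    case (1 S)
    then show ?case using U by simp
  next
    case (2 S)
    then show ?case by auto
  next
    case (3 C)
    then show ?case using V by simp
  next
    case (4 C)
    then have "\<Union> C \<subseteq> A" using sub by fast
    with 4 W show ?case by simp
  next
    case (5 S)
    then have "orbit p ` S \<subseteq> orbit p ` A" by auto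
    from card[OF this] show ?case using U[of S] 5 by (simp add: num_orbits_def)
  qed
qed

lemma sum_invariant_sets_card:
  assumes A: "finite A" and p: "p permutes A"
  shows "(\<Sum>S | S \<subseteq> A \<and> p ` S = S. of_nat (card S) * (- 1) ^ num_orbits S p) =
    (if num_orbits A p = 1 then - of_nat (card A) else 0 :: 'b::comm_ring_1)"
proof -
  show ?thesis
    using sum_card_orbits[OF assms] sum_invariant_sets[OF assms, of "of_nat :: nat \<Rightarrow> 'b"]
      sum_Pow_sum_minus_one_power[of "orbit p ` A" "\<lambda>B. of_nat (card B) :: 'b"] A
    by (simp add: num_orbits_def flip: of_nat_sum)
qed

text \<open>The origin of \<open>signed_sum\<close>: the permutations preserving \<open>S\<close>
  are the products \<open>\<rho> \<circ> \<tau>\<close>, and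
  \<open>(- 1) ^ num_orbits S \<zeta>\<close> differs from the sign of \<open>\<rho>\<close> by
  \<open>(- 1) ^ card S\<close>.\<close>

lemma sum_preserving_eq_signed_sum:
  fixes x :: "'b::field_char_0"
  assumes A: "finite A" and SA: "S \<subseteq> A"
  shows "(\<Sum>\<zeta> | \<zeta> permutes A \<and> \<zeta> ` S = S. (- 1) ^ num_orbits S \<zeta> * x ^ num_orbits A (\<omega> \<circ> \<zeta>)) =
    (- 1) ^ card S * signed_sum x A S \<omega>"
proof -
  interpret split_set A S x by standard fact+
  have comp: "perm_restrict (\<rho> \<circ> \<tau>) S = \<rho>" "perm_restrict (\<rho> \<circ> \<tau>) (A - S) = \<tau>"
    "\<rho> \<circ> \<tau> permutes A" "(\<rho> \<circ> \<tau>) ` S = S"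
    if "\<rho> permutes S" "\<tau> permutes (A - S)" for \<rho> \<tau>
  proof -
    have *: "\<tau> s = s" if "s \<in> S" for s using that \<open>\<tau> permutes (A - S)\<close> by (simp add: permutes_not_in)
    show "perm_restrict (\<rho> \<circ> \<tau>) S = \<rho>"
      using that * by (auto simp: fun_eq_iff perm_restrict_def permutes_not_in)
    have "\<tau> s \<notin> S" if "s \<notin> S" for s
      using that * \<open>\<tau> permutes (A - S)\<close> by (metis injD permutes_inj)
    then show "perm_restrict (\<rho> \<circ> \<tau>) (A - S) = \<tau>"
      using that by (auto simp: fun_eq_iff perm_restrict_def permutes_not_in)
    show "\<rho> \<circ> \<tau> permutes A"
      by (rule permutes_compose) (use that SA in \<open>auto intro: permutes_subset\<close>)
    have "\<tau> ` S = S" using * by simp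
    then show "(\<rho> \<circ> \<tau>) ` S = S" using that(1) by (metis image_comp permutes_image)
  qed
  have "(- 1) ^ card S * signed_sum x A S \<omega> =
     (\<Sum>(\<rho>, \<tau>)\<in>{\<rho>. \<rho> permutes S} \<times> {\<tau>. \<tau> permutes (A - S)}.
        (- 1) ^ card S * (of_int (sign \<rho>) * x ^ num_orbits A (\<omega> \<circ> (\<rho> \<circ> \<tau>))))"
    unfolding signed_sum_def by (simp add: sum_distrib_left sum.cartesian_product case_prod_unfold)
  also have "\<dots> = (\<Sum>\<zeta> | \<zeta> permutes A \<and> \<zeta> ` S = S. (- 1) ^ num_orbits S \<zeta> * x ^ num_orbits A (\<omega> \<circ> \<zeta>))"
  proof (rule sum.reindex_bij_witness[of _ "\<lambda>\<zeta>. (perm_restrict \<zeta> S, perm_restrict \<zeta> (A - S))" "\<lambda>(\<rho>, \<tau>). \<rho> \<circ> \<tau>"], goal_cases)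
    case (5 a)
    then obtain \<rho> \<tau> where a: "a = (\<rho>, \<tau>)" "\<rho> permutes S" "\<tau> permutes (A - S)" by auto
    have "(- 1) ^ card S * of_int (sign \<rho>) = ((- 1) ^ num_orbits S (\<rho> \<circ> \<tau>) :: 'b)"
      using sign_perm_restrict[OF comp(3,4)[OF a(2,3)]] comp(1)[OF a(2,3)]
      by (simp add: power_add mult.assoc[symmetric] flip: power_mult_distrib)
    then show ?case by (simp add: a mult.assoc[symmetric])
  next
    case (2 a)
    then obtain \<rho> \<tau> where a: "a = (\<rho>, \<tau>)" "\<rho> permutes S" "\<tau> permutes (A - S)" by auto
    then show ?case using comp(3,4)[OF a(2,3)] by simp
  qed (use comp(1,2) perm_restrict_split in auto)
  finally show ?thesis ..
qed

section \<open>Binomial identities and the main enumeration\<close>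

lemma prod_consecutive:
  fixes y :: "'b::field_char_0"
  shows "(\<Prod>i<k. y - of_nat i) * (\<Prod>i<p. y + 1 + of_nat i) = fact (p + k) * ((y + of_nat p) gchoose (p + k))"
proof -
  have rev: "(\<Prod>i<p. y + 1 + of_nat i) = (\<Prod>i<p. y + of_nat p - of_nat i)"
  proof (induction p)
    case (Suc p)
    have "(\<Prod>i<Suc p. y + of_nat (Suc p) - of_nat i) = (y + of_nat (Suc p)) * (\<Prod>i<p. y + of_nat p - of_nat i)"
      by (simp add: prod.lessThan_Suc_shift add_ac del: prod.lessThan_Suc)
    also have "\<dots> = (\<Prod>i<Suc p. y + 1 + of_nat i)"
      unfolding prod.lessThan_Suc Suc by (simp add: mult_ac add_ac)
    finally show ?case ..
  qed simp
  have "fact (p + k) * ((y + of_nat p) gchoose (p + k)) = (\<Prod>i<p + k. y + of_nat p - of_nat i)"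
    by (simp add: gbinomial_prod_rev atLeast0LessThan)
  also have "\<dots> = (\<Prod>i<p. y + of_nat p - of_nat i) * (\<Prod>i<k. y + of_nat p - of_nat (p + i))"
    by (induction k) (simp_all add: mult.assoc)
  finally show ?thesis by (simp add: rev mult_ac)
qed

lemma gbinomial_pascal:
  "(a::'b::field_char_0) gchoose Suc n = ((a - 1) gchoose n) + ((a - 1) gchoose Suc n)"
  using gbinomial_Suc_Suc[of "a - 1" n] by simp

lemma gbinomial_absorb_diff:
  "of_nat (Suc n) * ((a::'b::field_char_0) gchoose Suc n) = (a - of_nat n) * (a gchoose n)"
  using gbinomial_absorb_comp[of a n] gbinomial_absorption[of n a] by simp

text \<open>
  A permutation \<open>\<zeta>\<close> is cyclic iff the alternating sum of \<open>card S\<close> over its invariant sets \<open>S\<close> does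
  not vanish.  Summing over \<open>\<zeta>\<close> first leaves the sets \<open>S\<close> that are invariant under \<open>\<omega>\<close> and those
  with exactly one exit.  The contributions of the latter are differences
  \<open>\<Psi> k - \<Psi> (k + 1)\<close> with \<open>k = card S\<close>, and they telescope along the bijection
  \<open>(S, y) \<mapsto> (insert y S, y)\<close>, where \<open>y\<close> is the element at which \<open>\<omega>\<close> leaves \<open>S\<close>; the invariant
  sets are the two ends of each chain.
\<close>

theorem sum_cyclic_power_num_orbits:
  fixes x :: "'b::field_char_0"
  assumes A: "finite A" "card A = Suc N" and \<omega>: "\<omega> permutes A"
  shows "(\<Sum>\<zeta> | \<zeta> permutes A \<and> num_orbits A \<zeta> = 1. x ^ num_orbits A (\<omega> \<circ> \<zeta>)) =
    fact N * (\<Sum>S | S \<subseteq> A \<and> \<omega> ` S = S.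
      ((x + of_nat (card A - card S)) gchoose (N + 2)) * (- 1) ^ num_orbits S \<omega>)"
proof -
  define n where "n = card A"
  have n: "n = Suc N" using A by (simp add: n_def)
  have P: "permutation \<omega>" using \<omega> A by (auto intro: permutes_imp_permutation)
  define c where "c S = (- 1) ^ card S * signed_sum x A S \<omega>" for S
  define \<epsilon> :: "'a set \<Rightarrow> 'b" where "\<epsilon> S = (- 1) ^ num_orbits S \<omega>" for S
  define M :: "nat \<Rightarrow> 'b" where "M k = x + of_nat n - of_nat k" for k
  \<comment> \<open>A discrete antiderivative: by Pascal's rule
    \<open>\<Psi> k - \<Psi> (k + 1) = k * ((M k - 1) gchoose N)\<close>, which is
    \<open>card S * c S\<close> for a set with one exit, up to the factors
    \<open>\<epsilon> S\<close> and \<open>fact N\<close>.\<close>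
  define \<Psi> where "\<Psi> k = of_nat k * (M k gchoose n) + (M k gchoose Suc n)" for k
  \<comment> \<open>An invariant \<open>S\<close> admits every \<open>y\<close> outside it in
    \<open>d1\<close> and every \<open>y\<close> inside it in \<open>d2\<close>. A set with one exit
    admits exactly one \<open>y\<close> in each, and a set with more exits admits none.\<close>
  define d1 where "d1 S = (\<Sum>y | y \<in> A - S \<and> \<omega> ` S \<subseteq> insert y S. \<epsilon> (insert y S) * \<Psi> (card (insert y S)))" for S
  define d2 where "d2 S = (\<Sum>y | y \<in> S \<and> \<omega> ` (S - {y}) \<subseteq> S. \<epsilon> S * \<Psi> (card S))" for S
  have d: "sum d1 (Pow A) = sum d2 (Pow A)"
  proof -
    have fin: "finite (A - S)" "finite {y \<in> A - S. Q y}" for S Q using A by auto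
    have fin2: "finite S" "finite {y \<in> S. Q y}" if "S \<in> Pow A" for S Q
      using that by (auto intro!: finite_subset[OF _ A(1)])
    have "sum d1 (Pow A) = (\<Sum>(S, y)\<in>(SIGMA S:Pow A. {y \<in> A - S. \<omega> ` S \<subseteq> insert y S}). \<epsilon> (insert y S) * \<Psi> (card (insert y S)))"
      unfolding d1_def by (rule sum.Sigma) (use A fin in auto)
    also have "\<dots> = (\<Sum>(S, y)\<in>(SIGMA S:Pow A. {y \<in> S. \<omega> ` (S - {y}) \<subseteq> S}). \<epsilon> S * \<Psi> (card S))"
      by (rule sum.reindex_bij_witness[of _ "\<lambda>(S, y). (S - {y}, y)" "\<lambda>(S, y). (insert y S, y)"])
        (auto simp: insert_absorb)
    also have "\<dots> = sum d2 (Pow A)"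
      unfolding d2_def by (rule sum.Sigma[symmetric]) (use A fin2 in auto)
    finally show ?thesis .
  qed
  have pointwise: "fact N * (d2 S - d1 S) - of_nat (card S) * c S =
      (if \<omega> ` S = S then of_nat n * (fact N * ((M (card S) gchoose Suc n) * \<epsilon> S)) else 0)"
    if SA: "S \<subseteq> A" for S
  proof -
    interpret split_set A S x by standard (use A SA in auto)
    define k where "k = card S"
    have kn: "k \<le> n" unfolding k_def n_def using A(1) SA by (rule card_mono)
    have cT: "card (A - S) = n - k" using SA finS by (simp add: card_Diff_subset k_def n_def)
    have cI: "card (insert y S) = Suc k" if "y \<in> A - S" for y using that finS by (simp add: k_def)
    have MS: "M (Suc k) = M k - 1" for k by (simp add: M_def)
    show ?thesis
    proof (cases "\<omega> ` S = S")
      case True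
      \<comment> \<open>A point outside an invariant set lies on a cycle disjoint from it, so one
        more cycle is met and the sign changes.\<close>
      have \<epsilon>y: "\<epsilon> (insert y S) = - \<epsilon> S" if y: "y \<in> A - S" for y
      proof -
        have "orbit \<omega> y \<notin> orbit \<omega> ` S"
        proof
          assume "orbit \<omega> y \<in> orbit \<omega> ` S"
          then obtain s where s: "s \<in> S" "orbit \<omega> y = orbit \<omega> s" by blast
          then have "y \<in> orbit \<omega> s" using permutation_self_in_orbit[OF P, of y] by simp
          then have "y \<in> S" by induct (use True s in auto)
          with y show False by simp
        qed
        then show ?thesis using finS by (simp add: \<epsilon>_def num_orbits_def)
      qed
      have "{y. y \<in> A - S \<and> \<omega> ` S \<subseteq> insert y S} = A - S" using True by auto
      then have d1: "d1 S = - (of_nat (n - k) * (\<epsilon> S * \<Psi> (Suc k)))"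
        unfolding d1_def using \<epsilon>y cI cT by simp
      have "{y. y \<in> S \<and> \<omega> ` (S - {y}) \<subseteq> S} = S" using True by auto
      then have d2: "d2 S = of_nat k * (\<epsilon> S * \<Psi> k)" unfolding d2_def k_def by simp
      have "of_nat k * c S = \<epsilon> S * (fact N * (of_nat k * (of_nat n * ((M k - 1) gchoose n) + of_nat k * ((M k - 1) gchoose N))))"
      proof (cases k)
        case (Suc k')
        \<comment> \<open>Both products contain \<open>x\<close>. Taking out one copy leaves
          consecutive factors; the copy itself is written as
          \<open>(M k - 1 - of_nat N) + of_nat k\<close> and absorbed into binomial
          coefficients.\<close>
        have "(\<Prod>i<k. x - of_nat i) * (\<Prod>i<n - k. x + of_nat i) =
          x * ((\<Prod>i<k'. (x - 1) - of_nat i) * (\<Prod>i<n - k. (x - 1) + 1 + of_nat i))"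
          by (simp add: Suc prod.lessThan_Suc_shift algebra_simps del: prod.lessThan_Suc)
        also have "\<dots> = x * (fact N * ((M k - 1) gchoose N))"
          unfolding prod_consecutive using kn Suc n by (simp add: M_def of_nat_diff algebra_simps)
        also have "x * (fact N * ((M k - 1) gchoose N)) = fact N * (((M k - 1 - of_nat N) * ((M k - 1) gchoose N)) + of_nat k * ((M k - 1) gchoose N))"
          using n by (simp add: M_def algebra_simps)
        finally have "(\<Prod>i<k. x - of_nat i) * (\<Prod>i<n - k. x + of_nat i) =
          fact N * (of_nat n * ((M k - 1) gchoose n) + of_nat k * ((M k - 1) gchoose N))"
          using gbinomial_absorb_diff[of N "M k - 1"] n by simp
        moreover have "c S = \<epsilon> S * ((\<Prod>i<k. x - of_nat i) * (\<Prod>i<n - k. x + of_nat i))"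
          unfolding c_def \<epsilon>_def signed_sum_invariant[OF \<omega> True] cT k_def ..
        ultimately show ?thesis by (simp only: mult_ac)
      qed simp
      moreover have "M k gchoose n = ((M k - 1) gchoose N) + ((M k - 1) gchoose n)"
        "M k gchoose Suc n = ((M k - 1) gchoose n) + ((M k - 1) gchoose Suc n)"
        using gbinomial_pascal n by blast+
      moreover have "of_nat n = (of_nat k + of_nat (n - k) :: 'b)" using kn by (simp flip: of_nat_add)
      \<comment> \<open>What remains after Pascal's rule is this ring identity, with
        \<open>F = fact N\<close>, \<open>K = k\<close>, \<open>R = n - k\<close>,
        \<open>e = \<epsilon> S\<close> and \<open>a\<close>, \<open>b\<close>, \<open>d\<close> the
        binomial coefficients of \<open>M k - 1\<close> over \<open>N\<close>, \<open>n\<close>,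
        \<open>Suc n\<close>.\<close>
      moreover have "F * (K * (e * (K * (a + b) + (b + d))) - - (R * (e * ((1 + K) * b + d))))
          - e * (F * (K * ((K + R) * b + K * a))) = (K + R) * (F * ((b + d) * e))"
        for F K R e a b d :: 'b by (simp add: algebra_simps)
      ultimately show ?thesis using True
        unfolding d1 d2 k_def[symmetric] \<Psi>_def MS by (simp only: of_nat_Suc if_True simp_thms)
    next
      case False
      have "\<not> \<omega> ` S \<subseteq> S"
        using False finS by (metis card_image card_subset_eq permutes_inj_on[OF \<omega>])
      then obtain i where i: "i \<in> S" "\<omega> i \<notin> S" by blast
      have iA: "\<omega> i \<in> A" using i SA permutes_in_image[OF \<omega>] by auto
      show ?thesis
      proof (cases "\<forall>j\<in>S. j \<noteq> i \<longrightarrow> \<omega> j \<in> S")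
        case True
        have "{y. y \<in> A - S \<and> \<omega> ` S \<subseteq> insert y S} = {\<omega> i}" using True i iA by auto
        \<comment> \<open>The point \<open>\<omega> i\<close> is on the cycle of \<open>i\<close>,
          which \<open>S\<close> already meets.\<close>
        moreover have "\<epsilon> (insert (\<omega> i) S) = \<epsilon> S"
          using i permutation_orbit_step[OF P, of i] by (simp add: \<epsilon>_def num_orbits_def insert_absorb)
        ultimately have d1: "d1 S = \<epsilon> S * \<Psi> (Suc k)" unfolding d1_def using cI i iA by simp
        have "{y. y \<in> S \<and> \<omega> ` (S - {y}) \<subseteq> S} = {i}" using True i by auto
        then have d2: "d2 S = \<epsilon> S * \<Psi> k" unfolding d2_def k_def by simp
        have "k < n" using i iA SA A unfolding k_def n_def by (metis psubsetI psubset_card_mono)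
        have "c S = \<epsilon> S * ((\<Prod>i<k. x - of_nat i) * (\<Prod>i<n - k - 1. x + 1 + of_nat i))"
          unfolding c_def \<epsilon>_def k_def using signed_sum_one_exit[OF \<omega> i] True cT by (simp add: k_def)
        also have "\<dots> = \<epsilon> S * (fact N * ((M k - 1) gchoose N))"
          unfolding prod_consecutive using \<open>k < n\<close> n by (simp add: M_def of_nat_diff algebra_simps)
        finally have "c S = \<epsilon> S * (fact N * ((M k - 1) gchoose N))" .
        moreover have "M k gchoose n = ((M k - 1) gchoose N) + ((M k - 1) gchoose n)"
          "M k gchoose Suc n = ((M k - 1) gchoose n) + ((M k - 1) gchoose Suc n)"
          using gbinomial_pascal n by blast+
        ultimately show ?thesis using False
          unfolding d1 d2 k_def[symmetric] \<Psi>_def MS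
          by (simp add: algebra_simps)
      next
        case F2: False
        then obtain j where j: "j \<in> S" "j \<noteq> i" "\<omega> j \<notin> S" by blast
        have ne: "\<omega> i \<noteq> \<omega> j" using j \<omega> by (metis injD permutes_inj)
        have no_entry: "{y. y \<in> A - S \<and> \<omega> ` S \<subseteq> insert y S} = {}" using i j ne by auto
        have d1: "d1 S = 0" unfolding d1_def no_entry by (rule sum.empty)
        have no_exit: "{y. y \<in> S \<and> \<omega> ` (S - {y}) \<subseteq> S} = {}" using i j by auto
        have d2: "d2 S = 0" unfolding d2_def no_exit by (rule sum.empty)
        have "c S = 0" using two_exits[OF \<omega> i] j by (simp add: c_def)
        with d1 d2 False show ?thesis by simp
      qed
    qed
  qed
  let ?L = "\<Sum>\<zeta> | \<zeta> permutes A \<and> num_orbits A \<zeta> = 1. x ^ num_orbits A (\<omega> \<circ> \<zeta>)"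
  have fp: "finite {\<zeta>. \<zeta> permutes A}" using A by (simp add: finite_permutations)
  have "of_nat n * ?L = (\<Sum>\<zeta> | \<zeta> permutes A. (if num_orbits A \<zeta> = 1 then of_nat n else 0) * x ^ num_orbits A (\<omega> \<circ> \<zeta>))"
    unfolding sum_distrib_left by (rule sum.mono_neutral_cong_left) (use fp in auto)
  \<comment> \<open>The weighted alternating sum over invariant sets is \<open>- n\<close> for
    cyclic \<open>\<zeta>\<close> and \<open>0\<close> otherwise.\<close>
  also have "\<dots> = (\<Sum>\<zeta> | \<zeta> permutes A. - (\<Sum>S | S \<subseteq> A \<and> \<zeta> ` S = S. of_nat (card S) * (- 1) ^ num_orbits S \<zeta>) * x ^ num_orbits A (\<omega> \<circ> \<zeta>))"
    using sum_invariant_sets_card[OF A(1), where 'b='b] by (intro sum.cong refl) (simp add: n_def)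
  also have "\<dots> = - (\<Sum>\<zeta> | \<zeta> permutes A. \<Sum>S | S \<in> Pow A \<and> \<zeta> ` S = S. of_nat (card S) * ((- 1) ^ num_orbits S \<zeta> * x ^ num_orbits A (\<omega> \<circ> \<zeta>)))"
    by (simp add: sum_negf sum_distrib_right mult.assoc)
  also have "\<dots> = - (\<Sum>S\<in>Pow A. \<Sum>\<zeta> | \<zeta> \<in> {\<zeta>. \<zeta> permutes A} \<and> \<zeta> ` S = S. of_nat (card S) * ((- 1) ^ num_orbits S \<zeta> * x ^ num_orbits A (\<omega> \<circ> \<zeta>)))"
    by (subst sum.swap_restrict) (use fp A in auto)
  also have "\<dots> = - (\<Sum>S\<in>Pow A. of_nat (card S) * c S)"
    unfolding c_def sum_distrib_left[symmetric] mem_Collect_eq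
    by (intro arg_cong[of _ _ uminus] sum.cong refl arg_cong2[where f="(*)"] sum_preserving_eq_signed_sum) (use A in auto)
  \<comment> \<open>By \<open>d\<close> the added terms sum to zero; with them the summands of all
    sets that are not invariant vanish one by one.\<close>
  also have "\<dots> = (\<Sum>S\<in>Pow A. fact N * (d2 S - d1 S) - of_nat (card S) * c S)"
    using d by (simp add: sum_subtractf sum_distrib_left[symmetric])
  also have "\<dots> = (\<Sum>S\<in>Pow A. if \<omega> ` S = S then of_nat n * (fact N * ((M (card S) gchoose Suc n) * \<epsilon> S)) else 0)"
    by (intro sum.cong refl pointwise) auto
  also have "\<dots> = of_nat n * (fact N * (\<Sum>S | S \<in> Pow A \<and> \<omega> ` S = S. (M (card S) gchoose Suc n) * \<epsilon> S))"
    using A by (simp add: sum.inter_filter[symmetric] sum_distrib_left)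
  finally have "of_nat n * ?L = of_nat n * (fact N * (\<Sum>S | S \<in> Pow A \<and> \<omega> ` S = S. (M (card S) gchoose Suc n) * \<epsilon> S))" .
  moreover have "(of_nat n :: 'b) \<noteq> 0" unfolding n by (rule of_nat_neq_0)
  ultimately have "?L = fact N * (\<Sum>S | S \<in> Pow A \<and> \<omega> ` S = S. (M (card S) gchoose Suc n) * \<epsilon> S)"
    by (simp only: mult_cancel_left) simp
  moreover have "M (card S) = x + of_nat (card A - card S)" if "S \<subseteq> A" for S
    using that A card_mono[OF A(1) that] by (simp add: M_def n_def of_nat_diff)
  ultimately show ?thesis by (simp add: \<epsilon>_def n cong: conj_cong)
qed

section \<open>The series of the logarithm of \<open>(1 + v/2) / (1 - v/2)\<close>\<close>

definition half_plus :: "'a::field_char_0 fps" where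
  "half_plus = 1 + fps_const (1 / 2) * fps_X"

definition half_minus :: "'a::field_char_0 fps" where
  "half_minus = 1 - fps_const (1 / 2) * fps_X"

definition half_ratio :: "'a::field_char_0 fps" where
  "half_ratio = half_plus * inverse half_minus"

lemma half_nth_0 [simp]: "half_plus $ 0 = 1" "half_minus $ 0 = 1"
  by (simp_all add: half_plus_def half_minus_def)

lemma half_inverse [simp]: "half_minus * inverse half_minus = 1" "half_plus * inverse half_plus = 1"
  by (simp_all add: inverse_mult_eq_1')

lemma half_ratio_diff: "half_ratio - 1 = fps_X * inverse half_minus"
proof -
  have "half_plus - half_minus = (fps_const (1/2) + fps_const (1/2)) * (fps_X :: 'a fps)"
    by (simp add: half_plus_def half_minus_def algebra_simps del: fps_const_add)
  then have "half_plus - half_minus = (fps_X :: 'a fps)" by simp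
  then have "fps_X * inverse half_minus = half_ratio - half_minus * inverse (half_minus :: 'a fps)"
    by (metis half_ratio_def left_diff_distrib)
  then show ?thesis by simp
qed

lemma half_minus_power_nth: "k > m \<Longrightarrow> (half_minus ^ m :: 'a::field_char_0 fps) $ k = 0"
proof (induction m arbitrary: k)
  case (Suc m)
  have "(half_minus ^ Suc m :: 'a fps) = half_minus ^ m - fps_const (1/2) * (fps_X * half_minus ^ m)"
    by (subst (1) half_minus_def) (simp add: algebra_simps half_minus_def)
  then show ?case using Suc.prems Suc.IH[of k] Suc.IH[of "k - 1"] by simp
qed simp

text \<open>
  With \<open>M\<close> as the variable, both sides satisfy Pascal's rule.
\<close>

lemma half_ratio_power_nth_aux:
  "(half_ratio ^ M * half_minus ^ n * inverse half_minus) $ n = (of_nat (M choose n) :: 'a::field_char_0)"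
proof (induction M arbitrary: n)
  case 0
  show ?case
  proof (cases n)
    case (Suc m)
    have "half_minus ^ n * inverse half_minus = half_minus ^ m * (half_minus * inverse (half_minus :: 'a fps))"
      by (simp only: Suc power_Suc mult_ac)
    then have "(half_ratio ^ 0 * half_minus ^ n * inverse half_minus) $ n = ((half_minus ^ m) :: 'a fps) $ n"
      by simp
    then show ?thesis using Suc by (simp only: half_minus_power_nth) simp
  qed simp
next
  case (Suc M)
  have eq: "(half_ratio ^ Suc M :: 'a fps) = half_ratio ^ M + fps_X * (half_ratio ^ M * inverse half_minus)"
  proof -
    have "(half_ratio ^ Suc M :: 'a fps) = half_ratio ^ M + half_ratio ^ M * (half_ratio - 1)"
      by (simp add: algebra_simps)
    then show ?thesis by (simp add: half_ratio_diff mult_ac)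
  qed
  show ?case
  proof (cases n)
    case 0
    then show ?thesis unfolding eq using Suc.IH[of 0] by simp
  next
    case (Suc m)
    have "half_ratio ^ Suc M * half_minus ^ n * inverse half_minus =
      half_ratio ^ M * half_minus ^ n * inverse half_minus +
      fps_X * (half_ratio ^ M * half_minus ^ m * inverse half_minus * (half_minus * inverse (half_minus :: 'a fps)))"
      unfolding eq unfolding Suc power_Suc by (simp only: algebra_simps)
    then show ?thesis using Suc.IH[of n] Suc.IH[of m] Suc by simp
  qed
qed

text \<open>This is the change of variable \<open>t = v / (1 - v/2)\<close> in the coefficient of
  \<open>t ^ Suc n\<close> in \<open>(1 + t) ^ M\<close>. It turns the binomials of the enumeration
  into coefficients of a single series, where the sum over sets of cycles can be factored.\<close>

lemma half_ratio_power_nth: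
  "(half_ratio ^ M * half_minus ^ n) $ Suc n = (of_nat (M choose Suc n) :: 'a::field_char_0)"
proof -
  have "half_ratio ^ M * half_minus ^ Suc n * inverse half_minus =
    half_ratio ^ M * half_minus ^ n * (half_minus * inverse (half_minus :: 'a fps))"
    by (simp only: power_Suc mult_ac)
  then show ?thesis using half_ratio_power_nth_aux[of M "Suc n", where 'a='a]
    by (simp only: half_inverse mult_1_right)
qed

lemma half_ratio_half_minus_power:
  assumes "s \<le> n"
  shows "half_ratio ^ (n - s) * half_minus ^ n = half_plus ^ (n - s) * (half_minus ^ s :: 'a::field_char_0 fps)"
proof -
  have "(half_minus :: 'a fps) ^ n = half_minus ^ (n - s) * half_minus ^ s"
    using assms by (simp flip: power_add)
  moreover have "half_ratio ^ (n - s) * half_minus ^ (n - s) = (half_plus ^ (n - s) :: 'a fps)"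
    unfolding power_mult_distrib[symmetric] half_ratio_def by (simp add: mult.assoc inverse_mult_eq_1)
  ultimately show ?thesis by (simp add: mult.assoc[symmetric])
qed

text \<open>
  The series of \<open>ln ((1 + v/2) / (1 - v/2))\<close>.
\<close>

definition half_log :: "'a::field_char_0 fps" where
  "half_log = Abs_fps (\<lambda>k. if odd k then 2 / (2 ^ k * of_nat k) else 0)"

lemma half_log_nth_0 [simp]: "half_log $ 0 = 0"
  by (simp add: half_log_def)

lemma deriv_half_log: "fps_deriv half_log * (half_plus * half_minus) = (1 :: 'a::field_char_0 fps)"
proof -
  have pq: "half_plus * half_minus = 1 - fps_const (1/4) * (fps_X * (fps_X :: 'a fps))"
  proof -
    have "fps_const (1/2) * fps_X * (fps_const (1/2) * fps_X) = fps_const (1/2 * (1/2)) * (fps_X * (fps_X :: 'a fps))"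
      by (simp only: fps_const_mult[symmetric] mult_ac)
    then show ?thesis by (simp add: half_plus_def half_minus_def algebra_simps)
  qed
  have d: "fps_deriv half_log $ k = (if even k then 1 / 2 ^ k else 0 :: 'a)" for k
    by (simp add: half_log_def del: of_nat_Suc)
  have "fps_deriv half_log * (half_plus * half_minus) =
      fps_deriv half_log - fps_const (1/4) * (fps_X * (fps_X * (fps_deriv half_log :: 'a fps)))"
    unfolding pq by (simp add: algebra_simps)
  also have "\<dots> = 1"
  proof (rule fps_ext)
    fix k
    consider "k = 0" | "k = 1" | m where "k = Suc (Suc m)" by (metis One_nat_def not0_implies_Suc)
    then show "(fps_deriv half_log - fps_const (1/4) * (fps_X * (fps_X * fps_deriv half_log))) $ k = (1 :: 'a fps) $ k"
      by cases (simp_all add: d del: fps_deriv_nth)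
  qed
  finally show ?thesis .
qed

text \<open>The quotient of the two sides, \<open>E * half_minus * ip\<close>, has derivative zero
  and constant term one.\<close>

lemma exp_half_log: "fps_exp 1 oo half_log = (half_ratio :: 'a::field_char_0 fps)"
proof -
  define E :: "'a fps" where "E = fps_exp 1 oo half_log"
  define ip iq :: "'a fps" where "ip = inverse half_plus" and "iq = inverse half_minus"
  have p: "half_plus * ip = 1" and q: "half_minus * iq = 1" by (simp_all add: ip_def iq_def)
  have E': "fps_deriv E = E * fps_deriv half_log"
    unfolding E_def by (subst fps_compose_deriv) simp_all
  have L': "fps_deriv half_log = ip * iq"
  proof -
    have "fps_deriv half_log = fps_deriv half_log * (half_plus * ip) * (half_minus * iq)" by (simp add: p q)
    also have "\<dots> = fps_deriv half_log * (half_plus * half_minus) * (ip * iq)" by (simp only: mult_ac)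
    finally show ?thesis by (simp add: deriv_half_log)
  qed
  define h :: "'a fps" where "h = fps_const (1/2)"
  have dp: "fps_deriv half_plus = h" "fps_deriv half_minus = - h"
    by (simp_all add: half_plus_def half_minus_def h_def)
  have "fps_deriv ip = - h * ip ^ 2"
    unfolding ip_def by (subst fps_inverse_deriv) (simp_all add: dp)
  then have "fps_deriv (E * half_minus * ip) =
      E * (ip * iq) * half_minus * ip - E * h * ip - E * half_minus * (h * ip ^ 2)"
    by (simp add: E' L' dp algebra_simps)
  also have "\<dots> = E * ip * ip * ((half_minus * iq) - h * (half_plus + half_minus)) + E * ip * h * (half_plus * ip - 1)"
    by (simp add: power2_eq_square algebra_simps)
  also have "\<dots> = 0"
  proof -
    have "h * (half_plus + half_minus) = (1 :: 'a fps)"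
      by (simp add: half_plus_def half_minus_def h_def algebra_simps numeral_fps_const flip: fps_const_add)
    then show ?thesis by (simp add: p q)
  qed
  finally have "E * half_minus * ip = fps_const ((E * half_minus * ip) $ 0)"
    by (rule iffD1[OF fps_deriv_eq_0_iff])
  also have "(E * half_minus * ip) $ 0 = 1" by (simp add: E_def ip_def)
  finally have "E * half_minus * ip = 1" by simp
  then have "E * (half_minus * iq) * (half_plus * ip) = half_plus * iq" by (simp add: mult_ac)
  then show ?thesis by (simp add: p q E_def half_ratio_def iq_def)
qed

text \<open>As the exponential of \<open>m * half_log\<close>, the power has coefficients polynomial
  in \<open>m\<close>; the degree is bounded because \<open>half_log\<close> has no constant term.
  This prepares the comparison of coefficients in \<open>m\<close>.\<close>

lemma half_ratio_power_mult_nth: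
  "(half_ratio ^ m * P) $ k = (\<Sum>j\<le>k. of_nat m ^ j * ((half_log ^ j * P) $ k / fact j) :: 'a::field_char_0)"
proof -
  have "half_ratio ^ m = fps_exp (of_nat m) oo (half_log :: 'a fps)"
    by (simp add: fps_compose_power fps_exp_power_mult flip: exp_half_log)
  then have R: "(half_ratio ^ m) $ t = (\<Sum>j\<le>k. of_nat m ^ j / fact j * (half_log ^ j :: 'a fps) $ t)" if "t \<le> k" for t
  proof -
    have "(half_ratio ^ m) $ t = (\<Sum>j=0..t. of_nat m ^ j / fact j * (half_log ^ j :: 'a fps) $ t)"
      by (simp add: fps_compose_nth \<open>half_ratio ^ m = _\<close>)
    also have "\<dots> = (\<Sum>j\<le>k. of_nat m ^ j / fact j * (half_log ^ j :: 'a fps) $ t)"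
      by (rule sum.mono_neutral_left) (use that in \<open>auto simp: startsby_zero_power_prefix\<close>)
    finally show ?thesis .
  qed
  have "(half_ratio ^ m * P) $ k = (\<Sum>t=0..k. \<Sum>j\<le>k. of_nat m ^ j / fact j * (half_log ^ j :: 'a fps) $ t * P $ (k - t))"
    unfolding fps_mult_nth by (intro sum.cong refl) (simp add: R sum_distrib_right)
  also have "\<dots> = (\<Sum>j\<le>k. of_nat m ^ j * ((half_log ^ j * P) $ k / fact j))"
    by (subst sum.swap) (simp add: fps_mult_nth sum_distrib_left sum_divide_distrib mult.assoc)
  finally show ?thesis .
qed

section \<open>Permutations of given cycle type\<close>

definition orbit_type :: "'a set \<Rightarrow> ('a \<Rightarrow> 'a) \<Rightarrow> nat multiset" where
  "orbit_type A p = image_mset card (mset_set (orbit p ` A))"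

text \<open>
  The proportion of permutations with cycle type \<open>a\<close>.
\<close>

definition type_weight :: "nat multiset \<Rightarrow> 'b::field_char_0" where
  "type_weight a = 1 / (of_nat (sym_factor a) * of_nat (\<Prod>\<^sub># a))"

lemma int_partitions_iff: "a \<in> int_partitions n \<longleftrightarrow> 0 \<notin># a \<and> \<Sum>\<^sub># a = n"
  by (simp add: int_partitions_def)

lemma sym_factor_pos: "sym_factor a \<noteq> 0"
  by (simp add: sym_factor_def)

lemma sym_factor_add: "sym_factor (add_mset i a) = Suc (count a i) * sym_factor a"
proof -
  have "sym_factor a = (\<Prod>j\<in>insert i (set_mset a). fact (count a j))"
    unfolding sym_factor_def
    by (rule prod.mono_neutral_left) (auto simp: not_in_iff)
  also have "\<dots> = fact (count a i) * (\<Prod>j\<in>insert i (set_mset a) - {i}. fact (count a j))"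
    by (rule prod.remove) auto
  finally have 1: "sym_factor a = fact (count a i) * (\<Prod>j\<in>insert i (set_mset a) - {i}. fact (count a j))" .
  have "sym_factor (add_mset i a) = (\<Prod>j\<in>insert i (set_mset a). fact (count (add_mset i a) j))"
    by (simp add: sym_factor_def)
  also have "\<dots> = fact (count (add_mset i a) i) * (\<Prod>j\<in>insert i (set_mset a) - {i}. fact (count (add_mset i a) j))"
    by (rule prod.remove) auto
  also have "(\<Prod>j\<in>insert i (set_mset a) - {i}. fact (count (add_mset i a) j)) = (\<Prod>j\<in>insert i (set_mset a) - {i}. fact (count a j))"
    by (rule prod.cong) auto
  finally show ?thesis using 1 by (simp add: algebra_simps)
qed

lemma type_weight_add:
  assumes "i \<noteq> 0"
  shows "of_nat (i * Suc (count a i)) * type_weight (add_mset i a) = (type_weight a :: 'b::field_char_0)"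
proof -
  have "(of_nat (i * Suc (count a i)) :: 'b) \<noteq> 0" unfolding of_nat_eq_0_iff using assms by simp
  then show ?thesis
    by (simp add: type_weight_def sym_factor_add field_simps del: of_nat_Suc mult_Suc_right)
qed

lemma sum_mset_count: "(\<Sum>i\<in>#a. f i) = (\<Sum>i\<in>set_mset a. of_nat (count a i) * (f i :: 'b::comm_semiring_1))"
proof (induction a)
  case (add x a)
  have "(\<Sum>i\<in>set_mset (add_mset x a). of_nat (count (add_mset x a) i) * f i) =
    (\<Sum>i\<in>insert x (set_mset a). of_nat (count a i) * f i + (if i = x then f i else 0))"
    by (simp, intro sum.cong refl) (auto simp: algebra_simps)
  also have "\<dots> = (\<Sum>i\<in>insert x (set_mset a). of_nat (count a i) * f i) + f x"
    by (simp add: sum.distrib)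
  also have "(\<Sum>i\<in>insert x (set_mset a). of_nat (count a i) * f i) = (\<Sum>i\<in>set_mset a. of_nat (count a i) * f i)"
    by (rule sum.mono_neutral_right) (auto simp: not_in_iff)
  finally show ?case using add by (simp add: add_ac)
qed simp

text \<open>A marked part \<open>i\<close> is removed from \<open>a\<close>. The weights agree
  because \<open>i * count a i * type_weight a\<close> is the weight of the rest.\<close>

lemma sum_int_partitions_remove:
  fixes H :: "nat multiset \<Rightarrow> nat \<Rightarrow> 'b::field_char_0"
  shows "(\<Sum>a\<in>int_partitions n. type_weight a * (\<Sum>i\<in>#a. of_nat i * H (a - {#i#}) i)) =
    (\<Sum>i=1..n. \<Sum>b\<in>int_partitions (n - i). type_weight b * H b i)"
proof -
  have "(\<Sum>a\<in>int_partitions n. type_weight a * (\<Sum>i\<in>#a. of_nat i * H (a - {#i#}) i)) =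
    (\<Sum>(a, i)\<in>(SIGMA a:int_partitions n. set_mset a). type_weight a * of_nat (i * count a i) * H (a - {#i#}) i)"
    by (simp add: sum_mset_count sum_distrib_left mult_ac finite_int_partitions flip: sum.Sigma)
  also have "\<dots> = (\<Sum>(i, b)\<in>(SIGMA i:{1..n}. int_partitions (n - i)). type_weight b * H b i)"
  proof (rule sum.reindex_bij_witness[of _ "\<lambda>(i, b). (add_mset i b, i)" "\<lambda>(a, i). (i, a - {#i#})"], goal_cases)
    case (1 x)
    then show ?case by auto
  next
    case (2 x)
    then obtain a i where x: "x = (a, i)" "a \<in> int_partitions n" "i \<in># a" by auto
    then obtain b where b: "a = add_mset i b" by (metis insert_DiffM)
    have "i \<noteq> 0" using x by (metis int_partitions_iff)
    with x b show ?case by (auto simp: int_partitions_iff)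
  next
    case (3 x)
    then show ?case by auto
  next
    case (4 x)
    then show ?case by (auto simp: int_partitions_iff)
  next
    case (5 x)
    then obtain a i where x: "x = (a, i)" "a \<in> int_partitions n" "i \<in># a" by auto
    then obtain b where b: "a = add_mset i b" by (metis insert_DiffM)
    have "i \<noteq> 0" using x by (metis int_partitions_iff)
    from type_weight_add[OF this, of b, where 'b='b] show ?case
      using x b by (simp add: mult_ac del: of_nat_mult)
  qed
  also have "\<dots> = (\<Sum>i=1..n. \<Sum>b\<in>int_partitions (n - i). type_weight b * H b i)"
    by (simp add: finite_int_partitions flip: sum.Sigma)
  finally show ?thesis .
qed

text \<open>
  The induction inserts a point into the permutation, either as a fixed point or into a cycle.
\<close>

lemma sum_permutes_orbit_type:
  fixes F :: "nat multiset \<Rightarrow> 'b::field_char_0"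
  assumes "finite A"
  shows "(\<Sum>p | p permutes A. F (orbit_type A p)) =
    fact (card A) * (\<Sum>a\<in>int_partitions (card A). type_weight a * F a)"
  using assms
proof (induction A arbitrary: F rule: finite_induct)
  case empty
  have "int_partitions 0 = {{#}}" by (auto simp: int_partitions_iff) (metis multiset_cases sum_mset.add_mset add_eq_0_iff_both_eq_0 insert_noteq_member union_single_eq_member)
  then show ?case by (simp add: orbit_type_def type_weight_def sym_factor_def)
next
  case (insert x A)
  \<comment> \<open>The effect of one inserted point on the type: a new part \<open>1\<close>, or a
    part \<open>i\<close> enlarged in \<open>i\<close> ways.\<close>
  define G where "G a = F (add_mset 1 a) + (\<Sum>i\<in>#a. of_nat i * F (add_mset (Suc i) (a - {#i#})))" for a
  have "(\<Sum>b\<in>insert x A. F (orbit_type (insert x A) (transpose x b \<circ> q))) = G (orbit_type A q)"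
    if q: "q permutes A" for q
  proof -
    have P: "permutation q" using q insert.hyps by (auto intro: permutes_imp_permutation)
    have fO: "finite (orbit q ` A)" using insert.hyps by simp
    have fB: "finite B" if "B \<in> orbit q ` A" for B
    proof -
      have "B \<subseteq> A" using that permutes_orbit_subset[OF q] by fast
      then show ?thesis using insert.hyps finite_subset by blast
    qed
    have x: "orbit_type (insert x A) (transpose x x \<circ> q) = add_mset 1 (orbit_type A q)"
      using orbits_insert_fixed[OF q insert.hyps(2)] fO by (simp add: orbit_type_def)
    have ins: "orbit_type (insert x A) (transpose x b \<circ> q) =
        add_mset (Suc (card (orbit q b))) (orbit_type A q - {#card (orbit q b)#})" if b: "b \<in> A" for b
    proof -
      have "x \<notin> orbit q b" using permutes_orbit_subset[OF q b] insert.hyps by blast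
      then have "card (insert x (orbit q b)) = Suc (card (orbit q b))" using fB b by simp
      moreover have "mset_set (orbit q ` A - {orbit q b}) = mset_set (orbit q ` A) - {#orbit q b#}"
        using fO b by (simp add: mset_set_Diff)
      ultimately show ?thesis
        using orbits_insert_transpose[OF q insert.hyps b] fO b
        by (simp add: orbit_type_def image_mset_Diff)
    qed
    have "(\<Sum>b\<in>A. h (card (orbit q b))) = (\<Sum>i\<in>#orbit_type A q. of_nat i * h i)" for h :: "nat \<Rightarrow> 'b"
    proof -
      have "(\<Sum>b\<in>A. h (card (orbit q b))) = (\<Sum>B\<in>orbit q ` A. \<Sum>b | b \<in> A \<and> orbit q b = B. h (card (orbit q b)))"
        by (rule sum.image_gen) (use insert.hyps in auto)
      also have "\<dots> = (\<Sum>B\<in>orbit q ` A. of_nat (card B) * h (card B))"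
      proof (rule sum.cong[OF refl])
        fix B assume B: "B \<in> orbit q ` A"
        then obtain a where a: "a \<in> A" "B = orbit q a" by blast
        have "{b. b \<in> A \<and> orbit q b = B} = B"
          using a orbit_eq_permutation[OF P] permutation_self_in_orbit[OF P] permutes_orbit_subset[OF q a(1)] by auto
        moreover have "(\<Sum>b | b \<in> A \<and> orbit q b = B. h (card (orbit q b))) = (\<Sum>b | b \<in> A \<and> orbit q b = B. h (card B))"
          by (rule sum.cong) auto
        ultimately show "(\<Sum>b | b \<in> A \<and> orbit q b = B. h (card (orbit q b))) = of_nat (card B) * h (card B)" by simp
      qed
      also have "\<dots> = (\<Sum>i\<in>#orbit_type A q. of_nat i * h i)"
        by (simp add: orbit_type_def sum_unfold_sum_mset image_mset.compositionality o_def)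
      finally show ?thesis .
    qed
    from this[of "\<lambda>c. F (add_mset (Suc c) (orbit_type A q - {#c#}))"]
    have "(\<Sum>b\<in>A. F (orbit_type (insert x A) (transpose x b \<circ> q))) =
       (\<Sum>i\<in>#orbit_type A q. of_nat i * F (add_mset (Suc i) (orbit_type A q - {#i#})))"
      by (simp only: ins cong: sum.cong)
    then show ?thesis unfolding G_def using insert.hyps x by simp
  qed
  then have "(\<Sum>p | p permutes insert x A. F (orbit_type (insert x A) p)) = (\<Sum>q | q permutes A. G (orbit_type A q))"
    by (subst sum_over_permutations_insert[OF insert.hyps], subst sum.swap) (intro sum.cong refl, blast)
  also have "\<dots> = fact (card A) * (\<Sum>a\<in>int_partitions (card A). type_weight a * G a)"
    by (rule insert.IH)
  also have "(\<Sum>a\<in>int_partitions (card A). type_weight a * G a) =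
    (\<Sum>a\<in>int_partitions (card A). type_weight a * F (add_mset 1 a)) +
    (\<Sum>i=1..card A. \<Sum>b\<in>int_partitions (card A - i). type_weight b * F (add_mset (Suc i) b))"
    using sum_int_partitions_remove[where n = "card A" and H = "\<lambda>b i. F (add_mset (Suc i) b)"]
    by (simp add: G_def distrib_left sum.distrib)
  \<comment> \<open>The fixed point supplies the part \<open>1\<close>, the enlarged cycles the
    parts from \<open>2\<close> on.\<close>
  also have "\<dots> = (\<Sum>i=1..Suc (card A). \<Sum>b\<in>int_partitions (Suc (card A) - i). type_weight b * F (add_mset i b))"
    by (simp add: sum.atLeast_Suc_atMost sum.atLeast_Suc_atMost_Suc_shift del: sum.cl_ivl_Suc)
  \<comment> \<open>Read backwards, the removed part becomes a marked part of the enlarged type; the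
    marks total \<open>Suc (card A)\<close>, the next factor of the factorial.\<close>
  also have "\<dots> = (\<Sum>a\<in>int_partitions (Suc (card A)). type_weight a * (\<Sum>i\<in>#a. of_nat i * F (add_mset i (a - {#i#}))))"
    by (rule sum_int_partitions_remove[symmetric])
  also have "\<dots> = (\<Sum>a\<in>int_partitions (Suc (card A)). of_nat (Suc (card A)) * (type_weight a * F a))"
  proof (rule sum.cong[OF refl])
    fix a assume a: "a \<in> int_partitions (Suc (card A))"
    have "(\<Sum>i\<in>#a. of_nat i * F (add_mset i (a - {#i#}))) = (\<Sum>i\<in>#a. of_nat i * F a)"
      by (intro arg_cong[of _ _ sum_mset] image_mset_cong) simp
    also have "\<dots> = of_nat (\<Sum>\<^sub># a) * F a"
      by (simp add: sum_mset_distrib_right of_nat_sum_mset)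
    also have "\<Sum>\<^sub># a = Suc (card A)" using a by (simp add: int_partitions_iff)
    finally show "type_weight a * (\<Sum>i\<in>#a. of_nat i * F (add_mset i (a - {#i#}))) = of_nat (Suc (card A)) * (type_weight a * F a)"
      by (simp only: mult_ac)
  qed
  finally show ?case using insert.hyps by (simp add: sum_distrib_left mult_ac)
qed

section \<open>Permutations of given cycle type and genus\<close>

definition half_prod :: "nat multiset \<Rightarrow> 'a::field_char_0 fps" where
  "half_prod a = (\<Prod>i\<in>#a. half_plus ^ i - half_minus ^ i)"

text \<open>The alternating sum over sets \<open>C\<close> of cycles is the expansion of a product
  of differences: cycles in \<open>C\<close> contribute powers of \<open>half_minus\<close>, the
  others powers of \<open>half_plus\<close>.\<close>

lemma sum_cyclic_half_ratio:
  assumes A: "finite A" "card A = Suc N" and \<omega>: "\<omega> permutes A"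
  shows "(\<Sum>\<zeta> | \<zeta> permutes A \<and> num_orbits A \<zeta> = 1. of_nat m ^ num_orbits A (\<omega> \<circ> \<zeta>)) =
    fact N * ((half_ratio ^ m * half_prod (orbit_type A \<omega>)) $ (N + 2) :: 'b::field_char_0)"
proof -
  let ?n = "card A" and ?O = "orbit \<omega> ` A"
  note tot = sum_card_orbits[OF A(1) \<omega>]
  have "(\<Sum>S | S \<subseteq> A \<and> \<omega> ` S = S. (((of_nat m :: 'b) + of_nat (?n - card S)) gchoose (N + 2)) * (- 1) ^ num_orbits S \<omega>) =
     (\<Sum>C\<in>Pow ?O. ((of_nat m + of_nat (?n - sum card C)) gchoose (N + 2)) * (- 1) ^ card C)"
    by (rule sum_invariant_sets[OF A(1) \<omega>])
  also have "\<dots> = (\<Sum>C\<in>Pow ?O. (- 1) ^ card C * (half_ratio ^ m * (half_plus ^ (?n - sum card C) * half_minus ^ sum card C)) $ (N + 2))"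
  proof (rule sum.cong[OF refl])
    fix C assume "C \<in> Pow ?O"
    have "sum card C \<le> ?n"
      unfolding tot[symmetric] by (rule sum_mono2) (use A \<open>C \<in> Pow ?O\<close> in auto)
    then have "(half_ratio ^ m * (half_plus ^ (?n - sum card C) * half_minus ^ sum card C) :: 'b fps) =
       half_ratio ^ (m + (?n - sum card C)) * half_minus ^ ?n"
      by (simp only: half_ratio_half_minus_power[symmetric] power_add mult.assoc)
    then show "((of_nat m + of_nat (?n - sum card C)) gchoose (N + 2)) * (- 1) ^ card C =
       (- 1) ^ card C * (half_ratio ^ m * (half_plus ^ (?n - sum card C) * half_minus ^ sum card C) :: 'b fps) $ (N + 2)"
      using half_ratio_power_nth[of "m + (?n - sum card C)" ?n, where 'a='b]
        binomial_gbinomial[of "m + (?n - sum card C)" "N + 2", where 'a='b] A(2) by simp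
  qed
  also have "\<dots> = (half_ratio ^ m * (\<Sum>C\<in>Pow ?O. (- 1) ^ card C * (half_plus ^ (?n - sum card C) * half_minus ^ sum card C))) $ (N + 2)"
    unfolding sum_distrib_left fps_sum_nth
  proof (rule sum.cong[OF refl])
    fix C
    show "(- 1) ^ card C * (half_ratio ^ m * (half_plus ^ (?n - sum card C) * half_minus ^ sum card C) :: 'b fps) $ (N + 2) =
      (half_ratio ^ m * ((- 1) ^ card C * (half_plus ^ (?n - sum card C) * half_minus ^ sum card C))) $ (N + 2)"
      by (cases "even (card C)") simp_all
  qed
  also have "(\<Sum>C\<in>Pow ?O. (- 1) ^ card C * (half_plus ^ (?n - sum card C) * half_minus ^ sum card C)) =
     (\<Prod>B\<in>?O. half_plus ^ card B - half_minus ^ card B :: 'b fps)"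
  proof -
    have *: "(half_plus :: 'b fps) ^ (?n - sum card C) = (\<Prod>B\<in>?O - C. half_plus ^ card B)"
      "(half_minus :: 'b fps) ^ sum card C = (\<Prod>B\<in>C. half_minus ^ card B)" if "C \<in> Pow ?O" for C
    proof -
      have "finite C" using that A finite_subset by blast
      then have "sum card (?O - C) = ?n - sum card C" using that by (simp add: sum_diff_nat tot)
      then show "(half_plus :: 'b fps) ^ (?n - sum card C) = (\<Prod>B\<in>?O - C. half_plus ^ card B)"
        by (simp only: power_sum[symmetric])
      show "(half_minus :: 'b fps) ^ sum card C = (\<Prod>B\<in>C. half_minus ^ card B)"
        by (simp only: power_sum[symmetric])
    qed
    show ?thesis
      unfolding prod_diff_conv_sum[OF finite_imageI[OF A(1)]]
      by (intro sum.cong refl) (simp only: * mult_ac)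
  qed
  also have "\<dots> = half_prod (orbit_type A \<omega>)"
    by (simp add: half_prod_def orbit_type_def prod_unfold_prod_mset image_mset.compositionality o_def)
  finally show ?thesis unfolding sum_cyclic_power_num_orbits[OF A \<omega>] by simp
qed

text \<open>The enumeration at \<open>x = 1\<close> and \<open>\<omega> = id\<close>. All sets are
  invariant, but the binomial coefficient vanishes for every nonempty one.\<close>

lemma card_cyclic_permutations:
  fixes A :: "'a set"
  assumes A: "finite A" "card A = Suc N"
  shows "card {\<zeta>. \<zeta> permutes A \<and> num_orbits A \<zeta> = 1} = fact N"
proof -
  have "(of_nat (card {\<zeta>. \<zeta> permutes A \<and> num_orbits A \<zeta> = 1}) :: rat) =
     fact N * (\<Sum>S | S \<subseteq> A \<and> id ` S = S. ((1 + of_nat (card A - card S)) gchoose (N + 2)) * (- 1) ^ num_orbits S id)"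
    using sum_cyclic_power_num_orbits[OF A permutes_id, of "1 :: rat"] by simp
  also have "(\<Sum>S | S \<subseteq> A \<and> id ` S = S. (((1 :: rat) + of_nat (card A - card S)) gchoose (N + 2)) * (- 1) ^ num_orbits S id) =
     (\<Sum>S\<in>{{} :: 'a set}. ((1 + of_nat (card A - card S)) gchoose (N + 2)) * (- 1) ^ num_orbits S id)"
  proof (rule sum.mono_neutral_right)
    show "finite {S. S \<subseteq> A \<and> id ` S = S}" using A by simp
    show "\<forall>S\<in>{S. S \<subseteq> A \<and> id ` S = S} - {{}}.
      (((1 :: rat) + of_nat (card A - card S)) gchoose (N + 2)) * (- 1) ^ num_orbits S id = 0"
    proof
      fix S assume S: "S \<in> {S. S \<subseteq> A \<and> id ` S = S} - {{}}"
      then have "card S > 0" using A finite_subset by (auto simp: card_gt_0_iff)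
      then have "(Suc (card A - card S) choose (N + 2)) = 0" using A by (simp add: binomial_eq_0)
      then have "(((1 :: rat) + of_nat (card A - card S)) gchoose (N + 2)) = 0"
        by (metis binomial_gbinomial of_nat_0 of_nat_Suc)
      then show "(((1 :: rat) + of_nat (card A - card S)) gchoose (N + 2)) * (- 1) ^ num_orbits S id = 0" by simp
    qed
  qed auto
  also have "\<dots> = 1"
    using binomial_gbinomial[of "N + 2" "N + 2", where 'a=rat] A(2) by (simp add: num_orbits_def add_ac)
  finally have "(of_nat (card {\<zeta>. \<zeta> permutes A \<and> num_orbits A \<zeta> = 1}) :: rat) = of_nat (fact N)" by simp
  then show ?thesis by (simp only: of_nat_eq_iff)
qed

section \<open>Cyclic permutations as one conjugacy class\<close>

lemma cyclic_enumeration: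
  assumes A: "finite A" and p: "p permutes A" "num_orbits A p = 1" and a: "a \<in> A"
  shows "bij_betw (\<lambda>i. (p ^^ i) a) {0..<card A} A" "(p ^^ card A) a = a"
proof -
  have P: "permutation p" using p A by (auto intro: permutes_imp_permutation)
  have self: "a \<in> orbit p a" by (rule permutation_self_in_orbit[OF P])
  obtain B where B: "orbit p ` A = {B}" using p by (auto simp: num_orbits_def card_1_singleton_iff)
  have orb: "orbit p a = A"
  proof
    show "orbit p a \<subseteq> A" using p(1) a by (rule permutes_orbit_subset)
    show "A \<subseteq> orbit p a"
    proof
      fix x assume "x \<in> A"
      then have "orbit p x = orbit p a" using B a by blast
      then show "x \<in> orbit p a" using permutation_self_in_orbit[OF P, of x] by simp
    qed
  qed
  define d where "d = funpow_dist1 p a a"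
  have inj: "inj_on (\<lambda>n. (p ^^ n) a) {0..<d}" unfolding d_def by (rule inj_on_funpow_dist1[OF self])
  have im: "(\<lambda>n. (p ^^ n) a) ` {0..<d} = A" using orbit_conv_funpow_dist1[OF self] orb by (simp add: d_def)
  have "card A = d" using card_image[OF inj] im by simp
  then show "bij_betw (\<lambda>i. (p ^^ i) a) {0..<card A} A" "(p ^^ card A) a = a"
    using inj im funpow_dist1_prop[OF self] by (auto simp: bij_betw_def d_def)
qed

lemma cyclic_permutations_conjugate:
  assumes A: "finite A" and p: "p permutes A" "num_orbits A p = 1" and q: "q permutes A" "num_orbits A q = 1"
  obtains h where "h permutes A" "p = h \<circ> q \<circ> inv h"
proof -
  have "A \<noteq> {}" using p by (auto simp: num_orbits_def)
  then obtain a where a: "a \<in> A" by blast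
  define f where "f i = (q ^^ i) a" for i
  define g where "g i = (p ^^ i) a" for i
  let ?I = "{0..<card A}"
  have f: "bij_betw f ?I A" "f (card A) = a" and g: "bij_betw g ?I A" "g (card A) = a"
    using cyclic_enumeration[OF A q a] cyclic_enumeration[OF A p a] by (simp_all add: f_def[abs_def] g_def[abs_def])
  define h where "h x = (if x \<in> A then g (the_inv_into ?I f x) else x)" for x
  have "bij_betw (g \<circ> the_inv_into ?I f) A A"
    by (rule bij_betw_trans[OF bij_betw_the_inv_into[OF f(1)] g(1)])
  then have "bij_betw h A A" by (rule bij_betw_cong[THEN iffD1, rotated]) (simp add: h_def)
  then have h: "h permutes A" by (rule bij_imp_permutes) (simp add: h_def)
  have fA: "f i \<in> A" if "i \<in> ?I" for i using f(1) that by (auto simp: bij_betw_def)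
  have hf: "h (f i) = g i" if "i \<in> ?I" for i
    using that f(1) fA by (simp add: h_def bij_betw_def the_inv_into_f_f)
  have "0 \<in> ?I" using a A card_gt_0_iff by fastforce
  then have "h (f (card A)) = g (card A)" using hf[of 0] f(2) g(2) by (simp add: f_def g_def)
  \<comment> \<open>The index \<open>card A\<close>, where both enumerations return to
    \<open>a\<close>, is needed for the successor of the last point.\<close>
  then have hf': "h (f i) = g i" if "i \<le> card A" for i
    using that hf by (cases "i = card A") auto
  have "h (q x) = p (h x)" for x
  proof (cases "x \<in> A")
    case True
    then obtain i where i: "i \<in> ?I" "x = f i" using f(1) unfolding bij_betw_def by (metis imageE)
    have "h (q x) = h (f (Suc i))" using i by (simp add: f_def)
    also have "\<dots> = g (Suc i)" using i by (intro hf') simp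
    also have "\<dots> = p (h x)" using i hf' by (simp add: g_def)
    finally show ?thesis .
  next
    case False
    then show ?thesis using p q h by (simp add: permutes_not_in)
  qed
  then have "h \<circ> q = p \<circ> h" by auto
  then have "h \<circ> q \<circ> inv h = p \<circ> (h \<circ> inv h)" by (simp add: o_assoc)
  then have "p = h \<circ> q \<circ> inv h" using permutes_inv_o(1)[OF h] by simp
  with h show ?thesis by (rule that)
qed

lemma zeta_cyclic:
  assumes "n \<ge> 1"
  shows "zeta n permutes {1..n}" "num_orbits {1..n} (zeta n) = 1"
proof -
  have im: "zeta n ` {1..n} = {1..n}"
  proof
    show "zeta n ` {1..n} \<subseteq> {1..n}" by (auto simp: zeta_def Suc_le_eq)
    show "{1..n} \<subseteq> zeta n ` {1..n}"
    proof
      fix i assume i: "i \<in> {1..n}"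
      show "i \<in> zeta n ` {1..n}"
      proof (cases "i = 1")
        case True
        then have "i = zeta n n" using assms by (simp add: zeta_def)
        then show ?thesis using assms by auto
      next
        case False
        then have "i = zeta n (i - 1)" using i by (auto simp: zeta_def)
        moreover have "i - 1 \<in> {1..n}" using i False by auto
        ultimately show ?thesis by blast
      qed
    qed
  qed
  then have "inj_on (zeta n) {1..n}" by (simp add: eq_card_imp_inj_on)
  with im have "bij_betw (zeta n) {1..n} {1..n}" by (simp add: bij_betw_def)
  then show perm: "zeta n permutes {1..n}" by (rule bij_imp_permutes) (auto simp: zeta_def)
  have P: "permutation (zeta n)" using perm by (auto intro: permutes_imp_permutation)
  \<comment> \<open>Starting at \<open>n\<close> makes the \<open>i\<close>-th iterate equal to
    \<open>i\<close>.\<close>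
  have pow: "(zeta n ^^ i) n = i" if "1 \<le> i" "i \<le> n" for i
    using that by (induction i rule: dec_induct) (auto simp: zeta_def)
  have "orbit (zeta n) i = orbit (zeta n) n" if "i \<in> {1..n}" for i
  proof (rule orbit_eq_permutation[OF P])
    show "i \<in> orbit (zeta n) n" using pow[of i] that by (auto simp: orbit_altdef intro!: exI[of _ i])
  qed
  then have "orbit (zeta n) ` {1..n} = (\<lambda>_. orbit (zeta n) n) ` {1..n}" by (intro image_cong refl)
  then have "orbit (zeta n) ` {1..n} = {orbit (zeta n) n}" using assms by (simp only: image_constant_conv) simp
  then show "num_orbits {1..n} (zeta n) = 1" by (simp add: num_orbits_def)
qed

lemma orbit_type_conjugate:
  assumes "h permutes A"
  shows "orbit_type A (h \<circ> p \<circ> inv h) = orbit_type A p"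
proof -
  have inj: "inj h" using assms by (rule permutes_inj)
  have "inj_on ((`) h) (orbit p ` A)" by (metis inj inj_on_def inj_image_eq_iff)
  then show ?thesis
    unfolding orbit_type_def orbits_conjugate[OF assms]
    by (simp add: image_mset_mset_set[symmetric] image_mset.compositionality o_def card_image inj_on_subset[OF inj subset_UNIV])
qed

lemma sum_type_conjugate:
  assumes h: "h permutes A"
  shows "(\<Sum>\<sigma> | \<sigma> permutes A \<and> orbit_type A \<sigma> = a. f (num_orbits A (inv \<sigma> \<circ> (h \<circ> \<zeta> \<circ> inv h)))) =
    (\<Sum>\<sigma> | \<sigma> permutes A \<and> orbit_type A \<sigma> = a. f (num_orbits A (inv \<sigma> \<circ> \<zeta>)))"
proof (rule sym, rule sum.reindex_bij_witness[of _ "\<lambda>\<sigma>. inv h \<circ> \<sigma> \<circ> h" "\<lambda>\<sigma>. h \<circ> \<sigma> \<circ> inv h"], goal_cases)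
  note ih = permutes_inv[OF h] and ii = permutes_inv_inv[OF h] and io = permutes_inv_o[OF h]
  have c1: "inv h \<circ> (h \<circ> \<sigma> \<circ> inv h) \<circ> h = \<sigma>" for \<sigma>
    by (rule ext) (simp add: permutes_inverses[OF h])
  have c2: "h \<circ> (inv h \<circ> \<sigma> \<circ> h) \<circ> inv h = \<sigma>" for \<sigma>
    by (rule ext) (simp add: permutes_inverses[OF h])
  {
    case (1 \<sigma>)
    then show ?case by (rule_tac c1)
  next
    case (2 \<sigma>)
    then show ?case using h ih by (auto simp: orbit_type_conjugate intro!: permutes_compose)
  next
    case (3 \<sigma>)
    then show ?case by (rule_tac c2)
  next
    case (4 \<sigma>)
    then show ?case using h ih orbit_type_conjugate[OF ih, of \<sigma>] ii by (auto intro!: permutes_compose)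
  next
    case (5 \<sigma>)
    then have b: "bij h" "bij \<sigma>" "bij (inv h)" using h ih permutes_bij by auto
    have "inv (h \<circ> \<sigma> \<circ> inv h) = h \<circ> inv \<sigma> \<circ> inv h"
      using b ii by (simp add: o_inv_distrib bij_comp o_assoc)
    then have "inv (h \<circ> \<sigma> \<circ> inv h) \<circ> (h \<circ> \<zeta> \<circ> inv h) = h \<circ> (inv \<sigma> \<circ> \<zeta>) \<circ> inv h"
      by (auto simp: fun_eq_iff permutes_inverses[OF h])
    then show ?case by (simp add: num_orbits_conjugate[OF h])
  }
qed

lemma card_orbit_type:
  assumes "finite A"
  shows "of_nat (card {\<sigma>. \<sigma> permutes A \<and> orbit_type A \<sigma> = a}) =
    (if a \<in> int_partitions (card A) then fact (card A) * type_weight a else 0 :: 'b::field_char_0)"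
proof -
  have "(of_nat (card {\<sigma>. \<sigma> permutes A \<and> orbit_type A \<sigma> = a}) :: 'b) = (\<Sum>p | p permutes A. if orbit_type A p = a then 1 else 0)"
    using finite_permutations[OF assms] by (simp add: sum.If_cases Int_def)
  also have "\<dots> = fact (card A) * (\<Sum>b\<in>int_partitions (card A). type_weight b * (if b = a then 1 else 0))"
    by (rule sum_permutes_orbit_type[OF assms])
  also have "(\<Sum>b\<in>int_partitions (card A). type_weight b * (if b = a then 1 else 0)) =
      (if a \<in> int_partitions (card A) then type_weight a else 0 :: 'b)"
    by (simp add: finite_int_partitions if_distrib[of "(*) _"] cong: if_cong)
  finally show ?thesis by simp
qed

text \<open>A double count over \<open>\<sigma>\<close> of type \<open>a\<close> and cyclic
  \<open>\<zeta>\<close>. By conjugation the sum over \<open>\<sigma>\<close> is the same for every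
  \<open>\<zeta>\<close>, so the double sum is \<open>fact N\<close> times the left-hand side; for
  fixed \<open>\<sigma>\<close> the sum over \<open>\<zeta>\<close> is known.\<close>

lemma sum_type_half_ratio:
  fixes m :: nat
  assumes n: "n \<ge> 1" and a: "a \<in> int_partitions n"
  shows "(\<Sum>\<sigma> | \<sigma> permutes {1..n} \<and> orbit_type {1..n} \<sigma> = a. of_nat m ^ num_orbits {1..n} (inv \<sigma> \<circ> zeta n)) =
    fact n * type_weight a * ((half_ratio ^ m * half_prod a) $ (n + 1) :: 'b::field_char_0)"
proof -
  let ?A = "{1..n}"
  let ?T = "{\<sigma>. \<sigma> permutes ?A \<and> orbit_type ?A \<sigma> = a}"
  let ?Z = "{\<zeta>. \<zeta> permutes ?A \<and> num_orbits ?A \<zeta> = 1}"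
  let ?f = "\<lambda>\<zeta>. \<Sum>\<sigma>\<in>?T. of_nat m ^ num_orbits ?A (inv \<sigma> \<circ> \<zeta>) :: 'b"
  obtain N where N: "n = Suc N" using n by (cases n) auto
  have A: "finite ?A" "card ?A = Suc N" by (simp_all add: N)
  have c: "?f \<zeta> = ?f (zeta n)" if "\<zeta> \<in> ?Z" for \<zeta>
  proof -
    from that obtain h where h: "h permutes ?A" "\<zeta> = h \<circ> zeta n \<circ> inv h"
      using cyclic_permutations_conjugate[of ?A \<zeta> "zeta n"] zeta_cyclic[OF n] by auto
    show ?thesis unfolding h(2) by (rule sum_type_conjugate[OF h(1)])
  qed
  have "fact N * ?f (zeta n) = sum ?f ?Z"
    using c card_cyclic_permutations[OF A] by simp
  also have "\<dots> = (\<Sum>\<sigma>\<in>?T. \<Sum>\<zeta>\<in>?Z. of_nat m ^ num_orbits ?A (inv \<sigma> \<circ> \<zeta>))"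
    by (rule sum.swap)
  also have "\<dots> = (\<Sum>\<sigma>\<in>?T. fact N * (half_ratio ^ m * half_prod a) $ (N + 2))"
  proof (rule sum.cong[OF refl])
    fix \<sigma> assume \<sigma>: "\<sigma> \<in> ?T"
    \<comment> \<open>The enumeration is applied to \<open>inv \<sigma>\<close>, whose cycles are,
      as sets, those of \<open>\<sigma>\<close>.\<close>
    then have "orbit_type ?A (inv \<sigma>) = a"
      by (simp add: orbit_type_def orbit_inv_eq permutes_imp_permutation[of ?A \<sigma>])
    then show "(\<Sum>\<zeta>\<in>?Z. of_nat m ^ num_orbits ?A (inv \<sigma> \<circ> \<zeta>)) = fact N * (half_ratio ^ m * half_prod a :: 'b fps) $ (N + 2)"
      using sum_cyclic_half_ratio[OF A permutes_inv[of \<sigma> ?A], of m] \<sigma> by simp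
  qed
  also have "\<dots> = fact N * (fact n * type_weight a * (half_ratio ^ m * half_prod a) $ (N + 2))"
    using card_orbit_type[of ?A a, where 'b='b] a by simp
  finally show ?thesis unfolding mult_cancel_left by (simp add: N)
qed

lemma sum_powers_of_nat_eq_iff:
  fixes c d :: "nat \<Rightarrow> 'b::field_char_0"
  assumes "\<And>m. (\<Sum>j\<le>K. c j * of_nat m ^ j) = (\<Sum>j\<le>K. d j * of_nat m ^ j)" and "j \<le> K"
  shows "c j = d j"
proof -
  define p where "p = (\<Sum>j\<le>K. Polynomial.monom (c j - d j) j)"
  have "poly p (of_nat m) = 0" for m
    using assms(1)[of m] by (simp add: p_def poly_sum poly_monom algebra_simps sum_subtractf)
  then have "range of_nat \<subseteq> {x. poly p x = 0}" by auto
  moreover have "infinite (range (of_nat :: nat \<Rightarrow> 'b))"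
    by (simp add: inj_of_nat range_inj_infinite)
  ultimately have "p = 0" using poly_roots_finite finite_subset by blast
  then have "0 = Polynomial.coeff p j" by simp
  also have "\<dots> = c j - d j" using assms(2) by (simp add: p_def coeff_sum)
  finally show ?thesis by simp
qed

text \<open>Both sides of the preceding enumeration are polynomials in \<open>m\<close>. The
  coefficient of \<open>m ^ j\<close> counts the \<open>\<sigma>\<close> for which
  \<open>inv \<sigma> \<circ> zeta n\<close> has \<open>j\<close> cycles, and the relation between
  \<open>j\<close>, \<open>size a\<close>, \<open>g\<close> and \<open>n\<close> says that these
  have genus \<open>g\<close>.\<close>

lemma D_count_eq:
  assumes n: "n \<ge> 1" and a: "a \<in> int_partitions n" and j: "j + size a + 2 * g = n + 1"
  shows "of_nat (D_count g n a) = fact n * type_weight a * ((half_log ^ j * half_prod a) $ (n + 1) / fact j :: 'b::field_char_0)"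
proof -
  let ?A = "{1..n}"
  let ?T = "{\<sigma>. \<sigma> permutes ?A \<and> orbit_type ?A \<sigma> = a}"
  let ?l = "\<lambda>\<sigma>. num_orbits ?A (inv \<sigma> \<circ> zeta n)"
  have fT: "finite ?T" by (rule finite_subset[OF _ finite_permutations[of ?A]]) auto
  \<comment> \<open>The bound \<open>n + 1\<close> matches the range of the powers of
    \<open>m\<close> in \<open>half_ratio_power_mult_nth\<close>.\<close>
  have le: "?l \<sigma> \<le> n + 1" for \<sigma>
    using card_image_le[of ?A "orbit (inv \<sigma> \<circ> zeta n)"] by (simp add: num_orbits_def)
  have "(\<Sum>j\<le>n + 1. of_nat (card {\<sigma> \<in> ?T. ?l \<sigma> = j}) * of_nat m ^ j) =
     (\<Sum>j\<le>n + 1. fact n * type_weight a * ((half_log ^ j * half_prod a) $ (n + 1) / fact j) * of_nat m ^ j :: 'b)" for m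
  proof -
    have "(\<Sum>j\<le>n + 1. of_nat (card {\<sigma> \<in> ?T. ?l \<sigma> = j}) * of_nat m ^ j) = (\<Sum>j\<le>n + 1. \<Sum>\<sigma>\<in>{\<sigma> \<in> ?T. ?l \<sigma> = j}. of_nat m ^ ?l \<sigma> :: 'b)"
      by (rule sum.cong[OF refl]) simp
    also have "\<dots> = (\<Sum>\<sigma>\<in>?T. of_nat m ^ ?l \<sigma>)"
      by (rule sum.group) (use fT le in auto)
    finally show ?thesis
      unfolding sum_type_half_ratio[OF n a] half_ratio_power_mult_nth
      by (simp add: sum_distrib_left mult_ac del: sum.atMost_Suc)
  qed
  from sum_powers_of_nat_eq_iff[OF this, of j]
  have "of_nat (card {\<sigma> \<in> ?T. ?l \<sigma> = j}) = fact n * type_weight a * ((half_log ^ j * half_prod a) $ (n + 1) / fact j :: 'b)"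
    using j by simp
  moreover have "{\<sigma>. \<sigma> permutes {1..n} \<and> genus n \<sigma> = of_nat g \<and> cycle_type n \<sigma> = a} = {\<sigma> \<in> ?T. ?l \<sigma> = j}"
  proof -
    have "genus n \<sigma> = of_nat g \<longleftrightarrow> ?l \<sigma> = j" if "orbit_type ?A \<sigma> = a" for \<sigma>
    proof -
      have "num_cycles n \<sigma> = size a" using that by (auto simp: orbit_type_def num_cycles_def cycles_def)
      moreover have "num_cycles n (inv \<sigma> \<circ> zeta n) = ?l \<sigma>" by (simp add: num_cycles_def num_orbits_def cycles_def)
      moreover have "(of_nat (j + size a + 2 * g) :: rat) = of_nat (n + 1)" using j by (simp only:)
      then have "(of_nat j :: rat) = of_nat n + 1 - of_nat (size a) - 2 * of_nat g" by (simp add: algebra_simps)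
      ultimately have "genus n \<sigma> = of_nat g \<longleftrightarrow> (of_nat (?l \<sigma>) :: rat) = of_nat j"
        unfolding genus_def by (simp only:) (auto simp: field_simps)
      then show ?thesis by (simp only: of_nat_eq_iff)
    qed
    then show ?thesis by (auto simp: cycle_type_def orbit_type_def cycles_def)
  qed
  ultimately show ?thesis by (simp add: D_count_def)
qed

lemma D_count_eq_0:
  assumes "size a + 2 * g > n + 1"
  shows "D_count g n a = 0"
proof -
  have False if "genus n \<sigma> = of_nat g" "cycle_type n \<sigma> = a" for \<sigma>
  proof -
    have "num_cycles n \<sigma> = size a" using that by (auto simp: cycle_type_def num_cycles_def)
    then have "(of_nat (size a + 2 * g) + of_nat (num_cycles n (inv \<sigma> \<circ> zeta n)) :: rat) = of_nat (n + 1)"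
      using that by (simp add: genus_def field_simps)
    then have "size a + 2 * g + num_cycles n (inv \<sigma> \<circ> zeta n) = n + 1"
      by (simp only: of_nat_add[symmetric] of_nat_eq_iff)
    with assms show False by simp
  qed
  then have "{\<sigma>. \<sigma> permutes {1..n} \<and> genus n \<sigma> = of_nat g \<and> cycle_type n \<sigma> = a} = {}" by blast
  then show ?thesis unfolding D_count_def by (simp only: card.empty)
qed

section \<open>Weighted counts as residues\<close>

lemma card_permutations_of_multiset_sym_factor:
  "card (permutations_of_multiset b) * sym_factor b = fact (size b)"
  using card_permutations_of_multiset[of b] by (simp add: sym_factor_def)

section \<open>Coefficients of powers as sums over partitions\<close>

lemma fps_power_nth_multiset:
  fixes C :: "'b::comm_ring_1 fps"
  shows "(C ^ r) $ g = (\<Sum>b | size b = r \<and> \<Sum>\<^sub># b = g. of_nat (card (permutations_of_multiset b)) * (\<Prod>i\<in>#b. C $ i))"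
proof -
  have "(C ^ r) $ g = (\<Sum>v\<in>natpermute g r. \<Prod>i\<in>#mset v. C $ i)"
  proof (cases r)
    case 0
    then show ?thesis by (simp add: natpermute_0)
  next
    case (Suc m)
    have "(\<Prod>j\<in>{0..m}. C $ (v ! j)) = (\<Prod>i\<in>#mset v. C $ i)" if "v \<in> natpermute g r" for v
    proof -
      have "length v = Suc m" using that Suc by (simp add: natpermute_def)
      moreover have "(\<Prod>i\<in>#mset v. C $ i) = prod_list (map (\<lambda>i. C $ i) v)"
        by (simp flip: prod_mset_prod_list)
      ultimately show ?thesis
        by (simp add: prod.list_conv_set_nth atLeastLessThanSuc_atLeastAtMost)
    qed
    then show ?thesis by (simp add: Suc fps_power_nth_Suc del: power_Suc cong: sum.cong)
  qed
  also have "\<dots> = (\<Sum>b\<in>mset ` natpermute g r. \<Sum>v | v \<in> natpermute g r \<and> mset v = b. \<Prod>i\<in>#mset v. C $ i)"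
    by (rule sum.image_gen[OF natpermute_finite])
  also have "mset ` natpermute g r = {b. size b = r \<and> \<Sum>\<^sub># b = g}"
  proof (intro equalityI subsetI)
    fix b assume b: "b \<in> {b. size b = r \<and> \<Sum>\<^sub># b = g}"
    obtain v where "b = mset v" using ex_mset by metis
    with b show "b \<in> mset ` natpermute g r" by (auto simp: natpermute_def sum_mset_sum_list)
  qed (auto simp: natpermute_def sum_mset_sum_list)
  also have "(\<Sum>b | size b = r \<and> \<Sum>\<^sub># b = g. \<Sum>v | v \<in> natpermute g r \<and> mset v = b. \<Prod>i\<in>#mset v. C $ i) =
     (\<Sum>b | size b = r \<and> \<Sum>\<^sub># b = g. of_nat (card (permutations_of_multiset b)) * (\<Prod>i\<in>#b. C $ i))"
  proof (rule sum.cong[OF refl])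
    fix b assume b: "b \<in> {b. size b = r \<and> \<Sum>\<^sub># b = g}"
    have "{v. v \<in> natpermute g r \<and> mset v = b} = permutations_of_multiset b"
      using b by (auto simp: natpermute_def permutations_of_multiset_def sum_mset_sum_list)
    moreover have "(\<Sum>v | v \<in> natpermute g r \<and> mset v = b. \<Prod>i\<in>#mset v. C $ i) = (\<Sum>v | v \<in> natpermute g r \<and> mset v = b. \<Prod>i\<in>#b. C $ i)"
      by (rule sum.cong) auto
    ultimately show "(\<Sum>v | v \<in> natpermute g r \<and> mset v = b. \<Prod>i\<in>#mset v. C $ i) =
      of_nat (card (permutations_of_multiset b)) * (\<Prod>i\<in>#b. C $ i)" by simp
  qed
  finally show ?thesis .
qed

text \<open>The zero parts are split off because they carry the powers of the constant coefficient:
  \<open>odd_log\<close> in the expansion by \<open>y\<close>, the series \<open>X\<close> itself in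
  the expansion by genus.\<close>

lemma sum_multisets_zero_parts:
  "(\<Sum>b | size b = r \<and> \<Sum>\<^sub># b = g. F b) =
    (\<Sum>a | a \<in> int_partitions g \<and> size a \<le> r. F (a + replicate_mset (r - size a) 0))"
proof (rule sum.reindex_bij_witness[of _ "\<lambda>a. a + replicate_mset (r - size a) 0" "filter_mset (\<lambda>x. x \<noteq> 0)"], goal_cases)
  have split: "filter_mset (\<lambda>x. x \<noteq> 0) b + replicate_mset (size b - size (filter_mset (\<lambda>x. x \<noteq> 0) b)) 0 = b"
    "size (filter_mset (\<lambda>x. x \<noteq> 0) b) \<le> size b" "\<Sum>\<^sub># (filter_mset (\<lambda>x. x \<noteq> 0) b) = \<Sum>\<^sub># b" for b :: "nat multiset"
  proof -
    have 1: "b = filter_mset (\<lambda>x. x \<noteq> 0) b + replicate_mset (count b 0) 0"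
      by (rule multiset_eqI) auto
    show "size (filter_mset (\<lambda>x. x \<noteq> 0) b) \<le> size b" by (rule size_filter_mset_lesseq)
    have "size b = size (filter_mset (\<lambda>x. x \<noteq> 0) b) + count b 0"
      by (metis 1 size_replicate_mset size_union)
    then show "filter_mset (\<lambda>x. x \<noteq> 0) b + replicate_mset (size b - size (filter_mset (\<lambda>x. x \<noteq> 0) b)) 0 = b"
      using 1 by simp
    show "\<Sum>\<^sub># (filter_mset (\<lambda>x. x \<noteq> 0) b) = \<Sum>\<^sub># b" by (induction b) auto
  qed
  {
    case (1 b)
    then show ?case using split(1)[of b] by simp
  next
    case (2 b)
    then show ?case using split(2,3)[of b] by (simp add: int_partitions_iff)
  next
    case (3 a)
    then have "filter_mset (\<lambda>x. x \<noteq> 0) a = a"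
      by (intro iffD2[OF filter_mset_eq_conv]) (auto simp: int_partitions_iff intro: gr0I)
    then show ?case by simp
  next
    case (4 a)
    then show ?case by (auto simp: int_partitions_iff)
  next
    case (5 b)
    then show ?case using split(1)[of b] by simp
  }
qed

lemma sym_factor_replicate_0:
  assumes "0 \<notin># a"
  shows "sym_factor (a + replicate_mset k 0) = sym_factor a * fact k"
proof (induction k)
  case (Suc k)
  have "count a 0 = 0" using assms by (simp add: not_in_iff)
  then show ?case using Suc by (simp add: sym_factor_add algebra_simps)
qed simp

lemma card_permutations_zero_parts:
  assumes "a \<in> int_partitions g" "size a \<le> r"
  shows "of_nat (card (permutations_of_multiset (a + replicate_mset (r - size a) 0))) =
    (fact r / (of_nat (sym_factor a) * fact (r - size a)) :: 'b::field_char_0)"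
proof -
  let ?b = "a + replicate_mset (r - size a) 0"
  have "card (permutations_of_multiset ?b) * (sym_factor a * fact (r - size a)) = fact r"
    using card_permutations_of_multiset_sym_factor[of ?b] assms
    by (simp add: sym_factor_replicate_0 int_partitions_iff)
  then have "of_nat (card (permutations_of_multiset ?b)) * (of_nat (sym_factor a) * fact (r - size a)) = (fact r :: 'b)"
    by (metis of_nat_mult of_nat_fact)
  then show ?thesis using sym_factor_pos[of a] by (simp add: field_simps)
qed

text \<open>Exchanges the two variables, so that the same power can be expanded over partitions of
  \<open>n\<close> or over partitions of \<open>g\<close>.\<close>

definition fps_flip :: "'b::zero fps fps \<Rightarrow> 'b fps fps" where
  "fps_flip F = Abs_fps (\<lambda>i. Abs_fps (\<lambda>k. F $ k $ i))"

lemma fps_flip_nth [simp]: "fps_flip F $ i $ k = F $ k $ i"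
  by (simp add: fps_flip_def)

lemma fps_flip_mult: "fps_flip (F * G) = fps_flip F * (fps_flip G :: 'b::comm_ring_1 fps fps)"
proof (intro fps_ext)
  fix i k
  show "fps_flip (F * G) $ i $ k = (fps_flip F * fps_flip G) $ i $ k"
    by (simp add: fps_mult_nth fps_sum_nth) (rule sum.swap)
qed

lemma fps_flip_power: "fps_flip (F ^ r) = (fps_flip F :: 'b::comm_ring_1 fps fps) ^ r"
proof (induction r)
  case 0
  show ?case by (intro fps_ext) simp
qed (simp add: fps_flip_mult)

text \<open>
  The coefficient of \<open>y\<^sup>i\<close> in \<open>y\<^sup>2\<^sup>k\<^sup>+\<^sup>1 X_coeff \<kappa> k\<close>.  Multiplication by \<open>y\<^sup>2\<^sup>k\<^sup>+\<^sup>1\<close> amounts to the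
  substitution \<open>u = y v\<close> in the exponent.  Read as a series in \<open>v\<close> for fixed \<open>i\<close> it is
  \<open>ln ((1 + v/2) / (1 - v/2))\<close> for \<open>i = 0\<close> and
  \<open>\<kappa> i / i * ((1 + v/2)\<^sup>i - (1 - v/2)\<^sup>i)\<close> for \<open>i > 0\<close>, after removal of the odd factor \<open>v\<close>.
\<close>

definition X_entry :: "(nat \<Rightarrow> 'a::field_char_0) \<Rightarrow> nat \<Rightarrow> nat \<Rightarrow> 'a" where
  "X_entry \<kappa> k i = (if i = 0 then 1 / (2 ^ (2 * k) * of_nat (2 * k + 1))
     else \<kappa> i / of_nat i * (of_nat (i choose (2 * k + 1)) / 2 ^ (2 * k)))"

text \<open>Here and in \<open>odd_binomial\<close> the odd series \<open>half_log\<close> and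
  \<open>half_plus ^ i - half_minus ^ i\<close> are divided by \<open>v\<close> and written in the
  variable \<open>v^2\<close>, whose exponent is the genus.\<close>

definition odd_log :: "'a::field_char_0 fps" where
  "odd_log = Abs_fps (\<lambda>k. 1 / (2 ^ (2 * k) * of_nat (2 * k + 1)))"

definition odd_binomial :: "nat \<Rightarrow> 'a::field_char_0 fps" where
  "odd_binomial i = Abs_fps (\<lambda>k. of_nat (i choose (2 * k + 1)) / 2 ^ (2 * k))"

lemma fps_X_mult_compose_X_square_eqI:
  fixes F G :: "'a::comm_ring_1 fps"
  assumes "\<And>k. F $ (2 * k) = 0" "\<And>k. F $ (2 * k + 1) = G $ k"
  shows "F = fps_X * (G oo fps_X ^ 2)"
proof (rule fps_ext)
  fix m
  consider "m = 0" | k where "m = 2 * k + 1" | k where "m = 2 * Suc k"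
    by (metis evenE oddE not0_implies_Suc mult_0_right)
  then show "F $ m = (fps_X * (G oo fps_X ^ 2)) $ m"
  proof cases
    case 1
    then show ?thesis using assms(1)[of 0] by simp
  next
    case (2 k)
    then show ?thesis using assms(2)[of k] by (simp add: fps_nth_compose_X_power)
  next
    case (3 k)
    then show ?thesis using assms(1)[of "Suc k"] by (simp add: fps_nth_compose_X_power)
  qed
qed

lemma half_log_odd: "half_log = fps_X * (odd_log oo fps_X ^ 2)"
  by (rule fps_X_mult_compose_X_square_eqI)
    (simp_all add: half_log_def odd_log_def del: of_nat_Suc of_nat_add of_nat_mult)

lemma linear_power_nth: "((1 + fps_const c * fps_X) ^ i) $ k = of_nat (i choose k) * (c :: 'a::field_char_0) ^ k"
proof -
  have "((1 + fps_const c * fps_X) ^ i :: 'a fps) = (\<Sum>k\<le>i. of_nat (i choose k) * (fps_const c * fps_X) ^ k)"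
    unfolding add.commute[of 1] binomial_ring by simp
  also have "\<dots> = (\<Sum>k\<le>i. fps_const (of_nat (i choose k) * c ^ k) * fps_X ^ k)"
    by (simp add: power_mult_distrib fps_of_nat[symmetric] fps_const_power mult_ac flip: fps_const_mult)
  finally show ?thesis by (auto simp: fps_sum_nth binomial_eq_0 if_distrib[of "(*) _"] cong: if_cong)
qed

lemma half_diff_odd: "half_plus ^ i - half_minus ^ i = fps_X * (odd_binomial i oo fps_X ^ 2)"
proof (rule fps_X_mult_compose_X_square_eqI)
  have m: "half_minus = 1 + fps_const (- (1 / 2)) * (fps_X :: 'a fps)"
    by (simp add: half_minus_def)
  show "(half_plus ^ i - half_minus ^ i :: 'a fps) $ (2 * k) = 0" for k
    by (simp add: half_plus_def m linear_power_nth power_minus_even del: fps_const_neg)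
  show "(half_plus ^ i - half_minus ^ i :: 'a fps) $ (2 * k + 1) = odd_binomial i $ k" for k
    by (simp add: half_plus_def m linear_power_nth odd_binomial_def power_divide del: fps_const_neg)
qed

text \<open>Each of the \<open>j + size a\<close> odd factors gives up one \<open>v\<close>; the
  rest is a series in \<open>v^2\<close>.\<close>

lemma half_log_half_prod_nth:
  "(half_log ^ j * half_prod a) $ (j + size a + 2 * g) =
    (odd_log ^ j * (\<Prod>i\<in>#a. odd_binomial i) :: 'a::field_char_0 fps) $ g"
proof -
  have X2: "(fps_X ^ 2 :: 'a fps) $ 0 = 0" by simp
  have "half_prod a = fps_X ^ size a * ((\<Prod>i\<in>#a. odd_binomial i) oo (fps_X ^ 2 :: 'a fps))"
  proof (induction a)
    case (add i a)
    then show ?case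
      by (simp add: half_prod_def half_diff_odd fps_compose_mult_distrib[OF X2] mult_ac del: fps_X_power_nth)
  qed (simp add: half_prod_def)
  moreover have "half_log ^ j = fps_X ^ j * ((odd_log ^ j) oo (fps_X ^ 2 :: 'a fps))"
    by (simp add: half_log_odd power_mult_distrib fps_compose_power[OF X2])
  ultimately have "half_log ^ j * half_prod a = fps_X ^ (j + size a) * ((odd_log ^ j * (\<Prod>i\<in>#a. odd_binomial i)) oo (fps_X ^ 2 :: 'a fps))"
    by (simp add: fps_compose_mult_distrib[OF X2] power_add mult_ac)
  then show ?thesis by (simp add: fps_X_power_mult_nth fps_nth_compose_X_power)
qed

text \<open>The exponent \<open>r\<close> is the total number of cycles of \<open>\<sigma>\<close>
  and \<open>inv \<sigma> \<circ> zeta n\<close>. In the power, an index \<open>i > 0\<close> stands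
  for an \<open>i\<close>-cycle of \<open>\<sigma>\<close> and an index \<open>0\<close> for a cycle
  of the other permutation; the factors \<open>1 / i\<close> and the multinomial coefficient produce
  \<open>type_weight\<close>.\<close>

lemma alpha_eq_power_nth:
  assumes n: "n \<ge> 1" and r: "r + 2 * g = n + 1"
  shows "alpha \<kappa> g n = fact n / fact r * (Abs_fps (\<lambda>i. Abs_fps (\<lambda>k. X_entry \<kappa> k i)) ^ r) $ n $ g"
proof -
  define \<Phi> where "\<Phi> = Abs_fps (\<lambda>i. Abs_fps (\<lambda>k. X_entry \<kappa> k i))"
  have \<Phi>0: "\<Phi> $ 0 = odd_log" by (rule fps_ext) (simp add: \<Phi>_def X_entry_def odd_log_def)
  have \<Phi>i: "\<Phi> $ i = fps_const (\<kappa> i / of_nat i) * odd_binomial i" if "i \<noteq> 0" for i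
    using that by (intro fps_ext) (simp add: \<Phi>_def X_entry_def odd_binomial_def)
  have P: "(\<Prod>i\<in>#a. \<Phi> $ i) = fps_const ((\<Prod>i\<in>#a. \<kappa> i) / of_nat (\<Prod>\<^sub># a)) * (\<Prod>i\<in>#a. odd_binomial i)" if "0 \<notin># a" for a
    using that by (induction a) (auto simp: \<Phi>i mult_ac simp flip: fps_const_mult)
  have "(\<Phi> ^ r) $ n = (\<Sum>a | a \<in> int_partitions n \<and> size a \<le> r.
      of_nat (card (permutations_of_multiset (a + replicate_mset (r - size a) 0))) *
      (\<Prod>i\<in>#a + replicate_mset (r - size a) 0. \<Phi> $ i))"
    unfolding fps_power_nth_multiset by (rule sum_multisets_zero_parts)
  also have "\<dots> = (\<Sum>a | a \<in> int_partitions n \<and> size a \<le> r.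
      fps_const (fact r * type_weight a * (\<Prod>i\<in>#a. \<kappa> i) / fact (r - size a)) *
      (odd_log ^ (r - size a) * (\<Prod>i\<in>#a. odd_binomial i)))"
  proof (rule sum.cong[OF refl])
    fix a assume "a \<in> {a. a \<in> int_partitions n \<and> size a \<le> r}"
    then have a: "a \<in> int_partitions n" "size a \<le> r" "0 \<notin># a" by (auto simp: int_partitions_iff)
    have "(of_nat (card (permutations_of_multiset (a + replicate_mset (r - size a) 0))) :: 'a fps) =
       fps_const (fact r / (of_nat (sym_factor a) * fact (r - size a)))"
      unfolding card_permutations_zero_parts[OF a(1,2), symmetric] fps_of_nat ..
    then show "of_nat (card (permutations_of_multiset (a + replicate_mset (r - size a) 0))) *
      (\<Prod>i\<in>#a + replicate_mset (r - size a) 0. \<Phi> $ i) =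
      fps_const (fact r * type_weight a * (\<Prod>i\<in>#a. \<kappa> i) / fact (r - size a)) *
      (odd_log ^ (r - size a) * (\<Prod>i\<in>#a. odd_binomial i))"
      by (simp add: P[OF a(3)] \<Phi>0 type_weight_def mult_ac image_replicate_mset prod_mset_replicate_mset)
  qed
  finally have "(\<Phi> ^ r) $ n $ g = (\<Sum>a | a \<in> int_partitions n \<and> size a \<le> r.
      fact r * type_weight a * (\<Prod>i\<in>#a. \<kappa> i) / fact (r - size a) *
      (odd_log ^ (r - size a) * (\<Prod>i\<in>#a. odd_binomial i)) $ g)"
    by (simp add: fps_sum_nth)
  then have "fact n / fact r * (\<Phi> ^ r) $ n $ g = (\<Sum>a | a \<in> int_partitions n \<and> size a \<le> r.
      fact n * type_weight a * ((odd_log ^ (r - size a) * (\<Prod>i\<in>#a. odd_binomial i)) $ g / fact (r - size a)) * (\<Prod>i\<in>#a. \<kappa> i))"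
    by (simp add: sum_distrib_left field_simps)
  also have "\<dots> = (\<Sum>a | a \<in> int_partitions n \<and> size a \<le> r. of_nat (D_count g n a) * (\<Prod>i\<in>#a. \<kappa> i))"
  proof (rule sum.cong[OF refl])
    fix a assume "a \<in> {a. a \<in> int_partitions n \<and> size a \<le> r}"
    then have a: "a \<in> int_partitions n" and j: "r - size a + size a + 2 * g = n + 1" using r by auto
    show "fact n * type_weight a * ((odd_log ^ (r - size a) * (\<Prod>i\<in>#a. odd_binomial i)) $ g / fact (r - size a)) * (\<Prod>i\<in>#a. \<kappa> i) =
      of_nat (D_count g n a) * (\<Prod>i\<in>#a. \<kappa> i)"
      using D_count_eq[OF n a j, where 'b='a] half_log_half_prod_nth[of "r - size a" a g, where 'a='a] j by simp
  qed
  also have "\<dots> = alpha \<kappa> g n"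
    unfolding alpha_def
    by (rule sum.mono_neutral_left) (use r in \<open>auto simp: finite_int_partitions D_count_eq_0\<close>)
  finally show ?thesis by (simp add: \<Phi>_def)
qed

lemma alpha_eq_0:
  assumes "2 * g > n + 1"
  shows "alpha \<kappa> g n = 0"
  unfolding alpha_def by (rule sum.neutral) (use assms in \<open>simp add: D_count_eq_0\<close>)

section \<open>Coefficients of the derivatives of X\<close>

lemma X_ser_nth: "X_ser \<kappa> $$ d = (if d = - 1 then 1 else if d \<ge> 0 then \<kappa> (nat d + 1) else 0)"
  by (auto simp: X_ser_def)

lemma fls_deriv_power_nth:
  fixes F :: "'a::field_char_0 fls"
  shows "(fls_deriv ^^ m) F $$ d = fact m * ((of_int d + of_nat m) gchoose m) * F $$ (d + int m)"
proof -
  have "(fls_deriv ^^ m) F $$ d = (\<Prod>t<m. of_int d + 1 + of_nat t) * F $$ (d + int m)"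
  proof (induction m arbitrary: d)
    case (Suc m)
    have "(fls_deriv ^^ Suc m) F $$ d = (of_int d + 1) * (\<Prod>t<m. of_int (d + 1) + 1 + of_nat t) * F $$ (d + 1 + int m)"
      by (simp add: Suc)
    also have "(of_int d + 1) * (\<Prod>t<m. of_int (d + 1) + 1 + of_nat t) = (\<Prod>t<Suc m. of_int d + 1 + of_nat t :: 'a)"
      by (simp add: prod.lessThan_Suc_shift add_ac del: prod.lessThan_Suc)
    finally show ?case by (simp add: add_ac)
  qed simp
  also have "(\<Prod>t<m. of_int d + 1 + of_nat t) = fact m * ((of_int d + of_nat m) gchoose m :: 'a)"
    using prod_consecutive[of "of_int d :: 'a" 0 m] by simp
  finally show ?thesis .
qed

lemma gbinomial_minus_one: "(- 1 :: 'a::field_char_0) gchoose k = (- 1) ^ k"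
  using gbinomial_minus[of "1 :: 'a" k] binomial_gbinomial[of k k, where 'a='a] by simp

lemma X_coeff_alt:
  "X_coeff \<kappa> k = fls_const (inverse (2 ^ (2 * k) * fact (2 * k + 1))) * (fls_deriv ^^ (2 * k)) (X_ser \<kappa>)"
proof -
  have "(fact (2 * k + 1) :: 'a fls) = fls_const (fact (2 * k + 1))"
    by (metis fls_of_nat of_nat_fact)
  moreover have "(2 ^ (2 * k) :: 'a fls) = fls_const (2 ^ (2 * k))"
    by (metis fls_of_nat of_nat_numeral of_nat_power)
  ultimately have const: "(2 ^ (2 * k) * fact (2 * k + 1) :: 'a fls) = fls_const (2 ^ (2 * k) * fact (2 * k + 1))"
    by (simp only: fls_const_mult_const)
  show ?thesis unfolding X_coeff_def const divide_inverse fls_inverse_const by (rule mult.commute)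
qed

lemma X_coeff_nth:
  "X_coeff \<kappa> k $$ (int i - int (2 * k + 1)) = X_entry \<kappa> k i"
proof -
  note X_coeff_alt[of \<kappa> k]
  then have "X_coeff \<kappa> k $$ (int i - int (2 * k + 1)) =
     fact (2 * k) * ((of_nat i - 1) gchoose (2 * k)) * X_ser \<kappa> $$ (int i - 1) / (2 ^ (2 * k) * fact (2 * k + 1))"
    by (simp add: fls_deriv_power_nth field_simps)
  also have "\<dots> = ((of_nat i - 1) gchoose (2 * k)) / of_nat (2 * k + 1) * X_ser \<kappa> $$ (int i - 1) / 2 ^ (2 * k)"
  proof -
    have "f * b * c / (p * (q * f)) = b / q * c / p" if "f \<noteq> 0" for f b c p q :: 'a
    proof -
      have "f * b * c / (p * (q * f)) = f * (b * c) / (f * (p * q))" by (simp only: mult_ac)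
      then show ?thesis using that by (simp add: mult_ac)
    qed
    moreover have "fact (2 * k + 1) = of_nat (2 * k + 1) * (fact (2 * k) :: 'a)" by simp
    ultimately show ?thesis by (metis fact_nonzero)
  qed
  also have "\<dots> = X_entry \<kappa> k i"
  \<comment> \<open>The case \<open>i = 0\<close> is the pole of \<open>X\<close>, where
    \<open>- 1 gchoose (2 * k)\<close> is \<open>1\<close>. For \<open>i > 0\<close>, absorption
    turns \<open>((i - 1) choose (2 * k)) / (2 * k + 1)\<close> into
    \<open>(i choose (2 * k + 1)) / i\<close>.\<close>
  proof (cases i)
    case 0
    then show ?thesis by (simp add: X_entry_def X_ser_nth gbinomial_minus_one)
  next
    case (Suc i')
    have "of_nat i * of_nat (i' choose (2 * k)) = of_nat (2 * k + 1) * (of_nat (i choose (2 * k + 1)) :: 'a)"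
      using Suc_times_binomial_eq[of i' "2 * k"] Suc by (metis Suc_eq_plus1 mult.commute of_nat_mult)
    moreover have "(of_nat i - 1 :: 'a) gchoose (2 * k) = of_nat (i' choose (2 * k))"
      using Suc by (simp add: binomial_gbinomial)
    moreover have "(of_nat (2 * k + 1) :: 'a) \<noteq> 0" "(of_nat i :: 'a) \<noteq> 0"
      using Suc unfolding of_nat_eq_0_iff by simp_all
    ultimately have "((of_nat i - 1) gchoose (2 * k)) / of_nat (2 * k + 1) = (of_nat (i choose (2 * k + 1)) / of_nat i :: 'a)"
      by (simp add: field_simps del: of_nat_add of_nat_mult of_nat_Suc)
    moreover have "X_ser \<kappa> $$ (int i - 1) = \<kappa> i" using Suc by (simp add: X_ser_nth)
    ultimately show ?thesis using Suc by (simp add: X_entry_def del: of_nat_Suc binomial_Suc_Suc)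
  qed
  finally show ?thesis .
qed

lemma fps_to_fls_X_entry:
  "fps_to_fls (Abs_fps (X_entry \<kappa> k)) = fls_X ^ (2 * k + 1) * X_coeff \<kappa> k"
proof (rule fls_eqI)
  fix d
  have "X_coeff \<kappa> k $$ (d - int (2 * k + 1)) = 0" if "d < 0"
  proof -
    note X_coeff_alt[of \<kappa> k]
    then show ?thesis using that by (simp add: fls_deriv_power_nth X_ser_nth)
  qed
  moreover have "(fls_X ^ (2 * k + 1) * X_coeff \<kappa> k) $$ d = X_coeff \<kappa> k $$ (d - int (2 * k + 1))"
    unfolding fls_X_power_times_conv_shift fls_shift_nth by (rule arg_cong[of _ _ "($$) _"]) simp
  ultimately show "fps_to_fls (Abs_fps (X_entry \<kappa> k)) $$ d = (fls_X ^ (2 * k + 1) * X_coeff \<kappa> k) $$ d"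
    using X_coeff_nth[of \<kappa> k "nat d"] by (cases "d < 0") simp_all
qed

lemma X_coeff_0: "X_coeff \<kappa> 0 = X_ser \<kappa>"
  by (simp add: X_coeff_def)

text \<open>The same power, now expanded over partitions of \<open>g\<close>. The zero parts give
  powers of \<open>X_coeff \<kappa> 0 = X_ser \<kappa>\<close>, and the shifts add up to
  \<open>2 * g + r = n + 1\<close>, so the coefficient of \<open>y ^ n\<close> becomes a
  residue.\<close>

theorem alpha_eq_residue:
  assumes n: "n \<ge> 1" and r: "r + 2 * g = n + 1"
  shows "alpha \<kappa> g n = (\<Sum>a | a \<in> int_partitions g \<and> size a \<le> r.
    fact n / (of_nat (sym_factor a) * fact (r - size a)) * fls_residue (X_ser \<kappa> ^ (r - size a) * (\<Prod>i\<in>#a. X_coeff \<kappa> i)))"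
proof -
  define \<Psi> where "\<Psi> = Abs_fps (\<lambda>k. Abs_fps (\<lambda>i. X_entry \<kappa> k i))"
  have "Abs_fps (\<lambda>i. Abs_fps (\<lambda>k. X_entry \<kappa> k i)) = fps_flip \<Psi>"
    by (intro fps_ext) (simp add: \<Psi>_def)
  then have "alpha \<kappa> g n = fact n / fact r * (\<Psi> ^ r) $ g $ n"
    by (simp add: alpha_eq_power_nth[OF n r] flip: fps_flip_power)
  also have "(\<Psi> ^ r) $ g = (\<Sum>a | a \<in> int_partitions g \<and> size a \<le> r.
      of_nat (card (permutations_of_multiset (a + replicate_mset (r - size a) 0))) *
      (\<Prod>i\<in>#a + replicate_mset (r - size a) 0. \<Psi> $ i))"
    unfolding fps_power_nth_multiset by (rule sum_multisets_zero_parts)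
  also have "\<dots> $ n = (\<Sum>a | a \<in> int_partitions g \<and> size a \<le> r.
      fact r / (of_nat (sym_factor a) * fact (r - size a)) * fls_residue (X_ser \<kappa> ^ (r - size a) * (\<Prod>i\<in>#a. X_coeff \<kappa> i)))"
    unfolding fps_sum_nth
  proof (rule sum.cong[OF refl])
    fix a assume "a \<in> {a. a \<in> int_partitions g \<and> size a \<le> r}"
    then have a: "a \<in> int_partitions g" "size a \<le> r" by auto
    have "(of_nat (card (permutations_of_multiset (a + replicate_mset (r - size a) 0))) :: 'a fps) =
       fps_const (fact r / (of_nat (sym_factor a) * fact (r - size a)))"
      unfolding card_permutations_zero_parts[OF a(1,2), symmetric] fps_of_nat ..
    moreover have "(\<Prod>i\<in>#a + replicate_mset (r - size a) 0. \<Psi> $ i) $ n =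
      fls_residue (X_ser \<kappa> ^ (r - size a) * (\<Prod>i\<in>#a. X_coeff \<kappa> i))"
    proof -
      have P: "fps_to_fls (\<Prod>i\<in>#b. \<Psi> $ i) = fls_X ^ (2 * \<Sum>\<^sub># b + size b) * (\<Prod>i\<in>#b. X_coeff \<kappa> i)" for b
      proof (induction b)
        case (add i b)
        have "2 * \<Sum>\<^sub># (add_mset i b) + size (add_mset i b) = (2 * i + 1) + (2 * \<Sum>\<^sub># b + size b)" by simp
        then have "(fls_X :: 'a fls) ^ (2 * \<Sum>\<^sub># (add_mset i b) + size (add_mset i b)) = fls_X ^ (2 * i + 1) * fls_X ^ (2 * \<Sum>\<^sub># b + size b)"
          by (simp only: power_add)
        then show ?case using add fps_to_fls_X_entry[of \<kappa> i]
          by (simp add: fls_times_fps_to_fls \<Psi>_def mult_ac)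
      qed simp
      have "fps_to_fls (\<Prod>i\<in>#a + replicate_mset (r - size a) 0. \<Psi> $ i) = fls_X ^ (n + 1) * (X_ser \<kappa> ^ (r - size a) * (\<Prod>i\<in>#a. X_coeff \<kappa> i))"
      proof -
        have "2 * \<Sum>\<^sub># (a + replicate_mset (r - size a) 0) + size (a + replicate_mset (r - size a) 0) = n + 1"
          using a r by (simp add: int_partitions_iff)
        then show ?thesis unfolding P
          by (simp add: X_coeff_0 image_replicate_mset prod_mset_replicate_mset mult_ac)
      qed
      then have "fps_to_fls (\<Prod>i\<in>#a + replicate_mset (r - size a) 0. \<Psi> $ i) $$ int n = fls_residue (X_ser \<kappa> ^ (r - size a) * (\<Prod>i\<in>#a. X_coeff \<kappa> i))"
        by (simp add: fls_X_power_times_conv_shift del: power_Suc)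
      then show ?thesis by simp
    qed
    ultimately show "(of_nat (card (permutations_of_multiset (a + replicate_mset (r - size a) 0))) *
      (\<Prod>i\<in>#a + replicate_mset (r - size a) 0. \<Psi> $ i)) $ n =
      fact r / (of_nat (sym_factor a) * fact (r - size a)) * fls_residue (X_ser \<kappa> ^ (r - size a) * (\<Prod>i\<in>#a. X_coeff \<kappa> i))"
      by simp
  qed
  finally show ?thesis by (simp add: sum_distrib_left)
qed

section \<open>Substitution of \<open>X\<close>\<close>

text \<open>A lower bound that the zero series satisfies as well, whereas
  \<open>fls_subdegree 0 = 0\<close>.\<close>

abbreviation "vanishes_below e F \<equiv> (\<forall>k<e. F $$ k = 0)"

lemma vanishes_below_mult:
  fixes F G :: "'a::field_char_0 fls"
  assumes "vanishes_below e F" "vanishes_below e' G"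
  shows "vanishes_below (e + e') (F * G)"
proof (cases "F = 0 \<or> G = 0")
  case False
  then have "e \<le> fls_subdegree F" "e' \<le> fls_subdegree G"
    using assms by (auto intro: fls_subdegree_geI)
  then show ?thesis by (auto intro!: fls_times_nth_eq0)
qed auto

lemma subdegree_deriv_X_ser: "fls_subdegree (fls_deriv (X_ser \<kappa>)) = - 2"
  using fls_subdegree_deriv[of "X_ser \<kappa>"] fls_subdegree_X_ser[of \<kappa>] by simp

lemma X_ser_nonzero: "X_ser \<kappa> \<noteq> 0" "fls_deriv (X_ser \<kappa>) \<noteq> 0"
  using fls_subdegree_X_ser[of \<kappa>] subdegree_deriv_X_ser[of \<kappa>] by auto

lemma subdegree_inverse_deriv_X_ser: "fls_subdegree (1 / fls_deriv (X_ser \<kappa>)) = 2"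
  using X_ser_nonzero[of \<kappa>] by (simp add: divide_inverse subdegree_deriv_X_ser)

lemma vanishes_below_inverse_deriv_X_ser: "vanishes_below 2 (1 / fls_deriv (X_ser \<kappa>))"
  using subdegree_inverse_deriv_X_ser[of \<kappa>] by simp

text \<open>Differentiation lowers the order by one, and \<open>1 / X'\<close> has order
  two.\<close>

lemma vanishes_below_d_dX:
  assumes "vanishes_below e F"
  shows "vanishes_below (e + 1) (- d_dX \<kappa> F)"
proof -
  have "vanishes_below (e - 1) (fls_deriv F)" using assms by simp
  from vanishes_below_mult[OF vanishes_below_inverse_deriv_X_ser this, of \<kappa>]
  show ?thesis by (simp add: d_dX_def)
qed

lemma vanishes_below_d_dX_funpow:
  assumes "vanishes_below e F"
  shows "vanishes_below (e + int m) (((\<lambda>F. - d_dX \<kappa> F) ^^ m) F)"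
proof (induction m)
  case (Suc m)
  from vanishes_below_d_dX[OF this, of \<kappa>] show ?case by (simp add: add_ac)
qed (use assms in simp)

lemma vanishes_below_X_coeff: "vanishes_below (- int (2 * k + 1)) (X_coeff \<kappa> k)"
  by (auto simp: X_coeff_alt fls_deriv_power_nth X_ser_nth)

lemma vanishes_below_prod_X_coeff:
  "vanishes_below (- int (2 * \<Sum>\<^sub># a + size a)) (\<Prod>i\<in>#a. X_coeff \<kappa> i)"
proof (induction a)
  case (add i a)
  from vanishes_below_mult[OF vanishes_below_X_coeff[of i \<kappa>] add] show ?case
    by (simp add: algebra_simps)
qed auto

text \<open>
  The coefficient extraction dual to \<open>1 / X\<^sup>n\<^sup>+\<^sup>1\<close>, up to sign; integration by parts turns
  \<open>- d/dX\<close> into the lowering of \<open>n\<close>.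
\<close>

definition X_pairing :: "(nat \<Rightarrow> 'a::field_char_0) \<Rightarrow> nat \<Rightarrow> 'a fls \<Rightarrow> 'a" where
  "X_pairing \<kappa> n F = fls_residue (X_ser \<kappa> ^ n * fls_deriv (X_ser \<kappa>) * F)"

lemma X_pairing_sum: "X_pairing \<kappa> n (\<Sum>i\<in>I. F i) = (\<Sum>i\<in>I. X_pairing \<kappa> n (F i))"
  by (simp add: X_pairing_def sum_distrib_left fls_nth_sum)

lemma X_pairing_const: "X_pairing \<kappa> n (fls_const c * F) = c * X_pairing \<kappa> n F"
proof -
  have "X_ser \<kappa> ^ n * fls_deriv (X_ser \<kappa>) * (fls_const c * F) = fls_const c * (X_ser \<kappa> ^ n * fls_deriv (X_ser \<kappa>) * F)"
    by (simp only: mult_ac)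
  then show ?thesis unfolding X_pairing_def by (simp only: fls_residue_fls_const_times(1))
qed

text \<open>The factor \<open>X'\<close> cancels before the integration by parts. For
  \<open>n = 0\<close> the truncated \<open>n - 1\<close> is harmless because of the factor
  \<open>of_nat n\<close>.\<close>

lemma X_pairing_d_dX: "X_pairing \<kappa> n (- d_dX \<kappa> F) = of_nat n * X_pairing \<kappa> (n - 1) F"
proof -
  have "X_pairing \<kappa> n (- d_dX \<kappa> F) = - fls_residue (X_ser \<kappa> ^ n * fls_deriv F)"
    using X_ser_nonzero[of \<kappa>] by (simp add: X_pairing_def d_dX_def)
  also have "\<dots> = fls_residue (fls_deriv (X_ser \<kappa> ^ n) * F)"
    by (simp only: fls_residue_times_deriv)
  also have "fls_deriv (X_ser \<kappa> ^ n) * F = fls_const (of_nat n) * (X_ser \<kappa> ^ (n - 1) * fls_deriv (X_ser \<kappa>) * F)"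
    by (simp add: fls_deriv_power fls_of_nat mult_ac)
  finally show ?thesis by (simp add: X_pairing_def)
qed

lemma X_pairing_d_dX_funpow:
  "X_pairing \<kappa> n (((\<lambda>F. - d_dX \<kappa> F) ^^ m) F) =
    (if m \<le> n then fact n / fact (n - m) * X_pairing \<kappa> (n - m) F else 0)"
proof (induction m arbitrary: n)
  case (Suc m)
  show ?case
  proof (cases n)
    case (Suc n')
    then show ?thesis by (simp add: X_pairing_d_dX Suc.IH)
  qed (simp add: X_pairing_d_dX)
qed simp

lemma X_pairing_eqI:
  assumes F: "vanishes_below 1 F" and G: "vanishes_below 1 G"
    and eq: "\<And>n. X_pairing \<kappa> n F = X_pairing \<kappa> n G"
  shows "F = G"
proof (rule ccontr)
  assume "F \<noteq> G"
  define H where "H = F - G"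
  have H: "H \<noteq> 0" using \<open>F \<noteq> G\<close> by (simp add: H_def)
  have "1 \<le> fls_subdegree H" using F G H by (intro fls_subdegree_geI) (auto simp: H_def)
  \<comment> \<open>With \<open>d\<close> the order of \<open>H\<close>, the choice
    \<open>n = d - 1\<close> gives the integrand order \<open>- n - 2 + d = - 1\<close>, so its
    residue is its leading coefficient.\<close>
  define n where "n = nat (fls_subdegree H) - 1"
  let ?P = "X_ser \<kappa> ^ n * fls_deriv (X_ser \<kappa>) * H"
  have "fls_subdegree ?P = - 1"
    using \<open>1 \<le> fls_subdegree H\<close> H X_ser_nonzero[of \<kappa>]
    by (simp add: fls_subdegree_pow fls_subdegree_X_ser subdegree_deriv_X_ser n_def)
  moreover have "?P \<noteq> 0" using H X_ser_nonzero[of \<kappa>] by simp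
  ultimately have "fls_residue ?P \<noteq> 0" using nth_fls_subdegree_nonzero[of ?P] by simp
  moreover have "fls_residue ?P = X_pairing \<kappa> n F - X_pairing \<kappa> n G"
    by (simp add: H_def X_pairing_def right_diff_distrib)
  ultimately show False using eq by simp
qed

text \<open>For \<open>j = Suc n\<close> the integrand is the logarithmic derivative of
  \<open>X\<close>, with residue the order \<open>- 1\<close> of \<open>X\<close>; for smaller
  \<open>j\<close> it is \<open>X ^ m * X'\<close>, a multiple of a derivative.\<close>

lemma X_pairing_inverse_power:
  assumes "j \<le> Suc n"
  shows "X_pairing \<kappa> n (inverse (X_ser \<kappa>) ^ j) = (if j = Suc n then - 1 else 0)"
proof (cases "j = Suc n")
  case True
  have "X_ser \<kappa> ^ n * fls_deriv (X_ser \<kappa>) * inverse (X_ser \<kappa>) ^ Suc n = fls_deriv (X_ser \<kappa>) * inverse (X_ser \<kappa>)"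
    using X_ser_nonzero[of \<kappa>] by (simp add: power_inverse)
  then show ?thesis
    using True fls_residue_deriv_times_inverse_eq_subdegree(1)[of "X_ser \<kappa>"]
    by (simp only: X_pairing_def fls_subdegree_X_ser if_True) simp
next
  case False
  with assms have j: "j \<le> n" by simp
  define m where "m = n - j"
  have "X_ser \<kappa> ^ n = X_ser \<kappa> ^ m * X_ser \<kappa> ^ j" using j by (simp add: m_def flip: power_add)
  then have "X_ser \<kappa> ^ n * fls_deriv (X_ser \<kappa>) * inverse (X_ser \<kappa>) ^ j =
      X_ser \<kappa> ^ m * fls_deriv (X_ser \<kappa>) * (X_ser \<kappa> * inverse (X_ser \<kappa>)) ^ j"
    by (simp only: power_mult_distrib mult_ac)
  then have "X_ser \<kappa> ^ n * fls_deriv (X_ser \<kappa>) * inverse (X_ser \<kappa>) ^ j = X_ser \<kappa> ^ m * fls_deriv (X_ser \<kappa>)"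
    by (simp only: right_inverse[OF X_ser_nonzero(1)] power_one mult_1_right)
  moreover have "of_nat (Suc m) * fls_residue (X_ser \<kappa> ^ m * fls_deriv (X_ser \<kappa>)) = 0"
  proof -
    have "fls_deriv (X_ser \<kappa> ^ Suc m) = fls_const (of_nat (Suc m)) * (X_ser \<kappa> ^ m * fls_deriv (X_ser \<kappa>))"
      unfolding fls_deriv_power fls_of_nat by (simp add: mult_ac del: of_nat_Suc power_Suc)
    then show ?thesis using fls_residue_deriv[of "X_ser \<kappa> ^ Suc m"] by (simp del: of_nat_Suc power_Suc fls_deriv_nth)
  qed
  moreover have "(of_nat (Suc m) :: 'a) \<noteq> 0" by (rule of_nat_neq_0)
  ultimately show ?thesis using False by (simp only: X_pairing_def mult_eq_0_iff if_False) simp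
qed

section \<open>The substitution as a ring homomorphism\<close>

lemma subst_X_mult: "subst_X \<kappa> (F * G) = subst_X \<kappa> F * subst_X \<kappa> G"
  unfolding subst_X_def fps_compose_mult_distrib[OF fls_regpart_inverse_X_ser_nth_0] fls_times_fps_to_fls ..

lemma subst_X_add: "subst_X \<kappa> (F + G) = subst_X \<kappa> F + subst_X \<kappa> G"
  by (simp add: subst_X_def fps_compose_add_distrib)

lemma subst_X_sum: "subst_X \<kappa> (\<Sum>i\<in>I. F i) = (\<Sum>i\<in>I. subst_X \<kappa> (F i))"
  by (induction I rule: infinite_finite_induct) (simp_all add: subst_X_add, simp_all add: subst_X_def)

lemma subst_X_monom: "subst_X \<kappa> (fps_const c * fps_X ^ j) = fls_const c * inverse (X_ser \<kappa>) ^ j"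
proof -
  have "subst_X \<kappa> fps_X = inverse (X_ser \<kappa>)"
    unfolding subst_X_def fps_X_fps_compose_startby0[OF fls_regpart_inverse_X_ser_nth_0]
    by (rule fps_to_fls_regpart_inverse_X_ser)
  moreover have "subst_X \<kappa> 1 = 1" by (simp add: subst_X_def)
  ultimately have "subst_X \<kappa> (fps_X ^ j) = inverse (X_ser \<kappa>) ^ j"
    by (induction j) (simp_all add: subst_X_mult)
  moreover have "subst_X \<kappa> (fps_const c) = fls_const c" by (simp add: subst_X_def fps_const_to_fls)
  ultimately show ?thesis by (simp add: subst_X_mult)
qed

lemma fps_truncation:
  fixes W :: "'b::comm_ring_1 fps"
  shows "W = (\<Sum>j<K. fps_const (W $ j) * fps_X ^ j) + fps_shift K W * fps_X ^ K"
proof (rule fps_ext)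
  fix n
  have "(\<Sum>j<K. fps_const (W $ j) * fps_X ^ j) $ n = (\<Sum>j<K. if j = n then W $ j else 0)"
    unfolding fps_sum_nth by (intro sum.cong refl) simp
  then show "W $ n = ((\<Sum>j<K. fps_const (W $ j) * fps_X ^ j) + fps_shift K W * fps_X ^ K) $ n"
    by (simp add: fps_X_power_mult_right_nth)
qed

text \<open>The series is cut after the power \<open>Suc n\<close>, which reduces the claim to
  finitely many inverse powers of \<open>X\<close>. The tail carries \<open>X ^ (- n - 2)\<close>,
  which makes the integrand regular.\<close>

lemma X_pairing_subst_X: "X_pairing \<kappa> n (subst_X \<kappa> W) = - W $ Suc n"
proof -
  have "W = (\<Sum>j\<le>Suc n. fps_const (W $ j) * fps_X ^ j) + fps_shift (n + 2) W * (fps_const 1 * fps_X ^ (n + 2))"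
    using fps_truncation[of W "Suc (Suc n)"] by (simp add: lessThan_Suc_atMost del: power_Suc sum.lessThan_Suc sum.atMost_Suc)
  then have "subst_X \<kappa> W = (\<Sum>j\<le>Suc n. fls_const (W $ j) * inverse (X_ser \<kappa>) ^ j) +
      subst_X \<kappa> (fps_shift (n + 2) W) * (inverse (X_ser \<kappa>) ^ (n + 2))"
    by (metis (no_types, lifting) subst_X_add subst_X_sum subst_X_mult subst_X_monom mult_1 fls_const_1 sum.cong)
  moreover have "X_pairing \<kappa> n (subst_X \<kappa> (fps_shift (n + 2) W) * (inverse (X_ser \<kappa>) ^ (n + 2))) = 0"
  proof -
    let ?Q = "X_ser \<kappa> ^ n * fls_deriv (X_ser \<kappa>) * inverse (X_ser \<kappa>) ^ (n + 2)"
    have "fls_subdegree ?Q = 0"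
      using X_ser_nonzero[of \<kappa>]
      by (simp add: fls_subdegree_pow fls_subdegree_X_ser subdegree_deriv_X_ser del: power_Suc power_inverse)
    moreover have "fls_subdegree (subst_X \<kappa> (fps_shift (n + 2) W)) \<ge> 0"
      unfolding subst_X_def by (rule fls_subdegree_fls_to_fps_gt0)
    ultimately have "(?Q * subst_X \<kappa> (fps_shift (n + 2) W)) $$ - 1 = 0" by (intro fls_times_nth_eq0) simp
    then show ?thesis by (simp add: X_pairing_def mult_ac)
  qed
  moreover have "X_pairing \<kappa> n (\<Sum>j\<le>Suc n. fls_const (W $ j) * inverse (X_ser \<kappa>) ^ j) = - W $ Suc n"
  proof -
    have "X_pairing \<kappa> n (\<Sum>j\<le>Suc n. fls_const (W $ j) * inverse (X_ser \<kappa>) ^ j) =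
       (\<Sum>j\<le>Suc n. W $ j * (if j = Suc n then - 1 else 0))"
      unfolding X_pairing_sum X_pairing_const by (intro sum.cong refl) (simp add: X_pairing_inverse_power)
    then show ?thesis by (simp add: if_distrib[of "(*) _"] cong: if_cong)
  qed
  ultimately show ?thesis by (simp add: X_pairing_def distrib_left)
qed

lemma size_le_int_partitions: "a \<in> int_partitions g \<Longrightarrow> size a \<le> g"
proof -
  have "0 \<notin># a \<Longrightarrow> size a \<le> \<Sum>\<^sub># a" by (induction a) auto
  then show "a \<in> int_partitions g \<Longrightarrow> size a \<le> g" by (auto simp: int_partitions_iff)
qed

lemma sum_int_partitions_by_size:
  assumes "g \<ge> 1"
  shows "(\<Sum>l=1..g. \<Sum>a\<in>{a \<in> int_partitions g. size a = l}. h a l) = (\<Sum>a\<in>int_partitions g. h a (size a))"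
proof -
  have "(\<Sum>l=1..g. \<Sum>a\<in>{a \<in> int_partitions g. size a = l}. h a l) = (\<Sum>l=1..g. \<Sum>a\<in>{a \<in> int_partitions g. size a = l}. h a (size a))"
    by (intro sum.cong refl) auto
  also have "\<dots> = (\<Sum>a\<in>int_partitions g. h a (size a))"
  proof (rule sum.group)
    show "size ` int_partitions g \<subseteq> {1..g}"
      using assms size_le_int_partitions by (fastforce simp: int_partitions_iff Suc_le_eq nonempty_has_size[symmetric])
  qed (simp_all add: finite_int_partitions)
  finally show ?thesis .
qed

text \<open>The order \<open>m\<close> is a separate argument: one formula prescribes it through the
  number of parts, the other through the power of \<open>u\<close>.\<close>

definition genus_term :: "(nat \<Rightarrow> 'a::field_char_0) \<Rightarrow> nat \<Rightarrow> nat multiset \<Rightarrow> 'a fls" where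
  "genus_term \<kappa> m a = 1 / of_nat (sym_factor a) *
     ((\<lambda>F. - d_dX \<kappa> F) ^^ m) (- (1 / fls_deriv (X_ser \<kappa>)) * (\<Prod>i\<in>#a. X_coeff \<kappa> i))"

lemma inverse_of_nat_fls: "1 / of_nat s = fls_const (1 / of_nat s :: 'a::field_char_0)"
  by (simp add: fls_of_nat divide_inverse fls_inverse_const)

lemma X_pairing_genus_term:
  "X_pairing \<kappa> n (genus_term \<kappa> m a) = (if m \<le> n then
     - (fact n / (of_nat (sym_factor a) * fact (n - m)) * fls_residue (X_ser \<kappa> ^ (n - m) * (\<Prod>i\<in>#a. X_coeff \<kappa> i))) else 0)"
proof -
  have "X_pairing \<kappa> k (- (1 / fls_deriv (X_ser \<kappa>)) * Q) = - fls_residue (X_ser \<kappa> ^ k * Q)" for k Q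
    using X_ser_nonzero[of \<kappa>] by (simp add: X_pairing_def)
  then show ?thesis
    unfolding genus_term_def inverse_of_nat_fls X_pairing_const X_pairing_d_dX_funpow by simp
qed

lemma subst_X_W_per:
  assumes g: "g \<ge> 1"
  shows "subst_X \<kappa> (W_per \<kappa> g) = (\<Sum>a\<in>int_partitions g. genus_term \<kappa> (2 * g + size a - 1) a)"
proof (rule X_pairing_eqI[of _ _ \<kappa>])
  show "vanishes_below 1 (subst_X \<kappa> (W_per \<kappa> g))"
    by (auto simp: subst_X_def W_per_def)
  have "vanishes_below 1 (genus_term \<kappa> (2 * g + size a - 1) a)" if a: "a \<in> int_partitions g" for a
  proof -
    have "vanishes_below (2 + (- int (2 * \<Sum>\<^sub># a + size a))) (1 / fls_deriv (X_ser \<kappa>) * (\<Prod>i\<in>#a. X_coeff \<kappa> i))"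
      by (rule vanishes_below_mult[OF vanishes_below_inverse_deriv_X_ser vanishes_below_prod_X_coeff])
    moreover have "\<Sum>\<^sub># a = g" using a by (simp add: int_partitions_iff)
    ultimately have "vanishes_below (2 - int (2 * g + size a)) (- (1 / fls_deriv (X_ser \<kappa>)) * (\<Prod>i\<in>#a. X_coeff \<kappa> i))"
      by (simp only: mult_minus_left fls_uminus_nth neg_equal_0_iff_equal diff_conv_add_uminus)
    \<comment> \<open>The orders add up to
      \<open>2 - (2 * g + size a) + (2 * g + size a - 1) = 1\<close>, just enough for
      \<open>X_pairing_eqI\<close>.\<close>
    from vanishes_below_d_dX_funpow[OF this, of "2 * g + size a - 1" \<kappa>] show ?thesis
      using g unfolding genus_term_def inverse_of_nat_fls by (simp add: of_nat_diff)
  qed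
  then show "vanishes_below 1 (\<Sum>a\<in>int_partitions g. genus_term \<kappa> (2 * g + size a - 1) a)"
    by (simp add: fls_nth_sum)
  fix n
  show "X_pairing \<kappa> n (subst_X \<kappa> (W_per \<kappa> g)) =
    X_pairing \<kappa> n (\<Sum>a\<in>int_partitions g. genus_term \<kappa> (2 * g + size a - 1) a)"
  proof (cases "n \<ge> 1 \<and> 2 * g \<le> n + 1")
    case True
    define r where "r = n + 1 - 2 * g"
    have r: "r + 2 * g = n + 1" using True by (simp add: r_def)
    have "X_pairing \<kappa> n (\<Sum>a\<in>int_partitions g. genus_term \<kappa> (2 * g + size a - 1) a) =
      (\<Sum>a\<in>int_partitions g. if size a \<le> r then - (fact n / (of_nat (sym_factor a) * fact (r - size a)) *
        fls_residue (X_ser \<kappa> ^ (r - size a) * (\<Prod>i\<in>#a. X_coeff \<kappa> i))) else 0)"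
    proof -
      \<comment> \<open>This matches the range and the power of \<open>X\<close> in
        \<open>alpha_eq_residue\<close>; the subtraction of one is exact because
        \<open>g \<ge> 1\<close>.\<close>
      have *: "2 * g + l - 1 \<le> n \<longleftrightarrow> l \<le> r" "n - (2 * g + l - 1) = r - l" for l using r g by linarith+
      show ?thesis unfolding X_pairing_sum X_pairing_genus_term * ..
    qed
    also have "\<dots> = - alpha \<kappa> g n"
      unfolding alpha_eq_residue[OF True[THEN conjunct1] r] sum_negf[symmetric]
      by (rule sum.inter_filter[symmetric]) (rule finite_int_partitions)
    finally show ?thesis using True by (simp add: X_pairing_subst_X W_per_def)
  next
    case False
    \<comment> \<open>A partition of \<open>g \<ge> 1\<close> has a part, so the operator has order
      at least \<open>2 * g\<close>, which exceeds \<open>n\<close> here.\<close>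
    then have "\<not> 2 * g + size a - 1 \<le> n" if "a \<in> int_partitions g" for a
      using g that by (cases "a = {#}") (auto simp: int_partitions_iff nonempty_has_size)
    then have "X_pairing \<kappa> n (\<Sum>a\<in>int_partitions g. genus_term \<kappa> (2 * g + size a - 1) a) = 0"
      unfolding X_pairing_sum X_pairing_genus_term by simp
    moreover have "W_per \<kappa> g $ Suc n = 0"
      using False alpha_eq_0[of n g \<kappa>] by (auto simp: W_per_def)
    ultimately show ?thesis by (simp add: X_pairing_subst_X)
  qed
qed

section \<open>The series in \<open>\<hbar>\<close>\<close>

lemma fls_tendstoI:
  fixes F :: "nat \<Rightarrow> 'b::group_add fls"
  assumes "\<And>K. \<forall>\<^sub>F N in sequentially. \<forall>d\<le>K. F N $$ d = S $$ d"
  shows "F \<longlonglongrightarrow> S"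
proof (rule tendstoI)
  fix e :: real assume "e > 0"
  then obtain n where n: "inverse (2 ^ n) < e"
    using real_arch_pow_inv[of e "1/2"] by (auto simp: power_one_over inverse_eq_divide)
  from assms[of "int n"] show "\<forall>\<^sub>F N in sequentially. dist (F N) S < e"
  proof eventually_elim
    case (elim N)
    show ?case
    proof (cases "F N = S")
      case False
      then have "F N - S \<noteq> 0" by simp
      then have "int n < fls_subdegree (F N - S)"
        using elim by (intro fls_subdegree_greaterI) auto
      then have "dist (F N) S = inverse (2 ^ nat (fls_subdegree (F N - S)))" "n \<le> nat (fls_subdegree (F N - S))"
        using False by (simp_all add: dist_fls_def)
      then have "dist (F N) S \<le> inverse (2 ^ n)" by (simp add: le_imp_inverse_le power_increasing)
      with n show ?thesis by simp
    qed (use \<open>e > 0\<close> in simp)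
  qed
qed

text \<open>Monotonicity of \<open>M\<close> lets one cut serve all degrees up to a given one, and
  \<open>B\<close> makes the coefficientwise sum a Laurent series.\<close>

lemma fls_summable_coefficientwise:
  fixes f :: "nat \<Rightarrow> 'b::ab_group_add fls"
  assumes "\<And>m d. f m $$ d \<noteq> 0 \<Longrightarrow> m < M d" and "mono M" and "\<And>d. d < B \<Longrightarrow> M d = 0"
  shows "summable f" "suminf f $$ d = (\<Sum>m<M d. f m $$ d)"
proof -
  define S where "S = Abs_fls (\<lambda>d. \<Sum>m<M d. f m $$ d)"
  have S: "S $$ d = (\<Sum>m<M d. f m $$ d)" for d
    unfolding S_def by (rule nth_Abs_fls_lower_bound[of B]) (simp add: assms(3))
  have zero: "f m $$ d = 0" if "M d \<le> m" for m d using assms(1)[of m d] that by fastforce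
  have "(\<lambda>N. \<Sum>m<N. f m) \<longlonglongrightarrow> S"
  proof (rule fls_tendstoI)
    fix K
    show "\<forall>\<^sub>F N in sequentially. \<forall>d\<le>K. (\<Sum>m<N. f m) $$ d = S $$ d"
      using eventually_ge_at_top[of "M K"]
    proof eventually_elim
      case (elim N)
      show ?case
      proof (intro allI impI)
        fix d assume "d \<le> K"
        then have "M d \<le> N" using monoD[OF assms(2)] elim by (meson order_trans)
        then show "(\<Sum>m<N. f m) $$ d = S $$ d"
          unfolding S fls_nth_sum
          by (intro sum.mono_neutral_right) (auto simp: zero)
      qed
    qed
  qed
  then have "f sums S" by (simp add: sums_def)
  then show "summable f" "suminf f $$ d = (\<Sum>m<M d. f m $$ d)"
    using S by (auto simp: sums_iff)
qed

section \<open>The exponential in u and hbar\<close>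

lemma fls_const_prod_mset: "(\<Prod>i\<in>#b. fls_const (f i) * fls_X ^ (2 * i)) = fls_const (\<Prod>i\<in>#b. f i) * (fls_X :: 'b::field fls) ^ (2 * \<Sum>\<^sub># b)"
proof (induction b)
  case (add i b)
  have "fls_const (f i) * fls_X ^ (2 * i) * (fls_const (\<Prod>i\<in>#b. f i) * fls_X ^ (2 * \<Sum>\<^sub># b)) =
    (fls_const (f i) * fls_const (\<Prod>i\<in>#b. f i)) * ((fls_X :: 'b fls) ^ (2 * i) * fls_X ^ (2 * \<Sum>\<^sub># b))"
    by (simp only: mult_ac)
  then show ?case using add by (simp add: power_add distrib_left)
qed simp

lemma fls_const_sum: "fls_const (\<Sum>i\<in>I. f i) = (\<Sum>i\<in>I. fls_const (f i :: 'b::comm_ring_1))"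
  by (induction I rule: infinite_finite_induct) (simp_all flip: fls_plus_const)

text \<open>The coefficient of \<open>t^s\<close> in the \<open>i\<close>-th power of the series
  with coefficients \<open>X_coeff \<kappa> k\<close>, \<open>k \<ge> 1\<close>, already divided by
  the \<open>fact i\<close> of the exponential series.\<close>

definition multi_coeff :: "(nat \<Rightarrow> 'a::field_char_0) \<Rightarrow> nat \<Rightarrow> nat \<Rightarrow> 'a fls" where
  "multi_coeff \<kappa> s i = (\<Sum>a\<in>{a \<in> int_partitions s. size a = i}. 1 / of_nat (sym_factor a) * (\<Prod>k\<in>#a. X_coeff \<kappa> k))"

lemma exponent_ser_power_nth:
  "(exponent_ser \<kappa> ^ i) $ k = (if i \<le> k \<and> even (k - i)
     then fls_const (fact i * multi_coeff \<kappa> ((k - i) div 2) i) * fls_X ^ (k - i) else 0)"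
proof -
  define C where "C = Abs_fps (\<lambda>k. if k \<ge> 1 then fls_const (X_coeff \<kappa> k) * fls_X ^ (2 * k) else 0)"
  have X2: "(fps_X ^ 2 :: 'a fls fls fps) $ 0 = 0" by simp
  have "exponent_ser \<kappa> = fps_X * (C oo fps_X ^ 2)"
    by (rule fps_X_mult_compose_X_square_eqI) (auto simp: exponent_ser_def C_def)
  then have pow: "exponent_ser \<kappa> ^ i = fps_X ^ i * ((C ^ i) oo fps_X ^ 2)"
    by (simp add: power_mult_distrib fps_compose_power[OF X2])
  have coeff: "(C ^ i) $ s = fls_const (fact i * multi_coeff \<kappa> s i) * fls_X ^ (2 * s)" for s
  proof -
    have fin: "finite {b. size b = i \<and> \<Sum>\<^sub># b = s}"
    proof -
      have "{b. size b = i \<and> \<Sum>\<^sub># b = s} \<subseteq> mset ` natpermute s i"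
      proof
        fix b assume b: "b \<in> {b. size b = i \<and> \<Sum>\<^sub># b = s}"
        obtain v where "b = mset v" using ex_mset by metis
        with b show "b \<in> mset ` natpermute s i" by (auto simp: natpermute_def sum_mset_sum_list)
      qed
      then show ?thesis using natpermute_finite finite_surj by blast
    qed
    have "(C ^ i) $ s = (\<Sum>b | size b = i \<and> \<Sum>\<^sub># b = s. of_nat (card (permutations_of_multiset b)) * (\<Prod>k\<in>#b. C $ k))"
      by (rule fps_power_nth_multiset)
    also have "\<dots> = (\<Sum>b\<in>{a \<in> int_partitions s. size a = i}. of_nat (card (permutations_of_multiset b)) * (\<Prod>k\<in>#b. C $ k))"
    proof (rule sum.mono_neutral_right[OF fin])
      \<comment> \<open>A zero part contributes the constant coefficient of \<open>C\<close>, which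
        is zero; only partitions remain.\<close>
      show "\<forall>b\<in>{b. size b = i \<and> \<Sum>\<^sub># b = s} - {a \<in> int_partitions s. size a = i}.
        of_nat (card (permutations_of_multiset b)) * (\<Prod>k\<in>#b. C $ k) = 0"
        by (auto simp: int_partitions_iff C_def image_iff prod_mset_zero_iff)
    qed (auto simp: int_partitions_iff)
    also have "\<dots> = (\<Sum>b\<in>{a \<in> int_partitions s. size a = i}. fls_const (fact i * (1 / of_nat (sym_factor b) * (\<Prod>k\<in>#b. X_coeff \<kappa> k))) * fls_X ^ (2 * s))"
    proof (rule sum.cong[OF refl])
      fix b assume b: "b \<in> {a \<in> int_partitions s. size a = i}"
      then have "k \<noteq> 0" if "k \<in># b" for k using that by (metis int_partitions_iff mem_Collect_eq)
      then have "(\<Prod>k\<in>#b. C $ k) = (\<Prod>k\<in>#b. fls_const (X_coeff \<kappa> k) * fls_X ^ (2 * k))"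
        by (intro arg_cong[of _ _ prod_mset] image_mset_cong) (auto simp: C_def Suc_le_eq)
      also have "\<dots> = fls_const (\<Prod>k\<in>#b. X_coeff \<kappa> k) * fls_X ^ (2 * s)"
        using b by (simp add: fls_const_prod_mset int_partitions_iff)
      finally have "(\<Prod>k\<in>#b. C $ k) = fls_const (\<Prod>k\<in>#b. X_coeff \<kappa> k) * fls_X ^ (2 * s)" .
      moreover have "(of_nat (card (permutations_of_multiset b)) :: 'a fls fls) = fls_const (fact i * (1 / of_nat (sym_factor b)))"
      proof -
        have "card (permutations_of_multiset b) * sym_factor b = fact i"
          using card_permutations_of_multiset_sym_factor[of b] b by simp
        then have "of_nat (card (permutations_of_multiset b)) * of_nat (sym_factor b) = (fact i :: 'a fls)"
          by (metis of_nat_mult of_nat_fact)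
        then have "of_nat (card (permutations_of_multiset b)) = (fact i * (1 / of_nat (sym_factor b)) :: 'a fls)"
          using sym_factor_pos[of b] by (simp add: field_simps)
        then show ?thesis by (metis fls_of_nat)
      qed
      ultimately show "of_nat (card (permutations_of_multiset b)) * (\<Prod>k\<in>#b. C $ k) =
        fls_const (fact i * (1 / of_nat (sym_factor b) * (\<Prod>k\<in>#b. X_coeff \<kappa> k))) * fls_X ^ (2 * s)"
        by (simp only: mult.assoc[symmetric] fls_const_mult_const)
    qed
    also have "\<dots> = fls_const (fact i * multi_coeff \<kappa> s i) * fls_X ^ (2 * s)"
      unfolding multi_coeff_def sum_distrib_left sum_distrib_right[symmetric]
      by (simp only: fls_const_sum)
    finally show ?thesis .
  qed
  show ?thesis
    unfolding pow fps_X_power_mult_nth fps_nth_compose_X_power coeff by (auto simp: not_less)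
qed

text \<open>Every term of the exponent has one more \<open>u\<close> than hbar. The two degrees thus
  fix the number of factors, and a single term of the exponential series survives.\<close>

lemma exp_exponent_ser_nth:
  "((fps_exp 1 oo exponent_ser \<kappa>) $ Suc m) $$ d =
    (if even d \<and> 0 \<le> d \<and> d \<le> int m + 1 then multi_coeff \<kappa> (nat d div 2) (Suc m - nat d) else 0)"
proof -
  have "((fps_exp 1 oo exponent_ser \<kappa>) $ Suc m) $$ d = (\<Sum>i=0..Suc m. ((1 / fact i) * (exponent_ser \<kappa> ^ i) $ Suc m) $$ d)"
    by (simp add: fps_compose_nth fls_nth_sum)
  also have "\<dots> = (\<Sum>i=0..Suc m. if even (Suc m - i) \<and> d = int (Suc m - i) then multi_coeff \<kappa> ((Suc m - i) div 2) i else 0)"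
  proof (rule sum.cong[OF refl])
    fix i assume i: "i \<in> {0..Suc m}"
    have "(1 / fact i :: 'a fls fls) = fls_const (1 / fact i)"
      by (metis inverse_of_nat_fls of_nat_fact)
    then have "(1 / fact i) * (fls_const (fact i * multi_coeff \<kappa> ((Suc m - i) div 2) i) * fls_X ^ (Suc m - i)) =
       fls_const (1 / fact i * (fact i * multi_coeff \<kappa> ((Suc m - i) div 2) i)) * fls_X ^ (Suc m - i)"
      by (simp only: mult.assoc[symmetric] fls_const_mult_const)
    also have "1 / fact i * (fact i * multi_coeff \<kappa> ((Suc m - i) div 2) i) = multi_coeff \<kappa> ((Suc m - i) div 2) i"
      by simp
    finally have eq: "(1 / fact i) * (fls_const (fact i * multi_coeff \<kappa> ((Suc m - i) div 2) i) * fls_X ^ (Suc m - i)) =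
       fls_const (multi_coeff \<kappa> ((Suc m - i) div 2) i) * fls_X ^ (Suc m - i)" .
    have "((1 / fact i) * (exponent_ser \<kappa> ^ i) $ Suc m) =
       (if even (Suc m - i) then fls_const (multi_coeff \<kappa> ((Suc m - i) div 2) i) * fls_X ^ (Suc m - i) else 0)"
      unfolding exponent_ser_power_nth using i eq by simp
    then show "((1 / fact i) * (exponent_ser \<kappa> ^ i) $ Suc m) $$ d =
       (if even (Suc m - i) \<and> d = int (Suc m - i) then multi_coeff \<kappa> ((Suc m - i) div 2) i else 0)"
      by (auto simp: fls_X_power_conv_shift_1)
  qed
  also have "\<dots> = (\<Sum>i=0..Suc m. if i = Suc m - nat d then (if even d \<and> 0 \<le> d \<and> d \<le> int m + 1 then multi_coeff \<kappa> (nat d div 2) (Suc m - nat d) else 0) else 0)"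
  proof (rule sum.cong[OF refl])
    fix i assume i: "i \<in> {0..Suc m}"
    show "(if even (Suc m - i) \<and> d = int (Suc m - i) then multi_coeff \<kappa> ((Suc m - i) div 2) i else 0) =
      (if i = Suc m - nat d then (if even d \<and> 0 \<le> d \<and> d \<le> int m + 1 then multi_coeff \<kappa> (nat d div 2) (Suc m - nat d) else 0) else 0)"
    proof (cases "d = int (Suc m - i)")
      case True
      then have "nat d = Suc m - i" "d \<le> int m + 1" "Suc m - nat d = i" "even d \<longleftrightarrow> even (Suc m - i)" "0 \<le> d" using i by auto
      then show ?thesis using True by (simp only:) auto
    next
      case False
      then have "\<not> (i = Suc m - nat d \<and> 0 \<le> d \<and> d \<le> int m + 1)" using i by auto
      then show ?thesis using False by auto
    qed
  qed
  also have "\<dots> = (if even d \<and> 0 \<le> d \<and> d \<le> int m + 1 then multi_coeff \<kappa> (nat d div 2) (Suc m - nat d) else 0)"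
    by simp
  finally show ?thesis .
qed

lemma exp_over_hu_nth:
  "(exp_over_hu \<kappa> $$ int m) $$ d = ((fps_exp 1 oo exponent_ser \<kappa>) $ Suc m) $$ (d + 1)"
proof -
  have "inverse (fls_const fls_X * fls_X) = (fls_const fls_X_inv * fls_X_inv :: 'a fls fls fls)"
    by (simp add: fls_inverse_const fls_inverse_X)
  then have "exp_over_hu \<kappa> = fls_const fls_X_inv * (fls_X_inv * fps_to_fls (fps_exp 1 oo exponent_ser \<kappa>))"
    unfolding exp_over_hu_def divide_inverse by (simp only: mult_ac)
  then have "exp_over_hu \<kappa> $$ int m = fls_X_inv * (fps_exp 1 oo exponent_ser \<kappa>) $ Suc m"
    by (simp add: fls_X_inv_times_conv_shift nat_add_distrib)
  then show ?thesis by (simp add: fls_X_inv_times_conv_shift)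
qed

lemma d_dX_0: "- d_dX \<kappa> 0 = 0"
  by (simp add: d_dX_def)

lemma d_dX_funpow_0: "((\<lambda>F. - d_dX \<kappa> F) ^^ m) 0 = 0"
  by (induction m) (simp_all add: d_dX_0)

lemma d_dX_funpow_sum: "((\<lambda>F. - d_dX \<kappa> F) ^^ m) (\<Sum>i\<in>I. F i) = (\<Sum>i\<in>I. ((\<lambda>F. - d_dX \<kappa> F) ^^ m) (F i))"
proof (induction m)
  case (Suc m)
  have "- d_dX \<kappa> (\<Sum>i\<in>I. G i) = (\<Sum>i\<in>I. - d_dX \<kappa> (G i))" for G :: "'b \<Rightarrow> 'a fls"
    by (simp add: d_dX_def fls_deriv_sum sum_distrib_left sum_negf)
  then show ?case using Suc by simp
qed simp

lemma d_dX_funpow_const: "((\<lambda>F. - d_dX \<kappa> F) ^^ m) (fls_const c * F) = fls_const c * ((\<lambda>F. - d_dX \<kappa> F) ^^ m) F"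
proof (induction m)
  case (Suc m)
  have "- d_dX \<kappa> (fls_const c * G) = fls_const c * - d_dX \<kappa> G" for G
    by (simp add: d_dX_def)
  then show ?case using Suc by simp
qed simp

lemma hbar_lift_funpow_nth:
  assumes "f 0 = 0"
  shows "((hbar_lift f ^^ m) F) $$ d = (f ^^ m) (F $$ d)"
  by (induction m) (simp_all add: hbar_lift_nth[of f, OF assms])

text \<open>For \<open>d = 2 * g - 1\<close> the partitions are those of \<open>g\<close> into
  \<open>m + 1 - 2 * g\<close> parts. This is the source of the order \<open>2 * g + l - 1\<close>
  in the formula over partitions.\<close>

lemma hbar_term_nth:
  "hbar_term \<kappa> m $$ d = (if odd d \<and> - 1 \<le> d \<and> d \<le> int m
     then \<Sum>a\<in>{a \<in> int_partitions (nat (d + 1) div 2). size a = Suc m - nat (d + 1)}. genus_term \<kappa> m a else 0)"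
proof -
  have "hbar_term \<kappa> m $$ d = ((\<lambda>F. - d_dX \<kappa> F) ^^ m) (- (1 / fls_deriv (X_ser \<kappa>)) *
     ((fps_exp 1 oo exponent_ser \<kappa>) $ Suc m) $$ (d + 1))"
    unfolding hbar_term_def by (simp add: hbar_lift_funpow_nth d_dX_0 exp_over_hu_nth)
  also have "\<dots> = (if odd d \<and> - 1 \<le> d \<and> d \<le> int m then ((\<lambda>F. - d_dX \<kappa> F) ^^ m)
      (- (1 / fls_deriv (X_ser \<kappa>)) * multi_coeff \<kappa> (nat (d + 1) div 2) (Suc m - nat (d + 1))) else 0)"
    by (auto simp: exp_exponent_ser_nth d_dX_funpow_0)
  also have "((\<lambda>F. - d_dX \<kappa> F) ^^ m) (- (1 / fls_deriv (X_ser \<kappa>)) * multi_coeff \<kappa> s i) =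
      (\<Sum>a\<in>{a \<in> int_partitions s. size a = i}. genus_term \<kappa> m a)" for s i
  proof -
    have "- (1 / fls_deriv (X_ser \<kappa>)) * multi_coeff \<kappa> s i = (\<Sum>a\<in>{a \<in> int_partitions s. size a = i}.
       fls_const (1 / of_nat (sym_factor a)) * (- (1 / fls_deriv (X_ser \<kappa>)) * (\<Prod>k\<in>#a. X_coeff \<kappa> k)))"
      unfolding multi_coeff_def sum_distrib_left inverse_of_nat_fls by (intro sum.cong refl) (simp only: mult_ac)
    then show ?thesis by (simp only: d_dX_funpow_sum d_dX_funpow_const genus_term_def inverse_of_nat_fls)
  qed
  finally show ?thesis .
qed

text \<open>A partition of \<open>(d + 1) / 2\<close> has at most that many parts, but
  \<open>m - d\<close> are required. Hence finitely many \<open>m\<close> contribute to each degree,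
  which gives convergence.\<close>

lemma hbar_term_nth_eq_0:
  assumes "hbar_term \<kappa> m $$ d \<noteq> 0"
  shows "int m < 2 * (d + 1)"
proof (rule ccontr)
  assume le: "\<not> int m < 2 * (d + 1)"
  from assms have d: "odd d" "- 1 \<le> d" "d \<le> int m"
    by (auto simp: hbar_term_nth split: if_splits)
  obtain t where t: "d + 1 = 2 * t" using d(1) by (metis evenE odd_one odd_add)
  define s where "s = nat t"
  have s: "nat (d + 1) div 2 = s" "Suc m - nat (d + 1) > s" using le d t by (auto simp: s_def)
  have "size a \<noteq> Suc m - nat (d + 1)" if "a \<in> int_partitions s" for a
    using size_le_int_partitions[OF that] s(2) by linarith
  then have none: "{a \<in> int_partitions s. size a = Suc m - nat (d + 1)} = {}" by blast
  have "hbar_term \<kappa> m $$ d = 0" unfolding hbar_term_nth s(1) none by simp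
  with assms show False by simp
qed

theorem hbar_series:
  assumes g: "g \<ge> 1"
  shows "summable (hbar_term \<kappa>)"
    and "suminf (hbar_term \<kappa>) $$ (2 * int g - 1) = (\<Sum>a\<in>int_partitions g. genus_term \<kappa> (2 * g + size a - 1) a)"
proof -
  define M :: "int \<Rightarrow> nat" where "M d = nat (2 * (d + 1))" for d
  have M: "\<And>m d. hbar_term \<kappa> m $$ d \<noteq> 0 \<Longrightarrow> m < M d" "mono M" "\<And>d. d < - 1 \<Longrightarrow> M d = 0"
    using hbar_term_nth_eq_0[of \<kappa>] by (fastforce simp: M_def intro!: monoI)+
  show "summable (hbar_term \<kappa>)" using M by (rule fls_summable_coefficientwise)
  have "suminf (hbar_term \<kappa>) $$ (2 * int g - 1) = (\<Sum>m<M (2 * int g - 1). hbar_term \<kappa> m $$ (2 * int g - 1))"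
    using M by (rule fls_summable_coefficientwise)
  \<comment> \<open>The number of parts \<open>m + 1 - 2 * g\<close> of a partition of
    \<open>g \<ge> 1\<close> lies between \<open>1\<close> and \<open>g\<close>.\<close>
  also have "\<dots> = (\<Sum>m\<in>{2 * g..<3 * g}. hbar_term \<kappa> m $$ (2 * int g - 1))"
  proof (rule sum.mono_neutral_right)
    show "{2 * g..<3 * g} \<subseteq> {..<M (2 * int g - 1)}" by (auto simp: M_def)
    show "\<forall>m\<in>{..<M (2 * int g - 1)} - {2 * g..<3 * g}. hbar_term \<kappa> m $$ (2 * int g - 1) = 0"
    proof
      fix m assume m: "m \<in> {..<M (2 * int g - 1)} - {2 * g..<3 * g}"
      have eq: "nat (2 * int g - 1 + 1) = 2 * g" "2 * g div 2 = g" by simp_all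
      show "hbar_term \<kappa> m $$ (2 * int g - 1) = 0"
      proof (cases "2 * int g - 1 \<le> int m")
        case True
        have "size a \<noteq> Suc m - 2 * g" if a: "a \<in> int_partitions g" for a
        proof
          assume l: "size a = Suc m - 2 * g"
          have "a \<noteq> {#}" using a g by (auto simp: int_partitions_iff)
          then have "size a \<noteq> 0" by simp
          then show False using l m True size_le_int_partitions[OF a] by auto
        qed
        then have none: "{a \<in> int_partitions g. size a = Suc m - 2 * g} = {}" by blast
        show ?thesis unfolding hbar_term_nth eq none by simp
      qed (simp add: hbar_term_nth)
    qed
  qed auto
  also have "\<dots> = (\<Sum>l=1..g. hbar_term \<kappa> (2 * g + l - 1) $$ (2 * int g - 1))"
    by (rule sum.reindex_bij_witness[of _ "\<lambda>l. 2 * g + l - 1" "\<lambda>m. m + 1 - 2 * g"]) auto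
  also have "\<dots> = (\<Sum>l=1..g. \<Sum>a\<in>{a \<in> int_partitions g. size a = l}. genus_term \<kappa> (2 * g + l - 1) a)"
  proof (rule sum.cong[OF refl])
    fix l assume l: "l \<in> {1..g}"
    have *: "nat (2 * int g - 1 + 1) = 2 * g" "Suc (2 * g + l - 1) - 2 * g = l" "2 * g div 2 = g"
      "odd (2 * int g - 1)" "- 1 \<le> 2 * int g - 1" "2 * int g - 1 \<le> int (2 * g + l - 1)" using l g by auto
    show "hbar_term \<kappa> (2 * g + l - 1) $$ (2 * int g - 1) = (\<Sum>a\<in>{a \<in> int_partitions g. size a = l}. genus_term \<kappa> (2 * g + l - 1) a)"
      unfolding hbar_term_nth * using *(4-6) by (simp only: simp_thms if_True)
  qed
  also have "\<dots> = (\<Sum>a\<in>int_partitions g. genus_term \<kappa> (2 * g + size a - 1) a)"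
    by (rule sum_int_partitions_by_size[OF g])
  finally show "suminf (hbar_term \<kappa>) $$ (2 * int g - 1) = (\<Sum>a\<in>int_partitions g. genus_term \<kappa> (2 * g + size a - 1) a)" .
qed

theorem theorem3p1:
  fixes \<kappa> :: "nat \<Rightarrow> 'a::field_char_0" and g :: nat
  assumes "g \<ge> 1"
  shows "subst_X \<kappa> (W_per \<kappa> g) =
           (\<Sum>l=1..g. \<Sum>a\<in>{a \<in> int_partitions g. size a = l}.
              1 / of_nat (sym_factor a) *
              ((\<lambda>F. - d_dX \<kappa> F) ^^ (2 * g + l - 1))
                (- (1 / fls_deriv (X_ser \<kappa>)) * (\<Prod>i\<in>#a. X_coeff \<kappa> i)))
         \<and> summable (hbar_term \<kappa>)
         \<and> subst_X \<kappa> (W_per \<kappa> g) = (\<Sum>m. hbar_term \<kappa> m) $$ (2 * int g - 1)"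
  using subst_X_W_per[OF assms, of \<kappa>] hbar_series[OF assms, of \<kappa>]
    sum_int_partitions_by_size[OF assms, of "\<lambda>a l. genus_term \<kappa> (2 * g + l - 1) a"]
  by (simp only: genus_term_def)

end
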